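(* Let $T>0$ and let $\omega:\mathbb{R}\times[-T,T]\rightarrow\mathbb{R}$ be a smooth function which is singly-periodic (i.e. there is $L>0$ with $\omega(x+L,y)=\omega(x,y)$ for all $(x,y)$), which solves the elliptic sinh-Gordon equation $$\omega_{z\overline z}+\tfrac18\sinh(2\omega)=0,$$ and which satisfies Durham boundary conditions, i.e. along each of the two boundary components $\mathbb{R}\times\{T\}$ and $\mathbb{R}\times\{-T\}$ there are real constants $A,B$ (possibly different for the two components) such that $\omega_y=Ae^{\omega}+Be^{-\omega}$ on that component. Then $\omega$ is of finite type.
   Context: Write $z=x+iy$ and $\Omega=\mathbb{R}\times[-T,T]\subset\mathbb{C}$; smooth means smooth up to the boundary. Let $\sigma_0=\begin{pmatrix}1&0\\0&-1\end{pmatrix}$, $\sigma_+=\begin{pmatrix}0&1\\0&0\end{pmatrix}$, $\sigma_-=\begin{pmatrix}0&0\\1&0\end{pmatrix}$. For $\lambda,\gamma\in\mathbb{C}^*$ the Lax pair of $\omega$ is the $1$-form $\alpha(\lambda,\gamma)=\alpha_z\,dz+\alpha_{\overline z}\,d\overline z$ with $$\alpha_z=\tfrac12\omega_z\sigma_0+\tfrac{i}{4\lambda}e^{\omega}\sigma_++\tfrac{i\gamma}{4}e^{-\omega}\sigma_-,\qquad \alpha_{\overline z}=-\tfrac12\omega_{\overline z}\sigma_0+\tfrac{i}{4\gamma}e^{-\omega}\sigma_++\tfrac{i\lambda}{4}e^{\omega}\sigma_-.$$ A Killing field of $\omega$ is a function $\Phi:\mathbb{C}^*\times\mathbb{C}^*\rightarrow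 C^\infty(\Omega,\mathfrak{sl}_2(\mathbb{C}))$ with $d\Phi(\lambda,\gamma)=[\Phi(\lambda,\gamma),\alpha(\lambda,\gamma)]$ for all $\lambda,\gamma\in\mathbb{C}^*$. It is polynomial if $\Phi(\lambda,\gamma)=\sum_{(m,n)\in F}\Phi_{m,n}\lambda^m\gamma^n$ for some finite $F\subset\mathbb{Z}\times\mathbb{Z}$ and smooth functions $\Phi_{m,n}:\Omega\rightarrow\mathfrak{sl}_2(\mathbb{C})$. The solution $\omega$ is of finite type if it admits a polynomial Killing field which is not identically zero. *)

theory Defs
  imports "HOL-Analysis.Analysis"
begin

definition strip :: "real \<Rightarrow> complex set" where
  "strip T = {z. - T \<le> Im z \<and> Im z \<le> T}"

text \<open>
  Smoothness up to the boundary: all iterated derivatives are taken within the set.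
  This is meant for convex sets with nonempty interior, such as \<^term>\<open>strip T\<close> with
  \<^term>\<open>T > 0\<close>, where the derivative within the set is unique also at boundary points,
  so that \<^const>\<open>frechet_derivative\<close> does not depend on a choice.
\<close>

primrec Ck_on :: "nat \<Rightarrow> 'a::real_normed_vector set \<Rightarrow> ('a \<Rightarrow> 'b::real_normed_vector) \<Rightarrow> bool" where
  "Ck_on 0 S f \<longleftrightarrow> continuous_on S f"
| "Ck_on (Suc k) S f \<longleftrightarrow>
     f differentiable_on S \<and> (\<forall>v. Ck_on k S (\<lambda>x. frechet_derivative f (at x within S) v))"

definition smooth_on :: "'a::real_normed_vector set \<Rightarrow> ('a \<Rightarrow> 'b::real_normed_vector) \<Rightarrow> bool" where
  "smooth_on S f \<longleftrightarrow> (\<forall>k. Ck_on k S f)"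

text \<open>
  The partial derivatives and the Wirtinger derivatives on the strip; one-sided in the
  vertical direction at boundary points.
\<close>

definition partial_x :: "real \<Rightarrow> (complex \<Rightarrow> 'a::real_normed_vector) \<Rightarrow> complex \<Rightarrow> 'a" where
  "partial_x T f z = frechet_derivative f (at z within strip T) 1"

definition partial_y :: "real \<Rightarrow> (complex \<Rightarrow> 'a::real_normed_vector) \<Rightarrow> complex \<Rightarrow> 'a" where
  "partial_y T f z = frechet_derivative f (at z within strip T) \<i>"

definition d_z :: "real \<Rightarrow> (complex \<Rightarrow> complex) \<Rightarrow> complex \<Rightarrow> complex" where
  "d_z T f z = (partial_x T f z - \<i> * partial_y T f z) / 2"

definition d_zbar :: "real \<Rightarrow> (complex \<Rightarrow> complex) \<Rightarrow> complex \<Rightarrow> complex" where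
  "d_zbar T f z = (partial_x T f z + \<i> * partial_y T f z) / 2"

definition singly_periodic :: "real \<Rightarrow> (complex \<Rightarrow> real) \<Rightarrow> bool" where
  "singly_periodic T \<omega> \<longleftrightarrow> (\<exists>L>0. \<forall>z\<in>strip T. \<omega> (z + of_real L) = \<omega> z)"

definition sinh_gordon :: "real \<Rightarrow> (complex \<Rightarrow> real) \<Rightarrow> bool" where
  "sinh_gordon T \<omega> \<longleftrightarrow>
     (\<forall>z\<in>strip T. d_zbar T (d_z T (\<lambda>w. of_real (\<omega> w))) z + of_real (sinh (2 * \<omega> z)) / 8 = 0)"

definition durham_boundary :: "real \<Rightarrow> (complex \<Rightarrow> real) \<Rightarrow> bool" where
  "durham_boundary T \<omega> \<longleftrightarrow>
     (\<forall>y\<in>{T, - T}. \<exists>A B. \<forall>z. Im z = y \<longrightarrow>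
        partial_y T \<omega> z = A * exp (\<omega> z) + B * exp (- \<omega> z))"

type_synonym cmat2 = "complex^2^2"

definition mat_scale :: "complex \<Rightarrow> cmat2 \<Rightarrow> cmat2" (infixr \<open>*\<^sub>M\<close> 75) where
  "c *\<^sub>M A = (\<chi> i j. c * A $ i $ j)"

definition bracket :: "cmat2 \<Rightarrow> cmat2 \<Rightarrow> cmat2" where
  "bracket A B = A ** B - B ** A"

definition sl2 :: "cmat2 set" where
  "sl2 = {A. trace A = 0}"

definition sigma_0 :: cmat2 where
  "sigma_0 = vector [vector [1, 0], vector [0, - 1]]"

definition sigma_plus :: cmat2 where
  "sigma_plus = vector [vector [0, 1], vector [0, 0]]"

definition sigma_minus :: cmat2 where
  "sigma_minus = vector [vector [0, 0], vector [1, 0]]"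

definition lax_z :: "real \<Rightarrow> (complex \<Rightarrow> real) \<Rightarrow> complex \<Rightarrow> complex \<Rightarrow> complex \<Rightarrow> cmat2" where
  "lax_z T \<omega> l g z =
     (d_z T (\<lambda>w. of_real (\<omega> w)) z / 2) *\<^sub>M sigma_0
     + (\<i> / (4 * l) * of_real (exp (\<omega> z))) *\<^sub>M sigma_plus
     + (\<i> * g / 4 * of_real (exp (- \<omega> z))) *\<^sub>M sigma_minus"

definition lax_zbar :: "real \<Rightarrow> (complex \<Rightarrow> real) \<Rightarrow> complex \<Rightarrow> complex \<Rightarrow> complex \<Rightarrow> cmat2" where
  "lax_zbar T \<omega> l g z =
     (- (d_zbar T (\<lambda>w. of_real (\<omega> w)) z / 2)) *\<^sub>M sigma_0
     + (\<i> / (4 * g) * of_real (exp (- \<omega> z))) *\<^sub>M sigma_plus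
     + (\<i> * l / 4 * of_real (exp (\<omega> z))) *\<^sub>M sigma_minus"

text \<open>
  A one-form is a function of a point \<open>z\<close> and a tangent vector \<open>v\<close>, with
  \<open>dz v = v\<close> and \<open>d(cnj z) v = cnj v\<close>.
\<close>

definition lax_form :: "real \<Rightarrow> (complex \<Rightarrow> real) \<Rightarrow> complex \<Rightarrow> complex \<Rightarrow> complex \<Rightarrow> complex \<Rightarrow> cmat2" where
  "lax_form T \<omega> l g z v = v *\<^sub>M lax_z T \<omega> l g z + cnj v *\<^sub>M lax_zbar T \<omega> l g z"

definition killing_field ::
  "real \<Rightarrow> (complex \<Rightarrow> real) \<Rightarrow> (complex \<Rightarrow> complex \<Rightarrow> complex \<Rightarrow> cmat2) \<Rightarrow> bool" where
  "killing_field T \<omega> \<Phi> \<longleftrightarrow>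
     (\<forall>l g. l \<noteq> 0 \<longrightarrow> g \<noteq> 0 \<longrightarrow>
        smooth_on (strip T) (\<Phi> l g) \<and>
        \<Phi> l g ` strip T \<subseteq> sl2 \<and>
        (\<forall>z\<in>strip T. (\<Phi> l g has_derivative (\<lambda>v. bracket (\<Phi> l g z) (lax_form T \<omega> l g z v)))
                       (at z within strip T)))"

definition polynomial_field :: "real \<Rightarrow> (complex \<Rightarrow> complex \<Rightarrow> complex \<Rightarrow> cmat2) \<Rightarrow> bool" where
  "polynomial_field T \<Phi> \<longleftrightarrow>
     (\<exists>(F :: (int \<times> int) set) (C :: int \<Rightarrow> int \<Rightarrow> complex \<Rightarrow> cmat2).
        finite F \<and>
        (\<forall>(m, n)\<in>F. smooth_on (strip T) (C m n) \<and> C m n ` strip T \<subseteq> sl2) \<and>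
        (\<forall>l g. l \<noteq> 0 \<longrightarrow> g \<noteq> 0 \<longrightarrow>
           (\<forall>z\<in>strip T. \<Phi> l g z = (\<Sum>(m, n)\<in>F. (l powi m * g powi n) *\<^sub>M C m n z))))"

definition finite_type :: "real \<Rightarrow> (complex \<Rightarrow> real) \<Rightarrow> bool" where
  "finite_type T \<omega> \<longleftrightarrow>
     (\<exists>\<Phi>. killing_field T \<omega> \<Phi> \<and> polynomial_field T \<Phi> \<and>
          (\<exists>l g. l \<noteq> 0 \<and> g \<noteq> 0 \<and> (\<exists>z\<in>strip T. \<Phi> l g z \<noteq> 0)))"

end

theory Submission
  imports Defs "HOL-Computational_Algebra.Polynomial"
begin

text \<open>
  For every spectral parameter \<open>\<mu> = \<lambda> / \<gamma>\<close>, the monodromy over one period of the flat Lax connection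
  is a Killing field, and its diagonal entry \<open>f\<close> solves the linearised equation
  \<open>\<Delta>f + cosh (2 \<omega>) f = 0\<close>. On a boundary component with \<open>\<omega>\<^sub>y = A e\<^sup>\<omega> + B e\<^sup>-\<^sup>\<omega>\<close>, a constant matrix
  intertwines the monodromies at \<open>\<mu>\<close> and \<open>1 / \<mu>\<close>, so that \<open>u = f(\<mu>) - f(1 / \<mu>)\<close> satisfies the linearised
  Robin condition \<open>u\<^sub>y = (A e\<^sup>\<omega> - B e\<^sup>-\<^sup>\<omega>) u\<close> on both components, whatever their constants are.

  The periodic solutions of this elliptic boundary value problem form a finite-dimensional space:
  the Dirichlet energy of a solution is bounded by its square integral, so by the Poincare inequality
  a solution whose means over the cells of a fine grid all vanish is zero. Hence there is a nontrivial
  relation \<open>\<Sum> c\<^sub>j f(\<mu>\<^sub>j) = 0\<close> between finitely many of the entries. Such a relation is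
  precisely what is needed for the sum of \<open>c\<^sub>j / (\<mu> - \<mu>\<^sub>j)\<close> times the Killing field at \<open>\<mu>\<^sub>j\<close>, up to a rescaling
  of one entry, to be a Killing field for all \<open>\<mu>\<close>. Clearing denominators makes it polynomial, and it is
  nonzero because the monodromy is not scalar for negative \<open>\<mu>\<close> near \<open>0\<close>.
\<close>

section \<open>Linear differential equations\<close>

text \<open>The Robin condition arises because the \<open>y\<close>-derivative of \<open>f\<close>
  involves the off-diagonal entries \<open>g\<close>, \<open>h\<close> only through
  \<open>g + h\<close> and \<open>l * g + h / l\<close>. On a boundary line the tangential
  connection combines two constant matrices, with weights exp \<omega> and exp (- \<omega>) up to a
  constant. The traces of the monodromy against these matrices contain exactly those two
  expressions, together with \<open>f\<close>. As \<open>kmat\<close> intertwines the monodromy and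
  both matrices at \<open>l\<close> with those at \<open>1 / l\<close>, the traces agree, which
  eliminates \<open>g\<close> and \<open>h\<close>, but only from the difference of the two
  parameters. The matrix \<open>kmat\<close> depends on the boundary component, the difference does
  not; this is how different constants are accommodated. Finite dimension enters as a count:
  \<open>n * n\<close> cell means determine a solution, so \<open>n * n + 1\<close> pairs of
  parameters yield a relation. One member of each pair is negative and close to 0, which serves
  three ends: an off-diagonal entry of its monodromy is nonzero, \<open>kmat\<close> is invertible,
  and all parameters and their inverses are distinct, so that the relation between differences stays
  nontrivial as a relation between single entries.\<close>

lemma gronwall_norm:
  fixes D :: "real \<Rightarrow> 'a::real_inner"
  assumes der: "\<And>t. t \<in> {0..1} \<Longrightarrow> (D has_vector_derivative D' t) (at t within {0..1})"
    and bound: "\<And>t. t \<in> {0..1} \<Longrightarrow> norm (D' t) \<le> K * norm (D t) + e"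
    and K: "0 \<le> K" and t: "t \<in> {0..1}"
  shows "(norm (D t))\<^sup>2 \<le> ((norm (D 0))\<^sup>2 + e\<^sup>2) * exp (2 * K + 1)"
proof -
  \<comment> \<open>The summand \<open>e\<^sup>2\<close> absorbs the inhomogeneity: as
    \<open>2 * norm (D s) * e\<close> is at most the sum of the two squares, the derivative of
    \<open>D s \<bullet> D s + e\<^sup>2\<close> is at most \<open>2 * K + 1\<close> times that
    quantity itself.\<close>
  define \<psi> where "\<psi> s = (D s \<bullet> D s + e\<^sup>2) * exp (- (2 * K + 1) * s)" for s
  have cont: "continuous_on {0..1} D"
    using der by (meson continuous_on_eq_continuous_within has_vector_derivative_continuous)
  have "\<psi> t \<le> \<psi> 0"
  proof (rule DERIV_nonpos_imp_decreasing_open[of 0 t \<psi>])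
    show "0 \<le> t" using t by simp
    fix s assume s: "0 < s" "s < t"
    then have s1: "s \<in> {0..1}" and s2: "s < 1" using t by auto
    have D: "(D has_vector_derivative D' s) (at s)"
      using der[OF s1] s s2 by (simp add: at_within_Icc_at)
    have "((\<lambda>s. D s \<bullet> D s) has_real_derivative 2 * (D s \<bullet> D' s)) (at s)"
      using has_derivative_inner[OF D[unfolded has_vector_derivative_def] D[unfolded has_vector_derivative_def]]
      unfolding has_field_derivative_def
      by (rule has_derivative_eq_rhs) (simp add: fun_eq_iff inner_commute)
    then have d: "(\<psi> has_real_derivative 2 * (D s \<bullet> D' s) * exp (- (2 * K + 1) * s)
        + (D s \<bullet> D s + e\<^sup>2) * (exp (- (2 * K + 1) * s) * (- (2 * K + 1)))) (at s)"
      unfolding \<psi>_def by (auto intro!: derivative_eq_intros)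
    have "2 * (D s \<bullet> D' s) \<le> 2 * (norm (D s) * (K * norm (D s) + e))"
      using norm_cauchy_schwarz[of "D s" "D' s"] bound[OF s1]
        mult_left_mono[OF bound[OF s1] norm_ge_zero[of "D s"]] by linarith
    also have "\<dots> \<le> (2 * K + 1) * (norm (D s))\<^sup>2 + e\<^sup>2"
      using sum_squares_bound[of "norm (D s)" e] by (simp add: algebra_simps power2_eq_square)
    also have "\<dots> \<le> (2 * K + 1) * (D s \<bullet> D s + e\<^sup>2)"
      using mult_nonneg_nonneg[OF K zero_le_power2[of e]] by (simp add: dot_square_norm algebra_simps)
    finally have le: "2 * (D s \<bullet> D' s) - (2 * K + 1) * (D s \<bullet> D s + e\<^sup>2) \<le> 0" by simp
    have "2 * (D s \<bullet> D' s) * exp (- (2 * K + 1) * s)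
        + (D s \<bullet> D s + e\<^sup>2) * (exp (- (2 * K + 1) * s) * (- (2 * K + 1)))
      = (2 * (D s \<bullet> D' s) - (2 * K + 1) * (D s \<bullet> D s + e\<^sup>2)) * exp (- (2 * K + 1) * s)"
      by (simp add: algebra_simps)
    also have "\<dots> \<le> 0" using le by (simp add: mult_nonpos_nonneg)
    finally show "\<exists>y. (\<psi> has_real_derivative y) (at s) \<and> y \<le> 0" using d by blast
  next
    show "continuous_on {0..t} \<psi>" unfolding \<psi>_def
      using t by (auto intro!: continuous_intros continuous_on_subset[OF cont])
  qed
  then have "(D t \<bullet> D t + e\<^sup>2) * exp (- (2 * K + 1) * t) \<le> D 0 \<bullet> D 0 + e\<^sup>2"
    by (simp add: \<psi>_def)
  from mult_right_mono[OF this exp_ge_zero[of "(2 * K + 1) * t"]]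
  have "D t \<bullet> D t + e\<^sup>2 \<le> (D 0 \<bullet> D 0 + e\<^sup>2) * exp ((2 * K + 1) * t)"
    unfolding mult.assoc by (simp add: mult_exp_exp algebra_simps)
  also have "\<dots> \<le> (D 0 \<bullet> D 0 + e\<^sup>2) * exp (2 * K + 1)"
    using t K by (intro mult_left_mono) (auto simp: mult_left_le)
  finally show ?thesis by (simp add: dot_square_norm) (smt (verit) zero_le_power2)
qed

text \<open>Picard iteration written as a series: \<open>u n\<close> is the \<open>n\<close>-th
  increment, an iterated integral dominated by a term of the exponential series. The solution is
  then obtained by termwise differentiation, which needs uniform convergence of the derivatives
  only.\<close>

lemma linear_ode_exists:
  fixes A :: "real \<Rightarrow> 'a::banach \<Rightarrow>\<^sub>L 'a"
  assumes A: "continuous_on {0..1} A"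
  shows "\<exists>U. U 0 = u0 \<and> (\<forall>t\<in>{0..1}. (U has_vector_derivative A t (U t)) (at t within {0..1}))"
proof -
  have "compact (A ` {0..1})" using A compact_continuous_image by blast
  then obtain K where K0: "K > 0" and K: "\<And>t. t \<in> {0..1} \<Longrightarrow> norm (A t) \<le> K"
    using compact_imp_bounded bounded_pos by (metis imageI)
  define u where "u = rec_nat (\<lambda>t. u0) (\<lambda>_ v t. integral {0..t} (\<lambda>s. A s (v s)))"
  have u0: "u 0 = (\<lambda>t. u0)" and uSuc: "\<And>n. u (Suc n) = (\<lambda>t. integral {0..t} (\<lambda>s. A s (u n s)))"
    by (simp_all add: u_def)
  have cont: "continuous_on {0..1} (u n)" for n
  proof (induction n)
    case (Suc n)
    then show ?case unfolding uSuc
      by (intro indefinite_integral_continuous_1 integrable_continuous_real continuous_intros A)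
  qed (simp add: u0)
  have contA: "continuous_on {0..1} (\<lambda>s. A s (u n s))" for n
    by (intro continuous_intros A cont)
  have der: "(u (Suc n) has_vector_derivative A t (u n t)) (at t within {0..1})"
    if "t \<in> {0..1}" for n t
    unfolding uSuc using integral_has_vector_derivative[OF contA that] .
  have bound: "norm (u n t) \<le> norm u0 * (K * t) ^ n / fact n" if "t \<in> {0..1}" for n t
    using that
  proof (induction n arbitrary: t)
    case (Suc n)
    have *: "((\<lambda>s. K * (norm u0 * (K * s) ^ n / fact n)) has_integral
        norm u0 * (K * t) ^ Suc n / fact (Suc n) - norm u0 * (K * 0) ^ Suc n / fact (Suc n)) {0..t}"
    proof (rule fundamental_theorem_of_calculus)
      show "0 \<le> t" using Suc by simp
      fix s assume "s \<in> {0..t}"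
      have "((\<lambda>s. norm u0 * (K * s) ^ Suc n / fact (Suc n)) has_real_derivative
         norm u0 * (real (Suc n) * (K * s) ^ n * K) / fact (Suc n)) (at s within {0..t})"
        by (intro DERIV_cdivide DERIV_cmult)
          (use DERIV_power_Suc[OF DERIV_cmult_Id[of K s "{0..t}"], of n] in \<open>simp add: ac_simps\<close>)
      moreover have "norm u0 * (real (Suc n) * (K * s) ^ n * K) / fact (Suc n)
          = K * (norm u0 * (K * s) ^ n / fact n)"
        by (simp add: field_simps del: of_nat_Suc)
      ultimately show "((\<lambda>s. norm u0 * (K * s) ^ Suc n / fact (Suc n)) has_vector_derivative
         K * (norm u0 * (K * s) ^ n / fact n)) (at s within {0..t})"
        by (simp only: has_real_derivative_iff_has_vector_derivative)
    qed
    have "norm (u (Suc n) t) \<le> integral {0..t} (\<lambda>s. K * (norm u0 * (K * s) ^ n / fact n))"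
      unfolding uSuc
    proof (rule integral_norm_bound_integral)
      show "(\<lambda>s. A s (u n s)) integrable_on {0..t}"
        using Suc.prems by (intro integrable_continuous_real continuous_on_subset[OF contA]) auto
      show "(\<lambda>s. K * (norm u0 * (K * s) ^ n / fact n)) integrable_on {0..t}" using * by blast
      fix s assume "s \<in> {0..t}"
      then have s: "s \<in> {0..1}" using Suc.prems by auto
      have "norm (A s (u n s)) \<le> norm (A s) * norm (u n s)" by (rule norm_blinfun)
      also have "\<dots> \<le> K * (norm u0 * (K * s) ^ n / fact n)"
        using K[OF s] Suc.IH[OF s] K0 by (intro mult_mono) auto
      finally show "norm (A s (u n s)) \<le> K * (norm u0 * (K * s) ^ n / fact n)" .
    qed
    then show ?case using integral_unique[OF *] by simp
  qed (simp add: u0)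
  define M where "M n = norm u0 * (K ^ n / fact n)" for n
  have sM: "summable M" unfolding M_def
    using summable_exp[of K] by (intro summable_mult) (simp add: divide_inverse mult.commute)
  have bM: "norm (u n t) \<le> M n" if "t \<in> {0..1}" for n t
  proof -
    have "(K * t) ^ n \<le> K ^ n" using that K0 by (intro power_mono) (auto simp: mult_left_le)
    then show ?thesis using bound[OF that, of n] unfolding M_def
      by (smt (verit) divide_right_mono fact_ge_zero mult_left_mono norm_ge_zero times_divide_eq_right)
  qed
  define V where "V t = (\<Sum>n. u n t)" for t
  have unif: "uniform_limit {0..1} (\<lambda>n t. \<Sum>i<n. u i t) V sequentially"
    unfolding V_def by (rule Weierstrass_m_test[where M = M]) (use bM sM in auto)
  have sums: "(\<lambda>n. u n t) sums V t" if "t \<in> {0..1}" for t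
    unfolding V_def by (intro summable_sums summable_comparison_test'[OF sM] bM that)
  \<comment> \<open>The derivative of the \<open>n\<close>-th term is \<open>A\<close> applied to
    the term before it, and the zeroth term is constant.\<close>
  define f' where "f' n t h = h *\<^sub>R (case n of 0 \<Rightarrow> 0 | Suc m \<Rightarrow> A t (u m t))" for n t and h :: real
  have "\<exists>g. \<forall>x\<in>{0..1}. (\<lambda>n. u n x) sums g x \<and> (g has_derivative (\<lambda>h. h *\<^sub>R A x (V x))) (at x within {0..1})"
  proof (rule has_derivative_series[where f' = f'])
    show "(u n has_derivative f' n x) (at x within {0..1})" if "x \<in> {0..1}" for n x
      unfolding f'_def using der[OF that]
      by (cases n) (auto simp: u0 has_vector_derivative_def)
    show "(\<lambda>n. u n 0) sums V 0" using sums by simp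
    show "\<forall>\<^sub>F n in sequentially. \<forall>x\<in>{0..1}. \<forall>h. norm ((\<Sum>i<n. f' i x h) - h *\<^sub>R A x (V x)) \<le> e * norm h"
      if "e > 0" for e
    proof -
      have "\<forall>\<^sub>F n in sequentially. \<forall>x\<in>{0..1}. dist (\<Sum>i<n. u i x) (V x) < e / K"
        using unif that K0 by (auto simp: uniform_limit_iff)
      then obtain N where N: "\<And>n x. n \<ge> N \<Longrightarrow> x \<in> {0..1} \<Longrightarrow> dist (\<Sum>i<n. u i x) (V x) < e / K"
        unfolding eventually_sequentially by blast
      show ?thesis unfolding eventually_sequentially
      proof (intro exI allI impI ballI)
        \<comment> \<open>The first \<open>n\<close> derivatives involve only the first
          \<open>n - 1\<close> terms of the series, hence the bound \<open>Suc N\<close>.\<close>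
        fix n x h assume n: "Suc N \<le> n" and x: "x \<in> {0..1::real}"
        then obtain m where m: "n = Suc m" "m \<ge> N" by (cases n) auto
        have "(\<Sum>i<n. f' i x h) - h *\<^sub>R A x (V x) = h *\<^sub>R A x ((\<Sum>i<m. u i x) - V x)"
          unfolding m f'_def
          by (subst sum.lessThan_Suc_shift)
             (simp add: blinfun.sum_right blinfun.diff_right scaleR_diff_right scaleR_right.sum)
        also have "norm \<dots> \<le> \<bar>h\<bar> * (K * (e / K))"
          using N[OF m(2) x] K[OF x] K0 unfolding norm_scaleR dist_norm
          by (intro mult_left_mono order.trans[OF norm_blinfun] mult_mono) auto
        finally show "norm ((\<Sum>i<n. f' i x h) - h *\<^sub>R A x (V x)) \<le> e * norm h"
          using K0 by (simp add: mult.commute)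
      qed
    qed
  qed auto
  then obtain g where g: "\<And>x. x \<in> {0..1} \<Longrightarrow> (\<lambda>n. u n x) sums g x"
    "\<And>x. x \<in> {0..1} \<Longrightarrow> (g has_derivative (\<lambda>h. h *\<^sub>R A x (V x))) (at x within {0..1})" by blast
  have gV: "g x = V x" if "x \<in> {0..1}" for x using g(1)[OF that] sums[OF that] sums_unique2 by blast
  have "u n 0 = (if n = 0 then u0 else 0)" for n by (cases n) (auto simp: u0 uSuc)
  then have "V 0 = u0" unfolding V_def using suminf_finite[of "{0}" "\<lambda>n. u n 0"] by simp
  with g(2) gV show ?thesis by (intro exI[of _ g]) (auto simp: has_vector_derivative_def)
qed

section \<open>Flat connections\<close>

text \<open>In the application \<open>(a, b)\<close> and \<open>(a', b')\<close> are the coordinates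
  of \<open>z\<close> and \<open>w\<close>, and the operators are the connection coefficients at
  \<open>s *\<^sub>R z\<close> and \<open>s *\<^sub>R w\<close>. After removal of the first-order
  part there remain Taylor remainders of the coefficients and products of two increments, all of
  them small compared with \<open>w - z\<close>.\<close>

lemma increment_expand:
  fixes Xw :: "'a::real_vector"
  shows "(a' *\<^sub>R Xw + b' *\<^sub>R Yw) - (a *\<^sub>R Xz + b *\<^sub>R Yz)
     - (((a' - a) *\<^sub>R Xz + (b' - b) *\<^sub>R Yz)
        + s *\<^sub>R (a *\<^sub>R ((a' - a) *\<^sub>R Xx + (b' - b) *\<^sub>R Xy) + b *\<^sub>R ((a' - a) *\<^sub>R Yx + (b' - b) *\<^sub>R Yy)))
   = (a *\<^sub>R (Xw - Xz - ((s * (a' - a)) *\<^sub>R Xx + (s * (b' - b)) *\<^sub>R Xy))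
      + b *\<^sub>R (Yw - Yz - ((s * (a' - a)) *\<^sub>R Yx + (s * (b' - b)) *\<^sub>R Yy)))
     + ((a' - a) *\<^sub>R (Xw - Xz) + (b' - b) *\<^sub>R (Yw - Yz))"
proof -
  define p q where "p = a' - a" and "q = b' - b"
  have *: "a' = a + p" "b' = b + q" by (auto simp: p_def q_def)
  show ?thesis unfolding * add_diff_cancel_left'
    by (simp add: scaleR_add_right scaleR_add_left scaleR_diff_right mult.left_commute)
qed

text \<open>
  The candidate for the parallel section is transported from \<open>0\<close> to \<open>z\<close> along the ray
  \<open>t \<mapsto> t z\<close>; the flatness identity is what makes the transports
  along neighbouring rays agree to first order.
\<close>

lemma flat_connection_parallel_section:
  fixes S :: "complex set" and Ax Ay Axx Axy Ayx Ayy :: "complex \<Rightarrow> 'a::{banach,real_inner} \<Rightarrow>\<^sub>L 'a"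
  assumes S: "convex S" "closed S" "0 \<in> S"
    and dAx: "\<And>z. z \<in> S \<Longrightarrow> (Ax has_derivative (\<lambda>v. Re v *\<^sub>R Axx z + Im v *\<^sub>R Axy z)) (at z within S)"
    and dAy: "\<And>z. z \<in> S \<Longrightarrow> (Ay has_derivative (\<lambda>v. Re v *\<^sub>R Ayx z + Im v *\<^sub>R Ayy z)) (at z within S)"
    and cont: "continuous_on S Axx" "continuous_on S Axy" "continuous_on S Ayx" "continuous_on S Ayy"
    and flat: "\<And>z. z \<in> S \<Longrightarrow> Ayx z + (Ay z o\<^sub>L Ax z) = Axy z + (Ax z o\<^sub>L Ay z)"
  shows "\<exists>U. U 0 = u0 \<and>
    (\<forall>z\<in>S. (U has_derivative (\<lambda>v. Re v *\<^sub>R Ax z (U z) + Im v *\<^sub>R Ay z (U z))) (at z within S))"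
proof -
  define B where "B z v = Re v *\<^sub>R Ax z + Im v *\<^sub>R Ay z" for z v
  define DB where "DB z h v = Re v *\<^sub>R (Re h *\<^sub>R Axx z + Im h *\<^sub>R Axy z)
      + Im v *\<^sub>R (Re h *\<^sub>R Ayx z + Im h *\<^sub>R Ayy z)" for z h v
  \<comment> \<open>The curvature is alternating in the two directions, so its vanishing on the
    coordinate directions suffices.\<close>
  have Bflat: "DB z h v + (B z v o\<^sub>L B z h) = DB z v h + (B z h o\<^sub>L B z v)" if "z \<in> S" for z h v
  proof -
    have "DB z h v + (B z v o\<^sub>L B z h) - (DB z v h + (B z h o\<^sub>L B z v))
       = (Re h * Im v - Im h * Re v) *\<^sub>R (Ayx z + (Ay z o\<^sub>L Ax z) - (Axy z + (Ax z o\<^sub>L Ay z)))"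
      by (rule blinfun_eqI)
         (simp add: DB_def B_def blinfun.bilinear_simps algebra_simps)
    then show ?thesis using flat[OF that] by simp
  qed
  have cA: "continuous_on S Ax" "continuous_on S Ay"
    using dAx dAy by (meson continuous_on_eq_continuous_within has_derivative_continuous)+
  have Sray: "t *\<^sub>R z \<in> S" if "z \<in> S" "t \<in> {0..1}" for t z
    using convexD[OF S(1) S(3) that(1), of "1 - t" t] that by auto
  have "\<exists>U. U 0 = u0 \<and> (\<forall>t\<in>{0..1}. (U has_vector_derivative B (t *\<^sub>R z) z (U t)) (at t within {0..1}))"
    if "z \<in> S" for z
    unfolding B_def
    by (intro linear_ode_exists continuous_intros continuous_on_compose2[OF cA(1)]
         continuous_on_compose2[OF cA(2)]) (auto intro: Sray[OF that])
  then obtain U where U0: "\<And>z. z \<in> S \<Longrightarrow> U z 0 = u0"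
    and dU: "\<And>z t. z \<in> S \<Longrightarrow> t \<in> {0..1} \<Longrightarrow>
       (U z has_vector_derivative B (t *\<^sub>R z) z (U z t)) (at t within {0..1})"
    by metis
  define V where "V z = U z 1" for z
  have "(V has_derivative (\<lambda>v. B z v (V z))) (at z within S)" if z: "z \<in> S" for z
  proof -
    \<comment> \<open>A compact convex part of \<open>S\<close> which contains a neighbourhood of
      \<open>z\<close> in \<open>S\<close> and, because it contains 0, all rays to its points.
      Bounds and moduli of continuity become uniform on it.\<close>
    define S' where "S' = S \<inter> cball 0 (norm z + 1)"
    have comp: "compact S'" unfolding S'_def using S by (simp add: closed_Int_compact)
    have conv: "convex S'" unfolding S'_def using S by (intro convex_Int convex_cball) auto
    have S'S: "S' \<subseteq> S" by (auto simp: S'_def)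
    have 0: "0 \<in> S'" and zS': "z \<in> S'" using S z by (auto simp: S'_def)
    have ray': "t *\<^sub>R w \<in> S'" if "w \<in> S'" "t \<in> {0..1}" for t w
      using convexD[OF conv 0 that(1), of "1 - t" t] that by auto
    have bd: "\<exists>k. \<forall>w\<in>S'. norm (f w) \<le> k" if "continuous_on S f" for f :: "complex \<Rightarrow> 'a \<Rightarrow>\<^sub>L 'a"
      using compact_continuous_image[OF continuous_on_subset[OF that S'S] comp]
      by (auto dest!: compact_imp_bounded simp: bounded_iff)
    then obtain k1 k2 k3 k4 k5 k6 where k:
      "\<forall>w\<in>S'. norm (Ax w) \<le> k1" "\<forall>w\<in>S'. norm (Ay w) \<le> k2"
      "\<forall>w\<in>S'. norm (Axx w) \<le> k3" "\<forall>w\<in>S'. norm (Axy w) \<le> k4"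
      "\<forall>w\<in>S'. norm (Ayx w) \<le> k5" "\<forall>w\<in>S'. norm (Ayy w) \<le> k6"
      using bd[OF cA(1)] bd[OF cA(2)] bd[OF cont(1)] bd[OF cont(2)] bd[OF cont(3)] bd[OF cont(4)]
      by (elim exE)
    define k where "k = Max {k1, k2, k3, k4, k5, k6}"
    have "k1 \<le> k" "k2 \<le> k" "k3 \<le> k" "k4 \<le> k" "k5 \<le> k" "k6 \<le> k"
      unfolding k_def by (simp_all only: Max_ge finite.intros insert_iff simp_thms)
    then have kk: "norm (Ax w) \<le> k" "norm (Ay w) \<le> k" "norm (Axx w) \<le> k"
        "norm (Axy w) \<le> k" "norm (Ayx w) \<le> k" "norm (Ayy w) \<le> k" if "w \<in> S'" for w
      using k[THEN bspec, OF that] by linarith+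
    have k0: "k \<ge> 0" using kk(1)[OF 0] norm_ge_zero order_trans by blast
    have lin: "norm (Re v *\<^sub>R P + Im v *\<^sub>R Q) \<le> 2 * c * norm v"
      if "norm P \<le> c" "norm Q \<le> c" for v c and P Q :: "'a \<Rightarrow>\<^sub>L 'a"
    proof -
      have "norm (Re v *\<^sub>R P + Im v *\<^sub>R Q) \<le> \<bar>Re v\<bar> * norm P + \<bar>Im v\<bar> * norm Q"
        by (metis norm_scaleR norm_triangle_ineq)
      also have "\<dots> \<le> norm v * c + norm v * c"
        using that by (intro add_mono mult_mono abs_Re_le_cmod abs_Im_le_cmod) auto
      finally show ?thesis by simp
    qed
    have nB: "norm (B w v) \<le> 2 * k * norm v" if "w \<in> S'" for w v
      unfolding B_def by (rule lin) (use kk that in auto)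
    have nDB: "norm (DB w h v) \<le> 4 * k * norm h * norm v" if "w \<in> S'" for w h v
      using lin[where v = v and c = "2 * k * norm h" and P = "Re h *\<^sub>R Axx w + Im h *\<^sub>R Axy w"
        and Q = "Re h *\<^sub>R Ayx w + Im h *\<^sub>R Ayy w"] lin[where c = k and v = h] kk[OF that]
      by (simp add: DB_def)
    define R where "R = norm z + 1"
    have R1: "R \<ge> 1" by (simp add: R_def)
    have normS': "norm w \<le> R" if "w \<in> S'" for w using that by (simp add: S'_def R_def)
    define KK where "KK = 2 * k * R"
    have KK0: "KK \<ge> 0" using k0 R1 by (simp add: KK_def)
    have nBt: "norm (B (t *\<^sub>R w) w) \<le> KK" if "w \<in> S'" "t \<in> {0..1}" for w t
      using nB[OF ray'[OF that], of w] mult_left_mono[OF normS'[OF that(1)], of "2 * k"] k0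
      by (simp add: KK_def)
    define G where "G = exp (2 * KK + 1)"
    have G0: "G \<ge> 1" using KK0 by (simp add: G_def)
    define C where "C = sqrt ((norm u0)\<^sup>2 * G)"
    have C0: "C \<ge> 0" using G0 by (simp add: C_def)
    have nU: "norm (U w t) \<le> C" if w: "w \<in> S'" and t: "t \<in> {0..1}" for w t
    proof -
      have "(norm (U w t))\<^sup>2 \<le> ((norm (U w 0))\<^sup>2 + 0\<^sup>2) * exp (2 * KK + 1)"
      proof (rule gronwall_norm)
        show "(U w has_vector_derivative B (s *\<^sub>R w) w (U w s)) (at s within {0..1})"
          if "s \<in> {0..1}" for s using dU S'S w that by blast
        show "norm (B (s *\<^sub>R w) w (U w s)) \<le> KK * norm (U w s) + 0" if "s \<in> {0..1}" for s
          using norm_blinfun[of "B (s *\<^sub>R w) w" "U w s"] mult_right_mono[OF nBt[OF w that] norm_ge_zero]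
          by (metis add.right_neutral order_trans)
      qed (use KK0 t in auto)
      then show ?thesis using U0 S'S w unfolding C_def G_def
        by (intro real_le_rsqrt) auto
    qed
    let ?\<delta> = "\<lambda>t w. B (t *\<^sub>R w) w - B (t *\<^sub>R z) z - (B (t *\<^sub>R z) (w - z) + t *\<^sub>R DB (t *\<^sub>R z) (w - z) z)"
    have Blip: "norm (?\<delta> t w)
        \<le> norm (w - z) * (2 * c * R + 2 * d)"
      if w: "w \<in> S'" and t: "t \<in> {0..1}"
      and c: "norm (Ax (t *\<^sub>R w) - Ax (t *\<^sub>R z) - (Re (t *\<^sub>R (w - z)) *\<^sub>R Axx (t *\<^sub>R z) + Im (t *\<^sub>R (w - z)) *\<^sub>R Axy (t *\<^sub>R z))) \<le> norm (w - z) * c"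
         "norm (Ay (t *\<^sub>R w) - Ay (t *\<^sub>R z) - (Re (t *\<^sub>R (w - z)) *\<^sub>R Ayx (t *\<^sub>R z) + Im (t *\<^sub>R (w - z)) *\<^sub>R Ayy (t *\<^sub>R z))) \<le> norm (w - z) * c"
      and d: "norm (Ax (t *\<^sub>R w) - Ax (t *\<^sub>R z)) \<le> d" "norm (Ay (t *\<^sub>R w) - Ay (t *\<^sub>R z)) \<le> d"
      for w t c d
    proof -
      have "B (t *\<^sub>R w) w - B (t *\<^sub>R z) z - (B (t *\<^sub>R z) (w - z) + t *\<^sub>R DB (t *\<^sub>R z) (w - z) z)
        = (Re z *\<^sub>R (Ax (t *\<^sub>R w) - Ax (t *\<^sub>R z) - (Re (t *\<^sub>R (w - z)) *\<^sub>R Axx (t *\<^sub>R z) + Im (t *\<^sub>R (w - z)) *\<^sub>R Axy (t *\<^sub>R z)))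
          + Im z *\<^sub>R (Ay (t *\<^sub>R w) - Ay (t *\<^sub>R z) - (Re (t *\<^sub>R (w - z)) *\<^sub>R Ayx (t *\<^sub>R z) + Im (t *\<^sub>R (w - z)) *\<^sub>R Ayy (t *\<^sub>R z))))
          + (Re (w - z) *\<^sub>R (Ax (t *\<^sub>R w) - Ax (t *\<^sub>R z)) + Im (w - z) *\<^sub>R (Ay (t *\<^sub>R w) - Ay (t *\<^sub>R z)))"
        unfolding B_def DB_def minus_complex.sel scaleR_complex.sel by (rule increment_expand)
      also have "norm \<dots> \<le> 2 * (norm (w - z) * c) * norm z + 2 * d * norm (w - z)"
        by (rule order_trans[OF norm_triangle_ineq add_mono[OF lin[OF c] lin[OF d]]])
      also have "\<dots> \<le> 2 * (norm (w - z) * c) * R + 2 * d * norm (w - z)"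
        using order_trans[OF norm_ge_zero c(1)] normS'[OF zS'] by (simp add: mult_left_mono)
      finally show ?thesis by (simp add: algebra_simps)
    qed
    define C1 where "C1 = (2 * k + 4 * k * R + 4 * R + 2) * C"
    define C2 where "C2 = C1 * sqrt G"
    define C3 where "C3 = (2 * k + 4 * k * R) * C2 + (4 * R + 2) * C"
    have C1: "C1 \<ge> 0" and C2: "C2 \<ge> 0" and C3: "C3 \<ge> 0"
      using k0 R1 C0 G0 by (auto simp: C1_def C2_def C3_def)
    \<comment> \<open>Besides \<open>norm (w - z)\<close> the bound carries a factor
      \<open>\<eta>\<close>, while \<open>C3\<close> and \<open>G\<close> do not depend on
      \<open>w\<close>; differentiability at \<open>z\<close> follows by letting
      \<open>\<eta>\<close> tend to 0.\<close>
    have key: "norm (V w - V z - B z (w - z) (V z)) \<le> norm (w - z) * (\<eta> * C3 * sqrt G)"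
      if w: "w \<in> S'" and hw: "norm (w - z) \<le> \<eta>" and \<eta>: "0 < \<eta>" "\<eta> \<le> 1" and
        uni: "\<And>t. t \<in> {0..1} \<Longrightarrow>
           norm (?\<delta> t w)
             \<le> norm (w - z) * (\<eta> * (4 * R + 2))" for w \<eta>
    proof -
      define h where "h = w - z"
      \<comment> \<open>When the ray to \<open>z\<close> is replaced by the ray to \<open>w\<close>,
        \<open>X\<close> is the first-order change of the coefficient of the transport equation and
        \<rho> is the remainder.\<close>
      define X where "X t = B (t *\<^sub>R z) h + t *\<^sub>R DB (t *\<^sub>R z) h z" for t
      define \<rho> where "\<rho> t = B (t *\<^sub>R w) w - B (t *\<^sub>R z) z - X t" for t
      have n\<rho>: "norm (\<rho> t) \<le> norm h * (\<eta> * (4 * R + 2))" if "t \<in> {0..1}" for t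
        using uni[OF that] by (simp add: \<rho>_def X_def h_def)
      have nX: "norm (X t) \<le> norm h * (2 * k + 4 * k * R)" if t: "t \<in> {0..1}" for t
      proof -
        have "norm (X t) \<le> norm (B (t *\<^sub>R z) h) + \<bar>t\<bar> * norm (DB (t *\<^sub>R z) h z)"
          unfolding X_def by (metis norm_scaleR norm_triangle_ineq)
        also have "\<dots> \<le> 2 * k * norm h + 1 * (4 * k * norm h * R)"
          using nB[OF ray'[OF zS' t], of h] t nDB[OF ray'[OF zS' t], of h z] k0 normS'[OF zS']
            mult_left_mono[OF normS'[OF zS'], of "4 * k * norm h"]
          by (intro add_mono mult_mono) auto
        finally show ?thesis by (simp add: algebra_simps)
      qed
      define \<Delta> where "\<Delta> t = U w t - U z t" for t
      have d\<Delta>: "(\<Delta> has_vector_derivative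
          B (t *\<^sub>R z) z (\<Delta> t) + (X t + \<rho> t) (U w t)) (at t within {0..1})" if t: "t \<in> {0..1}" for t
      proof -
        have "(\<Delta> has_vector_derivative B (t *\<^sub>R w) w (U w t) - B (t *\<^sub>R z) z (U z t)) (at t within {0..1})"
          unfolding \<Delta>_def using w z S'S t by (intro has_vector_derivative_diff dU) auto
        also have "B (t *\<^sub>R w) w (U w t) - B (t *\<^sub>R z) z (U z t)
          = B (t *\<^sub>R z) z (\<Delta> t) + (X t + \<rho> t) (U w t)"
          by (simp add: \<Delta>_def \<rho>_def blinfun.bilinear_simps)
        finally show ?thesis .
      qed
      have n\<Delta>: "norm (\<Delta> t) \<le> norm h * C2" if t: "t \<in> {0..1}" for t
      proof -
        have "(norm (\<Delta> t))\<^sup>2 \<le> ((norm (\<Delta> 0))\<^sup>2 + (norm h * C1)\<^sup>2) * exp (2 * KK + 1)"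
        proof (rule gronwall_norm[OF d\<Delta> _ KK0 t])
          fix s :: real assume s: "s \<in> {0..1}"
          have "norm ((X s + \<rho> s) (U w s)) \<le> norm (X s + \<rho> s) * norm (U w s)" by (rule norm_blinfun)
          also have "\<dots> \<le> (norm h * (2 * k + 4 * k * R) + norm h * (1 * (4 * R + 2))) * C"
            using nX[OF s] n\<rho>[OF s] nU[OF w s] C0 \<eta> R1 k0
            by (intro mult_mono order_trans[OF norm_triangle_ineq] add_mono
                order_trans[OF n\<rho>[OF s]] mult_left_mono) auto
          also have "\<dots> = norm h * C1" by (simp add: C1_def algebra_simps)
          finally have *: "norm ((X s + \<rho> s) (U w s)) \<le> norm h * C1" .
          have "norm (B (s *\<^sub>R z) z (\<Delta> s)) \<le> KK * norm (\<Delta> s)"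
            by (rule order_trans[OF norm_blinfun]) (intro mult_right_mono nBt zS' s norm_ge_zero)
          with * show "norm (B (s *\<^sub>R z) z (\<Delta> s) + (X s + \<rho> s) (U w s)) \<le> KK * norm (\<Delta> s) + norm h * C1"
            by (intro norm_triangle_le) linarith
        qed
        also have "\<dots> = (norm h * C2)\<^sup>2"
          using w z S'S G0 by (auto simp: \<Delta>_def U0 C2_def power_mult_distrib G_def[symmetric])
        finally show ?thesis using C2 by (simp add: power2_le_iff_abs_le)
      qed
      \<comment> \<open>The subtracted term is the expected first-order change of the transport. By
        flatness, which exchanges the two directions in \<open>DB\<close>, it satisfies the
        linearised transport equation, so \<open>D\<close> solves the homogeneous equation up to the
        small forcing \<open>X t (\<Delta> t) + \<rho> t (U w t)\<close>. It starts at 0, and at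
        time 1 it is the error in the derivative of \<open>V\<close>.\<close>
      define D where "D t = \<Delta> t - t *\<^sub>R B (t *\<^sub>R z) h (U z t)" for t
      have dD: "(D has_vector_derivative B (t *\<^sub>R z) z (D t) + (X t (\<Delta> t) + \<rho> t (U w t))) (at t within {0..1})"
        if t: "t \<in> {0..1}" for t
      proof -
        have tz: "t *\<^sub>R z \<in> S" using ray'[OF zS' t] S'S by blast
        have ray: "((\<lambda>t. t *\<^sub>R z) has_derivative (\<lambda>s. s *\<^sub>R z)) (at t within {0..1})"
          by (auto intro!: derivative_eq_intros)
        have sub: "(\<lambda>t. t *\<^sub>R z) ` {0..1} \<subseteq> S" using ray'[OF zS'] S'S by blast
        have dX: "((\<lambda>t. Ax (t *\<^sub>R z)) has_derivative
            (\<lambda>s. Re (s *\<^sub>R z) *\<^sub>R Axx (t *\<^sub>R z) + Im (s *\<^sub>R z) *\<^sub>R Axy (t *\<^sub>R z))) (at t within {0..1})"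
          by (rule has_derivative_in_compose2[OF dAx sub t ray])
        have dY: "((\<lambda>t. Ay (t *\<^sub>R z)) has_derivative
            (\<lambda>s. Re (s *\<^sub>R z) *\<^sub>R Ayx (t *\<^sub>R z) + Im (s *\<^sub>R z) *\<^sub>R Ayy (t *\<^sub>R z))) (at t within {0..1})"
          by (rule has_derivative_in_compose2[OF dAy sub t ray])
        have 1: "((\<lambda>t. B (t *\<^sub>R z) h) has_vector_derivative DB (t *\<^sub>R z) z h) (at t within {0..1})"
          unfolding B_def DB_def has_vector_derivative_def
          by (rule has_derivative_eq_rhs[OF has_derivative_add[OF
                has_derivative_scaleR_right[OF dX] has_derivative_scaleR_right[OF dY]]])
             (simp add: fun_eq_iff scaleR_add_right mult.left_commute)
        have 2: "((\<lambda>t. B (t *\<^sub>R z) h (U z t)) has_vector_derivative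
            B (t *\<^sub>R z) h (B (t *\<^sub>R z) z (U z t)) + DB (t *\<^sub>R z) z h (U z t)) (at t within {0..1})"
          by (rule bounded_bilinear.has_vector_derivative[OF bounded_bilinear_blinfun_apply 1 dU[OF z t]])
        have 3: "((\<lambda>t. t *\<^sub>R B (t *\<^sub>R z) h (U z t)) has_vector_derivative
            t *\<^sub>R (B (t *\<^sub>R z) h (B (t *\<^sub>R z) z (U z t)) + DB (t *\<^sub>R z) z h (U z t)) + 1 *\<^sub>R (B (t *\<^sub>R z) h (U z t)))
            (at t within {0..1})"
          by (rule bounded_bilinear.has_vector_derivative[OF bounded_bilinear_scaleR _ 2])
             (auto intro!: derivative_eq_intros)
        have "(D has_vector_derivative B (t *\<^sub>R z) z (\<Delta> t) + (X t + \<rho> t) (U w t)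
             - (t *\<^sub>R (B (t *\<^sub>R z) h (B (t *\<^sub>R z) z (U z t)) + DB (t *\<^sub>R z) z h (U z t)) + 1 *\<^sub>R (B (t *\<^sub>R z) h (U z t))))
             (at t within {0..1})"
          unfolding D_def by (rule has_vector_derivative_diff[OF d\<Delta>[OF t] 3])
        also have "B (t *\<^sub>R z) h (B (t *\<^sub>R z) z (U z t)) + DB (t *\<^sub>R z) z h (U z t)
            = (DB (t *\<^sub>R z) z h + (B (t *\<^sub>R z) h o\<^sub>L B (t *\<^sub>R z) z)) (U z t)"
          by (simp add: blinfun.bilinear_simps)
        also have "\<dots> = B (t *\<^sub>R z) z (B (t *\<^sub>R z) h (U z t)) + DB (t *\<^sub>R z) h z (U z t)"
          unfolding Bflat[OF tz] by (simp add: blinfun.bilinear_simps)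
        also have "B (t *\<^sub>R z) z (\<Delta> t) + (X t + \<rho> t) (U w t)
             - (t *\<^sub>R \<dots> + 1 *\<^sub>R (B (t *\<^sub>R z) h (U z t)))
            = B (t *\<^sub>R z) z (D t) + (X t (\<Delta> t) + \<rho> t (U w t))"
          by (simp add: D_def X_def \<Delta>_def blinfun.bilinear_simps scaleR_add_right scaleR_diff_right)
        finally show ?thesis .
      qed
      define e where "e = norm h * (\<eta> * C3)"
      have "(norm (D 1))\<^sup>2 \<le> ((norm (D 0))\<^sup>2 + e\<^sup>2) * exp (2 * KK + 1)"
      proof (rule gronwall_norm[OF dD _ KK0])
        fix s :: real assume s: "s \<in> {0..1}"
        have "norm (X s (\<Delta> s)) \<le> (norm h * (2 * k + 4 * k * R)) * (norm h * C2)"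
          using k0 R1 by (intro order_trans[OF norm_blinfun] mult_mono nX n\<Delta> s) auto
        also have "\<dots> \<le> (norm h * (2 * k + 4 * k * R)) * (\<eta> * C2)"
          using hw k0 R1 C2 unfolding h_def by (intro mult_left_mono mult_right_mono) auto
        finally have X: "norm (X s (\<Delta> s)) \<le> norm h * \<eta> * ((2 * k + 4 * k * R) * C2)"
          by (simp add: algebra_simps)
        have "norm (\<rho> s (U w s)) \<le> norm h * (\<eta> * (4 * R + 2)) * C"
          using R1 \<eta> by (intro order_trans[OF norm_blinfun] mult_mono n\<rho> nU s w) auto
        with X have *: "norm (X s (\<Delta> s) + \<rho> s (U w s)) \<le> e"
          unfolding e_def C3_def by (intro order_trans[OF norm_triangle_ineq]) (simp add: algebra_simps)
        have "norm (B (s *\<^sub>R z) z (D s)) \<le> KK * norm (D s)"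
          by (rule order_trans[OF norm_blinfun]) (intro mult_right_mono nBt zS' s norm_ge_zero)
        with * show "norm (B (s *\<^sub>R z) z (D s) + (X s (\<Delta> s) + \<rho> s (U w s))) \<le> KK * norm (D s) + e"
          by (intro norm_triangle_le) linarith
      qed auto
      also have "\<dots> = (e * sqrt G)\<^sup>2"
        using w z S'S G0 by (auto simp: D_def \<Delta>_def U0 power_mult_distrib G_def[symmetric])
      finally have "norm (D 1) \<le> e * sqrt G"
        using C3 \<eta> G0 by (simp add: power2_le_iff_abs_le e_def)
      then show ?thesis by (simp add: D_def \<Delta>_def V_def e_def h_def algebra_simps)
    qed
    have uc: "\<exists>d>0. \<forall>p\<in>S'. \<forall>q\<in>S'. dist p q < d \<longrightarrow> norm (f p - f q) \<le> \<eta>"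
      if "continuous_on S f" "\<eta> > 0" for f :: "complex \<Rightarrow> 'a \<Rightarrow>\<^sub>L 'a" and \<eta>
      using compact_uniformly_continuous[OF continuous_on_subset[OF that(1) S'S] comp] that(2)
      unfolding uniformly_continuous_on_def dist_norm by (meson less_imp_le)
    show ?thesis unfolding has_derivative_within_alt
    proof (intro conjI allI impI)
      show "bounded_linear (\<lambda>v. B z v (V z))"
        unfolding B_def blinfun.bilinear_simps
        by (intro bounded_linear_add bounded_linear_scaleR_const bounded_linear_Re bounded_linear_Im)
      fix \<epsilon> :: real assume \<epsilon>: "\<epsilon> > 0"
      define \<eta> where "\<eta> = min 1 (\<epsilon> / (C3 * sqrt G + 1))"
      have CG: "C3 * sqrt G \<ge> 0" using C3 G0 by auto
      have \<eta>: "\<eta> > 0" "\<eta> \<le> 1" using \<epsilon> CG by (auto simp: \<eta>_def)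
      have "\<eta> * (C3 * sqrt G) \<le> \<epsilon> / (C3 * sqrt G + 1) * (C3 * sqrt G + 1)"
        using CG \<epsilon> by (intro mult_mono) (auto simp: \<eta>_def)
      then have \<eta>\<epsilon>: "\<eta> * C3 * sqrt G \<le> \<epsilon>" using CG by (simp add: mult.assoc)
      obtain d1 d2 d3 d4 d5 d6 where d: "d1 > 0" "d2 > 0" "d3 > 0" "d4 > 0" "d5 > 0" "d6 > 0"
        "\<forall>p\<in>S'. \<forall>q\<in>S'. dist p q < d1 \<longrightarrow> norm (Ax p - Ax q) \<le> \<eta>"
        "\<forall>p\<in>S'. \<forall>q\<in>S'. dist p q < d2 \<longrightarrow> norm (Ay p - Ay q) \<le> \<eta>"
        "\<forall>p\<in>S'. \<forall>q\<in>S'. dist p q < d3 \<longrightarrow> norm (Axx p - Axx q) \<le> \<eta>"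
        "\<forall>p\<in>S'. \<forall>q\<in>S'. dist p q < d4 \<longrightarrow> norm (Axy p - Axy q) \<le> \<eta>"
        "\<forall>p\<in>S'. \<forall>q\<in>S'. dist p q < d5 \<longrightarrow> norm (Ayx p - Ayx q) \<le> \<eta>"
        "\<forall>p\<in>S'. \<forall>q\<in>S'. dist p q < d6 \<longrightarrow> norm (Ayy p - Ayy q) \<le> \<eta>"
        using uc[OF cA(1) \<eta>(1)] uc[OF cA(2) \<eta>(1)] uc[OF cont(1) \<eta>(1)] uc[OF cont(2) \<eta>(1)]
          uc[OF cont(3) \<eta>(1)] uc[OF cont(4) \<eta>(1)] by (elim exE conjE)
      define \<delta> where "\<delta> = Min {\<eta>, d1, d2, d3, d4, d5, d6}"
      have \<delta>: "\<delta> > 0" "\<delta> \<le> \<eta>" "\<delta> \<le> d1" "\<delta> \<le> d2" "\<delta> \<le> d3" "\<delta> \<le> d4" "\<delta> \<le> d5" "\<delta> \<le> d6"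
        unfolding \<delta>_def using d(1-6) \<eta>(1) by (simp_all only: Min_gr_iff Min_le finite.intros insert_not_empty ball_simps insert_iff simp_thms)
      show "\<exists>d>0. \<forall>y\<in>S. norm (y - z) < d \<longrightarrow>
          norm (V y - V z - B z (y - z) (V z)) \<le> \<epsilon> * norm (y - z)"
      proof (intro exI[of _ \<delta>] conjI ballI impI \<delta>(1))
        fix w assume wS: "w \<in> S" and wz: "norm (w - z) < \<delta>"
        have "norm w \<le> norm z + 1" using wz \<delta>(2) \<eta>(2) norm_triangle_sub[of w z] by linarith
        then have w: "w \<in> S'" using wS by (simp add: S'_def)
        have close: "dist (t *\<^sub>R w) (t *\<^sub>R z) \<le> norm (w - z)" if "t \<in> {0..1}" for t
          using that by (simp add: dist_norm mult_left_le_one_le flip: scaleR_diff_right)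
        \<comment> \<open>Differentiability at each \<open>t *\<^sub>R z\<close> gives no bound
          uniform in \<open>t\<close>. The mean value inequality on the segment, with uniformly
          continuous partial derivatives, does.\<close>
        have tay: "norm (f (t *\<^sub>R w) - f (t *\<^sub>R z) - (Re (t *\<^sub>R (w - z)) *\<^sub>R fx (t *\<^sub>R z) + Im (t *\<^sub>R (w - z)) *\<^sub>R fy (t *\<^sub>R z)))
            \<le> norm (w - z) * (2 * \<eta>)"
          if t: "t \<in> {0..1}"
            and f: "\<And>p. p \<in> S \<Longrightarrow> (f has_derivative (\<lambda>v. Re v *\<^sub>R fx p + Im v *\<^sub>R fy p)) (at p within S)"
            and x: "\<forall>p\<in>S'. \<forall>q\<in>S'. dist p q < dx \<longrightarrow> norm (fx p - fx q) \<le> \<eta>" "\<delta> \<le> dx"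
            and y: "\<forall>p\<in>S'. \<forall>q\<in>S'. dist p q < dy \<longrightarrow> norm (fy p - fy q) \<le> \<eta>" "\<delta> \<le> dy"
          for t dx dy and f fx fy :: "complex \<Rightarrow> 'a \<Rightarrow>\<^sub>L 'a"
        proof -
          define T where "T = closed_segment (t *\<^sub>R z) (t *\<^sub>R w)"
          have TS': "T \<subseteq> S'" unfolding T_def
            by (intro closed_segment_subset conv ray' zS' w t)
          have Td: "dist p (t *\<^sub>R z) < \<delta>" if "p \<in> T" for p
            using segment_bound(1)[OF that[unfolded T_def]] close[OF t] wz
            by (simp add: dist_norm)
          have "norm (f (t *\<^sub>R w) - f (t *\<^sub>R z) - (\<lambda>p v. Re v *\<^sub>R fx p + Im v *\<^sub>R fy p) (t *\<^sub>R z) (t *\<^sub>R w - t *\<^sub>R z))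
            \<le> norm (t *\<^sub>R w - t *\<^sub>R z) * (2 * \<eta>)"
          proof (rule differentiable_bound_linearization[where S = T])
            show "t *\<^sub>R z + s *\<^sub>R (t *\<^sub>R w - t *\<^sub>R z) \<in> T" if "s \<in> {0..1}" for s
              using that unfolding T_def in_segment by (intro exI[of _ s]) (auto simp: algebra_simps)
            show "(f has_derivative (\<lambda>v. Re v *\<^sub>R fx p + Im v *\<^sub>R fy p)) (at p within T)" if "p \<in> T" for p
              using f[of p] TS' S'S that has_derivative_subset[of f _ p S T] by blast
            show "t *\<^sub>R z \<in> T" by (simp add: T_def)
            fix p assume p: "p \<in> T"
            show "onorm ((\<lambda>v. Re v *\<^sub>R fx p + Im v *\<^sub>R fy p) - (\<lambda>v. Re v *\<^sub>R fx (t *\<^sub>R z) + Im v *\<^sub>R fy (t *\<^sub>R z))) \<le> 2 * \<eta>"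
            proof (rule onorm_le)
              fix v
              have "norm (Re v *\<^sub>R (fx p - fx (t *\<^sub>R z)) + Im v *\<^sub>R (fy p - fy (t *\<^sub>R z))) \<le> 2 * \<eta> * norm v"
                using x(1)[rule_format, of p "t *\<^sub>R z"] y(1)[rule_format, of p "t *\<^sub>R z"] x(2) y(2) Td[OF p] p TS' ray'[OF zS' t]
                by (intro lin) auto
              then show "norm (((\<lambda>v. Re v *\<^sub>R fx p + Im v *\<^sub>R fy p) - (\<lambda>v. Re v *\<^sub>R fx (t *\<^sub>R z) + Im v *\<^sub>R fy (t *\<^sub>R z))) v) \<le> 2 * \<eta> * norm v"
                by (simp add: algebra_simps)
            qed
          qed
          also have "\<dots> \<le> norm (w - z) * (2 * \<eta>)"
            using close[OF t] \<eta> by (intro mult_right_mono) (auto simp: dist_norm)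
          finally show ?thesis by (simp add: algebra_simps)
        qed
        have "norm (V w - V z - B z (w - z) (V z)) \<le> norm (w - z) * (\<eta> * C3 * sqrt G)"
        proof (rule key[OF w _ \<eta>])
          show "norm (w - z) \<le> \<eta>" using wz \<delta>(2) by linarith
          fix t :: real assume t: "t \<in> {0..1}"
          have cl: "norm (f (t *\<^sub>R w) - f (t *\<^sub>R z)) \<le> \<eta>"
            if "\<forall>p\<in>S'. \<forall>q\<in>S'. dist p q < d \<longrightarrow> norm (f p - f q) \<le> \<eta>" "\<delta> \<le> d"
            for f :: "complex \<Rightarrow> 'a \<Rightarrow>\<^sub>L 'a" and d
            using that close[OF t] wz ray'[OF w t] ray'[OF zS' t] by auto
          have "norm (?\<delta> t w)
            \<le> norm (w - z) * (2 * (2 * \<eta>) * R + 2 * \<eta>)"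
            by (intro Blip w t tay[OF t dAx d(9) \<delta>(5) d(10) \<delta>(6)] tay[OF t dAy d(11) \<delta>(7) d(12) \<delta>(8)]
                cl[OF d(7) \<delta>(3)] cl[OF d(8) \<delta>(4)])
          then show "norm (?\<delta> t w)
             \<le> norm (w - z) * (\<eta> * (4 * R + 2))" by (simp add: algebra_simps)
        qed
        also have "\<dots> \<le> \<epsilon> * norm (w - z)"
          using \<eta>\<epsilon> by (subst mult.commute) (rule mult_right_mono, auto)
        finally show "norm (V w - V z - B z (w - z) (V z)) \<le> \<epsilon> * norm (w - z)" .
      qed
    qed
  qed
  moreover have "V 0 = u0"
  proof -
    have "(U 0 has_derivative (\<lambda>h. 0)) (at t within {0..1})" if "t \<in> {0..1}" for t
      using dU[OF S(3) that] by (simp add: B_def has_vector_derivative_def)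
    then have "U 0 1 = U 0 0" by (intro has_derivative_zero_unique[of "{0..1}"]) auto
    then show ?thesis using U0[OF S(3)] by (simp add: V_def)
  qed
  ultimately show ?thesis unfolding B_def by (intro exI[of _ V]) (simp add: blinfun.bilinear_simps)
qed

section \<open>Functions of class C^k on the strip\<close>

text \<open>At a boundary point one vertical direction leaves the strip, but uniqueness only
  requires an arbitrarily small step of either sign along each basis vector. A step shorter than
  \<open>T\<close> cannot leave the strip in both directions.\<close>

lemma strip_derivative_unique:
  assumes "T > 0" "z \<in> strip T"
    and "(f has_derivative f') (at z within strip T)" "(f has_derivative f'') (at z within strip T)"
  shows "f' = f''"
proof (rule frechet_derivative_unique_within[OF assms(3,4)])
  fix i :: complex and e :: real assume i: "i \<in> Basis" and e: "e > 0"
  define m where "m = min e T / 2"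
  have m: "0 < m" "m < e" "m < T" using e assms(1) by (auto simp: m_def min_def)
  have "z + m *\<^sub>R i \<in> strip T \<or> z + (- m) *\<^sub>R i \<in> strip T"
    using i assms(2) m by (auto simp: strip_def Basis_complex_def)
  then show "\<exists>d. 0 < \<bar>d\<bar> \<and> \<bar>d\<bar> < e \<and> z + d *\<^sub>R i \<in> strip T"
    using m by (metis abs_minus_cancel abs_of_pos)
qed

lemma strip_frechet_derivative:
  assumes "T > 0" "z \<in> strip T" "(f has_derivative f') (at z within strip T)"
  shows "frechet_derivative f (at z within strip T) = f'"
  using strip_derivative_unique[OF assms(1,2)] assms(3)
  by (metis differentiableI frechet_derivative_works)

lemma convex_strip: "convex (strip T)"
proof -
  have "strip T = {z. Im z \<le> T} \<inter> {z. Im z \<ge> - T}" by (auto simp: strip_def)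
  then show ?thesis by (simp add: convex_Int convex_halfspace_Im_le convex_halfspace_Im_ge)
qed

lemma closed_strip: "closed (strip T)"
  unfolding strip_def by (intro closed_Collect_conj closed_Collect_le continuous_intros)

lemma Ck_on_cong:
  assumes "T > 0" "\<And>z. z \<in> strip T \<Longrightarrow> f z = g z"
  shows "Ck_on k (strip T) f \<longleftrightarrow> Ck_on k (strip T) g"
  using assms(2)
proof (induction k arbitrary: f g)
  case 0 then show ?case by (simp cong: continuous_on_cong)
next
  case (Suc k)
  have d: "(f has_derivative D) (at z within strip T) \<longleftrightarrow> (g has_derivative D) (at z within strip T)"
    if "z \<in> strip T" for z D
    using has_derivative_transform[OF that] Suc.prems that by metis
  have "f differentiable_on strip T \<longleftrightarrow> g differentiable_on strip T"
    unfolding differentiable_on_def differentiable_def using d by blast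
  moreover have e: "frechet_derivative f (at z within strip T) = frechet_derivative g (at z within strip T)"
    if "z \<in> strip T" for z using d[OF that] by (simp add: frechet_derivative_def)
  have "Ck_on k (strip T) (\<lambda>z. frechet_derivative f (at z within strip T) v)
      \<longleftrightarrow> Ck_on k (strip T) (\<lambda>z. frechet_derivative g (at z within strip T) v)" for v
    by (rule Suc.IH) (simp only: e)
  ultimately show ?case by simp
qed

text \<open>Frees all later arguments from \<open>frechet_derivative\<close>: by uniqueness, any
  explicit family of derivatives may take its place.\<close>

lemma Ck_on_SucI:
  assumes "T > 0" "\<And>z. z \<in> strip T \<Longrightarrow> (f has_derivative f' z) (at z within strip T)"
    "\<And>v. Ck_on k (strip T) (\<lambda>z. f' z v)"
  shows "Ck_on (Suc k) (strip T) f"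
proof -
  have "Ck_on k (strip T) (\<lambda>z. frechet_derivative f (at z within strip T) v)" for v
    by (subst Ck_on_cong[OF assms(1), of _ "\<lambda>z. f' z v"])
       (simp_all only: strip_frechet_derivative[OF assms(1) _ assms(2)] assms(3))
  then show ?thesis using assms(2) by (auto simp: differentiable_on_def differentiable_def)
qed

lemma Ck_on_SucD:
  assumes "Ck_on (Suc k) S f"
  shows "\<exists>f'. (\<forall>z\<in>S. (f has_derivative f' z) (at z within S)) \<and> (\<forall>v. Ck_on k S (\<lambda>z. f' z v))"
  using assms
  by (intro exI[of _ "\<lambda>z. frechet_derivative f (at z within S)"])
     (simp add: differentiable_on_def frechet_derivative_works)

lemma Ck_on_lower: "T > 0 \<Longrightarrow> Ck_on (Suc k) (strip T) f \<Longrightarrow> Ck_on k (strip T) f"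
proof (induction k arbitrary: f)
  case 0
  then show ?case by (auto simp: differentiable_imp_continuous_on)
next
  case (Suc k)
  from Suc.prems(2) have "f differentiable_on strip T"
    "\<And>v. Ck_on (Suc k) (strip T) (\<lambda>z. frechet_derivative f (at z within strip T) v)"
    by (simp_all only: Ck_on.simps(2)[of "Suc k"])
  with Suc.IH[OF Suc.prems(1)] show ?case by (simp only: Ck_on.simps(2) simp_thms)
qed

lemma Ck_on_const: "T > 0 \<Longrightarrow> Ck_on k (strip T) (\<lambda>z. c)"
proof (induction k arbitrary: c)
  case (Suc k)
  show ?case by (rule Ck_on_SucI[OF Suc.prems has_derivative_const Suc.IH[OF Suc.prems]])
qed simp

lemma Ck_on_add:
  assumes "T > 0" "Ck_on k (strip T) f" "Ck_on k (strip T) g"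
  shows "Ck_on k (strip T) (\<lambda>z. f z + g z)"
  using assms(2,3)
proof (induction k arbitrary: f g)
  case (Suc k)
  obtain f' where f: "\<And>z. z \<in> strip T \<Longrightarrow> (f has_derivative f' z) (at z within strip T)" "\<And>v. Ck_on k (strip T) (\<lambda>z. f' z v)"
    using Ck_on_SucD[OF Suc.prems(1)] by blast
  obtain g' where g: "\<And>z. z \<in> strip T \<Longrightarrow> (g has_derivative g' z) (at z within strip T)" "\<And>v. Ck_on k (strip T) (\<lambda>z. g' z v)"
    using Ck_on_SucD[OF Suc.prems(2)] by blast
  note d = f g
  show ?case
    by (rule Ck_on_SucI[OF assms(1) has_derivative_add[OF d(1,3)] Suc.IH[OF d(2,4)]])
qed (auto intro: continuous_intros)

lemma Ck_on_bounded_linear: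
  assumes "T > 0" "bounded_linear L" "Ck_on k (strip T) f"
  shows "Ck_on k (strip T) (\<lambda>z. L (f z))"
  using assms(3)
proof (induction k arbitrary: f)
  case 0 then show ?case by (simp add: bounded_linear.continuous_on[OF assms(2)])
next
  case (Suc k)
  obtain f' where d: "\<And>z. z \<in> strip T \<Longrightarrow> (f has_derivative f' z) (at z within strip T)" "\<And>v. Ck_on k (strip T) (\<lambda>z. f' z v)"
    using Ck_on_SucD[OF Suc.prems] by blast
  show ?case
    by (rule Ck_on_SucI[OF assms(1) bounded_linear.has_derivative[OF assms(2) d(1)] Suc.IH[OF d(2)]])
qed

lemma Ck_on_bilinear:
  assumes "T > 0" "bounded_bilinear b" "Ck_on k (strip T) f" "Ck_on k (strip T) g"
  shows "Ck_on k (strip T) (\<lambda>z. b (f z) (g z))"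
  using assms(3,4)
proof (induction k arbitrary: f g)
  case 0 then show ?case by (simp add: bounded_bilinear.continuous_on[OF assms(2)])
next
  case (Suc k)
  obtain f' where f: "\<And>z. z \<in> strip T \<Longrightarrow> (f has_derivative f' z) (at z within strip T)" "\<And>v. Ck_on k (strip T) (\<lambda>z. f' z v)"
    using Ck_on_SucD[OF Suc.prems(1)] by blast
  obtain g' where g: "\<And>z. z \<in> strip T \<Longrightarrow> (g has_derivative g' z) (at z within strip T)" "\<And>v. Ck_on k (strip T) (\<lambda>z. g' z v)"
    using Ck_on_SucD[OF Suc.prems(2)] by blast
  note d = f g
  have l: "Ck_on k (strip T) f" "Ck_on k (strip T) g" using Ck_on_lower[OF assms(1)] Suc.prems by auto
  show ?case
  proof (rule Ck_on_SucI[OF assms(1)])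
    show "((\<lambda>z. b (f z) (g z)) has_derivative (\<lambda>v. b (f z) (g' z v) + b (f' z v) (g z))) (at z within strip T)"
      if "z \<in> strip T" for z by (intro bounded_bilinear.FDERIV[OF assms(2)] d(1,3) that)
    show "Ck_on k (strip T) (\<lambda>z. b (f z) (g' z v) + b (f' z v) (g z))" for v
      by (rule Ck_on_add[OF assms(1) Suc.IH[OF l(1) d(4)] Suc.IH[OF d(2) l(2)]])
  qed
qed

lemma Ck_on_exp:
  fixes f :: "complex \<Rightarrow> real"
  assumes "T > 0" "Ck_on k (strip T) f"
  shows "Ck_on k (strip T) (\<lambda>z. exp (f z))"
  using assms(2)
proof (induction k arbitrary: f)
  case (Suc k)
  obtain f' where d: "\<And>z. z \<in> strip T \<Longrightarrow> (f has_derivative f' z) (at z within strip T)" "\<And>v. Ck_on k (strip T) (\<lambda>z. f' z v)"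
    using Ck_on_SucD[OF Suc.prems] by blast
  have l: "Ck_on k (strip T) f" using Ck_on_lower[OF assms(1)] Suc.prems by auto
  show ?case
  proof (rule Ck_on_SucI[OF assms(1)])
    show "((\<lambda>z. exp (f z)) has_derivative (\<lambda>v. f' z v * exp (f z))) (at z within strip T)"
      if "z \<in> strip T" for z by (intro has_derivative_exp d(1) that)
    show "Ck_on k (strip T) (\<lambda>z. f' z v * exp (f z))" for v
      by (rule Ck_on_bilinear[OF assms(1) bounded_bilinear_mult d(2) Suc.IH[OF l]])
  qed
qed (auto intro: continuous_intros)

lemma smooth_on_bounded_linear:
  "T > 0 \<Longrightarrow> bounded_linear L \<Longrightarrow> smooth_on (strip T) f \<Longrightarrow> smooth_on (strip T) (\<lambda>z. L (f z))"
  unfolding smooth_on_def by (intro allI) (erule (1) Ck_on_bounded_linear, erule spec)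

lemma smooth_on_add:
  "T > 0 \<Longrightarrow> smooth_on (strip T) f \<Longrightarrow> smooth_on (strip T) g \<Longrightarrow> smooth_on (strip T) (\<lambda>z. f z + g z)"
  by (simp add: smooth_on_def Ck_on_add)

lemma smooth_on_zero: "T > 0 \<Longrightarrow> smooth_on (strip T) (\<lambda>z. 0)"
  by (simp add: smooth_on_def Ck_on_const)

section \<open>Energy and Poincare estimates on rectangles\<close>

text \<open>Cauchy-Schwarz against the constant function 1, read off from the nonnegative integral
  of \<open>(g x - m)\<^sup>2\<close> with \<open>m\<close> the mean of \<open>g\<close>.\<close>

lemma square_integral_le:
  fixes g :: "real \<Rightarrow> real"
  assumes "a \<le> b" and g: "continuous_on {a..b} g"
  shows "(integral {a..b} g)\<^sup>2 \<le> (b - a) * integral {a..b} (\<lambda>x. (g x)\<^sup>2)"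
proof (cases "a = b")
  case False
  with assms have ab: "a < b" by simp
  define m where "m = integral {a..b} g / (b - a)"
  have i: "g integrable_on {a..b}" "(\<lambda>x. (g x)\<^sup>2) integrable_on {a..b}"
    by (intro integrable_continuous_real continuous_intros g)+
  have "0 \<le> integral {a..b} (\<lambda>x. (g x - m)\<^sup>2)"
    by (intro integral_nonneg integrable_continuous_real continuous_intros g) auto
  also have "\<dots> = integral {a..b} (\<lambda>x. (g x)\<^sup>2 - 2 * m * g x + m\<^sup>2)"
    by (simp add: power2_diff algebra_simps)
  also have "\<dots> = integral {a..b} (\<lambda>x. (g x)\<^sup>2) - 2 * m * integral {a..b} g + m\<^sup>2 * (b - a)"
  proof (rule integral_unique)
    have "((\<lambda>x. (g x)\<^sup>2 - 2 * m * g x + m\<^sup>2) has_integral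
        integral {a..b} (\<lambda>x. (g x)\<^sup>2) - 2 * m * integral {a..b} g + (b - a) *\<^sub>R m\<^sup>2) {a..b}"
      using ab i by (intro has_integral_add has_integral_diff has_integral_mult_right integrable_integral)
        (use has_integral_const_real[of "m\<^sup>2" a b] in simp_all)
    then show "((\<lambda>x. (g x)\<^sup>2 - 2 * m * g x + m\<^sup>2) has_integral
        integral {a..b} (\<lambda>x. (g x)\<^sup>2) - 2 * m * integral {a..b} g + m\<^sup>2 * (b - a)) {a..b}"
      by (simp add: mult.commute)
  qed
  also have "integral {a..b} g = m * (b - a)" using ab by (simp add: m_def)
  finally have "m\<^sup>2 * (b - a) \<le> integral {a..b} (\<lambda>x. (g x)\<^sup>2)" by (simp add: power2_eq_square)
  from mult_left_mono[OF this, of "b - a"] ab show ?thesis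
    by (simp add: \<open>integral {a..b} g = m * (b - a)\<close> power2_eq_square mult_ac)
qed auto

lemma increment_square_le:
  fixes f :: "real \<Rightarrow> real"
  assumes f: "\<And>x. x \<in> {a..b} \<Longrightarrow> (f has_real_derivative g x) (at x within {a..b})"
    and g: "continuous_on {a..b} g" and x: "x \<in> {a..b}" and y: "y \<in> {a..b}"
  shows "(f x - f y)\<^sup>2 \<le> (b - a) * integral {a..b} (\<lambda>x. (g x)\<^sup>2)"
proof -
  have *: "(f x - f y)\<^sup>2 \<le> (b - a) * integral {a..b} (\<lambda>x. (g x)\<^sup>2)"
    if xy: "x \<in> {a..b}" "y \<in> {a..b}" "y \<le> x" for x y
  proof -
    have sub: "{y..x} \<subseteq> {a..b}" using xy by auto
    have "(g has_integral f x - f y) {y..x}"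
    proof (rule fundamental_theorem_of_calculus[OF xy(3)])
      fix t assume "t \<in> {y..x}"
      then have "(f has_real_derivative g t) (at t within {y..x})"
        using f[of t] sub by (intro has_field_derivative_subset[OF _ sub]) auto
      then show "(f has_vector_derivative g t) (at t within {y..x})"
        by (simp only: has_real_derivative_iff_has_vector_derivative)
    qed
    then have "(f x - f y)\<^sup>2 = (integral {y..x} g)\<^sup>2" by (simp add: integral_unique)
    also have "\<dots> \<le> (x - y) * integral {y..x} (\<lambda>x. (g x)\<^sup>2)"
      by (rule square_integral_le[OF xy(3) continuous_on_subset[OF g sub]])
    also have "\<dots> \<le> (b - a) * integral {a..b} (\<lambda>x. (g x)\<^sup>2)"
      using xy sub continuous_on_subset[OF g sub] g
      by (intro mult_mono integral_subset_le integral_nonneg integrable_continuous_real continuous_intros) auto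
    finally show ?thesis .
  qed
  show ?thesis using *[OF x y] *[OF y x] by (cases "y \<le> x") (auto simp: power2_commute)
qed

abbreviation rint :: "real \<Rightarrow> real \<Rightarrow> real \<Rightarrow> real \<Rightarrow> (real \<times> real \<Rightarrow> real) \<Rightarrow> real" where
  "rint a b c d f \<equiv> integral (cbox (a, c) (b, d)) f"

lemma rint_iterated:
  assumes "continuous_on (cbox (a, c) (b, d)) f"
  shows "rint a b c d f = integral {a..b} (\<lambda>x. integral {c..d} (\<lambda>y. f (x, y)))"
    and "rint a b c d f = integral {c..d} (\<lambda>y. integral {a..b} (\<lambda>x. f (x, y)))"
proof -
  show "rint a b c d f = integral {a..b} (\<lambda>x. integral {c..d} (\<lambda>y. f (x, y)))"
    using integral_prod_continuous[OF assms] by simp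
  then show "rint a b c d f = integral {c..d} (\<lambda>y. integral {a..b} (\<lambda>x. f (x, y)))"
    using integral_swap_continuous[of a c b d "\<lambda>x y. f (x, y)"] assms by simp
qed

lemma continuous_on_slice:
  fixes f :: "real \<times> real \<Rightarrow> 'a::topological_space"
  assumes "continuous_on (cbox (a, c) (b, d)) f"
  shows "y \<in> {c..d} \<Longrightarrow> continuous_on {a..b} (\<lambda>x. f (x, y))"
    and "x \<in> {a..b} \<Longrightarrow> continuous_on {c..d} (\<lambda>y. f (x, y))"
  by (rule continuous_on_compose2[OF assms]; auto intro!: continuous_intros)+

lemma continuous_on_integral_slice:
  fixes f :: "real \<times> real \<Rightarrow> real"
  assumes "continuous_on (cbox (a, c) (b, d)) f"
  shows "continuous_on {a..b} (\<lambda>x. integral {c..d} (\<lambda>y. f (x, y)))"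
    and "continuous_on {c..d} (\<lambda>y. integral {a..b} (\<lambda>x. f (x, y)))"
proof -
  have "continuous_on ({a..b} \<times> cbox c d) (\<lambda>(x, y). f (x, y))"
    using assms by (simp add: cbox_Pair_eq)
  then show "continuous_on {a..b} (\<lambda>x. integral {c..d} (\<lambda>y. f (x, y)))"
    using integral_continuous_on_param by fastforce
  have "continuous_on ({c..d} \<times> cbox a b) (\<lambda>(y, x). f (x, y))"
    unfolding case_prod_unfold
    by (rule continuous_on_compose2[OF assms]) (auto intro!: continuous_intros)
  then show "continuous_on {c..d} (\<lambda>y. integral {a..b} (\<lambda>x. f (x, y)))"
    using integral_continuous_on_param by fastforce
qed

text \<open>As the mean vanishes, subtracting a constant from \<open>w\<close> can only increase its
  square integral. The constant chosen is the value at \<open>(x', c)\<close>, which is joined to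
  \<open>(x, y)\<close> by a horizontal and a vertical segment. The vertical contribution depends on
  \<open>x'\<close> and becomes a double integral by averaging over \<open>x'\<close> at the
  end.\<close>

lemma poincare_rectangle:
  fixes w wx wy :: "real \<times> real \<Rightarrow> real"
  assumes ab: "a < b" and cd: "c < d"
    and cont: "continuous_on (cbox (a, c) (b, d)) w" "continuous_on (cbox (a, c) (b, d)) wx"
      "continuous_on (cbox (a, c) (b, d)) wy"
    and dx: "\<And>x y. x \<in> {a..b} \<Longrightarrow> y \<in> {c..d} \<Longrightarrow>
        ((\<lambda>x. w (x, y)) has_real_derivative wx (x, y)) (at x within {a..b})"
    and dy: "\<And>x y. x \<in> {a..b} \<Longrightarrow> y \<in> {c..d} \<Longrightarrow>
        ((\<lambda>y. w (x, y)) has_real_derivative wy (x, y)) (at y within {c..d})"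
    and mean: "rint a b c d w = 0"
  shows "rint a b c d (\<lambda>p. (w p)\<^sup>2) \<le>
    2 * (b - a)\<^sup>2 * rint a b c d (\<lambda>p. (wx p)\<^sup>2) + 2 * (d - c)\<^sup>2 * rint a b c d (\<lambda>p. (wy p)\<^sup>2)"
proof -
  let ?B = "cbox (a, c) (b, d)"
  define X where "X y = integral {a..b} (\<lambda>x. (wx (x, y))\<^sup>2)" for y
  define Y where "Y x = integral {c..d} (\<lambda>y. (wy (x, y))\<^sup>2)" for x
  have c2: "continuous_on ?B (\<lambda>p. (w p)\<^sup>2)" "continuous_on ?B (\<lambda>p. (wx p)\<^sup>2)" "continuous_on ?B (\<lambda>p. (wy p)\<^sup>2)"
    by (intro continuous_intros cont)+
  have cX: "continuous_on {c..d} X" and cY: "continuous_on {a..b} Y"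
    unfolding X_def Y_def using continuous_on_integral_slice c2 by blast+
  have area: "measure lborel ?B = (b - a) * (d - c)"
    using ab cd by (simp add: content_Pair)
  have cX2: "continuous_on ?B (\<lambda>p. X (snd p))"
    by (rule continuous_on_compose2[OF cX]) (auto intro!: continuous_intros)
  have iX: "rint a b c d (\<lambda>p. X (snd p)) = (b - a) * rint a b c d (\<lambda>p. (wx p)\<^sup>2)"
    unfolding rint_iterated(2)[OF cX2] rint_iterated(2)[OF c2(2)] using ab by (simp add: X_def)
  have step: "rint a b c d (\<lambda>p. (w p)\<^sup>2) \<le>
      2 * (b - a)\<^sup>2 * rint a b c d (\<lambda>p. (wx p)\<^sup>2) + 2 * (d - c)\<^sup>2 * (b - a) * Y x'"
    if x': "x' \<in> {a..b}" for x'
  proof -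
    define W where "W = w (x', c)"
    have "(w p)\<^sup>2 - 2 * W * w p + W\<^sup>2 \<le> 2 * (b - a) * X (snd p) + 2 * (d - c) * Y x'" if p: "p \<in> ?B" for p
    proof -
      obtain x y where [simp]: "p = (x, y)" and xy: "x \<in> {a..b}" "y \<in> {c..d}" using p by (cases p) auto
      have 1: "(w (x, y) - w (x', y))\<^sup>2 \<le> (b - a) * X y" unfolding X_def
        by (rule increment_square_le[OF dx[OF _ xy(2)] continuous_on_slice(1)[OF cont(2) xy(2)] xy(1) x'])
      have 2: "(w (x', y) - W)\<^sup>2 \<le> (d - c) * Y x'" unfolding Y_def W_def
        using cd by (intro increment_square_le[OF dy[OF x'] continuous_on_slice(2)[OF cont(3) x'] xy(2)]) auto
      have "(w p)\<^sup>2 - 2 * W * w p + W\<^sup>2 = ((w (x, y) - w (x', y)) + (w (x', y) - W))\<^sup>2"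
        by (simp add: power2_eq_square algebra_simps)
      also have "\<dots> \<le> 2 * (w (x, y) - w (x', y))\<^sup>2 + 2 * (w (x', y) - W)\<^sup>2"
        using zero_le_power2[of "(w (x, y) - w (x', y)) - (w (x', y) - W)"]
        by (simp add: power2_eq_square algebra_simps)
      also have "\<dots> \<le> 2 * ((b - a) * X y) + 2 * ((d - c) * Y x')" using 1 2 by linarith
      finally show ?thesis by (simp add: algebra_simps)
    qed
    then have "rint a b c d (\<lambda>p. (w p)\<^sup>2 - 2 * W * w p + W\<^sup>2) \<le> rint a b c d (\<lambda>p. 2 * (b - a) * X (snd p) + 2 * (d - c) * Y x')"
      by (intro integral_le integrable_continuous continuous_intros cont cX2) auto
    also have "rint a b c d (\<lambda>p. (w p)\<^sup>2 - 2 * W * w p + W\<^sup>2)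
        = rint a b c d (\<lambda>p. (w p)\<^sup>2) + W\<^sup>2 * ((b - a) * (d - c))"
      by (subst integral_add integral_diff,
          (intro integrable_continuous continuous_intros cont)+)+ (simp add: mean area)
    also have "rint a b c d (\<lambda>p. 2 * (b - a) * X (snd p) + 2 * (d - c) * Y x')
        = 2 * (b - a) * ((b - a) * rint a b c d (\<lambda>p. (wx p)\<^sup>2)) + 2 * (d - c) * Y x' * ((b - a) * (d - c))"
      by (subst integral_add, (intro integrable_continuous continuous_intros cX2)+) (simp add: iX area)
    finally have "rint a b c d (\<lambda>p. (w p)\<^sup>2) + W\<^sup>2 * ((b - a) * (d - c)) \<le>
      2 * (b - a)\<^sup>2 * rint a b c d (\<lambda>p. (wx p)\<^sup>2) + 2 * (d - c)\<^sup>2 * (b - a) * Y x'"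
      by (simp add: power2_eq_square algebra_simps)
    moreover have "0 \<le> W\<^sup>2 * ((b - a) * (d - c))" using ab cd by simp
    ultimately show ?thesis by linarith
  qed
  have "integral {a..b} (\<lambda>x'. rint a b c d (\<lambda>p. (w p)\<^sup>2)) \<le>
     integral {a..b} (\<lambda>x'. 2 * (b - a)\<^sup>2 * rint a b c d (\<lambda>p. (wx p)\<^sup>2) + 2 * (d - c)\<^sup>2 * (b - a) * Y x')"
    by (intro integral_le integrable_continuous_real continuous_intros cY step)
  also have "\<dots> = (b - a) * (2 * (b - a)\<^sup>2 * rint a b c d (\<lambda>p. (wx p)\<^sup>2)) + 2 * (d - c)\<^sup>2 * (b - a) * integral {a..b} Y"
    by (subst integral_add, (intro integrable_continuous_real continuous_intros cY)+) (use ab in simp)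
  also have "integral {a..b} Y = rint a b c d (\<lambda>p. (wy p)\<^sup>2)"
    unfolding Y_def rint_iterated(1)[OF c2(3)] ..
  finally have "(b - a) * rint a b c d (\<lambda>p. (w p)\<^sup>2) \<le> (b - a) *
     (2 * (b - a)\<^sup>2 * rint a b c d (\<lambda>p. (wx p)\<^sup>2) + 2 * (d - c)\<^sup>2 * rint a b c d (\<lambda>p. (wy p)\<^sup>2))"
    using ab by (simp add: algebra_simps)
  then show ?thesis using ab by simp
qed

lemma integral_split_sum:
  fixes f :: "real \<Rightarrow> 'a::banach"
  assumes "mono s" "continuous_on {s 0..s n} f"
  shows "integral {s 0..s n} f = (\<Sum>i<n. integral {s i..s (Suc i)} f)"
  using assms(2)
proof (induction n)
  case (Suc n)
  have m: "s 0 \<le> s n" "s n \<le> s (Suc n)" using assms(1) by (auto simp: mono_def)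
  have "integral {s 0..s (Suc n)} f = integral {s 0..s n} f + integral {s n..s (Suc n)} f"
    using Henstock_Kurzweil_Integration.integral_combine[OF m integrable_continuous_real[OF Suc.prems]] by simp
  also have "integral {s 0..s n} f = (\<Sum>i<n. integral {s i..s (Suc i)} f)"
    using m by (intro Suc.IH continuous_on_subset[OF Suc.prems]) auto
  finally show ?case by simp
qed simp

lemma rint_split_sum:
  assumes s: "mono s" and t: "mono t" and f: "continuous_on (cbox (s 0, t 0) (s n, t m)) f"
  shows "rint (s 0) (s n) (t 0) (t m) f = (\<Sum>i<n. \<Sum>j<m. rint (s i) (s (Suc i)) (t j) (t (Suc j)) f)"
proof -
  have sub: "cbox (s i, t j) (s (Suc i), t (Suc j)) \<subseteq> cbox (s 0, t 0) (s n, t m)" if "i < n" "j < m" for i j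
  proof -
    have "s 0 \<le> s i" "s (Suc i) \<le> s n" "t 0 \<le> t j" "t (Suc j) \<le> t m"
      using s t that by (auto simp: mono_def)
    then show ?thesis by (auto simp: cbox_Pair_eq)
  qed
  have sub2: "cbox (s i, t 0) (s (Suc i), t m) \<subseteq> cbox (s 0, t 0) (s n, t m)" if "i < n" for i
  proof -
    have "s 0 \<le> s i" "s (Suc i) \<le> s n" using s that by (auto simp: mono_def)
    then show ?thesis by (auto simp: cbox_Pair_eq)
  qed
  have "rint (s 0) (s n) (t 0) (t m) f = (\<Sum>i<n. integral {s i..s (Suc i)} (\<lambda>x. integral {t 0..t m} (\<lambda>y. f (x, y))))"
    unfolding rint_iterated(1)[OF f]
    by (rule integral_split_sum[OF s continuous_on_integral_slice(1)[OF f]])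
  also have "\<dots> = (\<Sum>i<n. rint (s i) (s (Suc i)) (t 0) (t m) f)"
    by (intro sum.cong refl rint_iterated(1)[symmetric] continuous_on_subset[OF f sub2]) auto
  also have "\<dots> = (\<Sum>i<n. \<Sum>j<m. rint (s i) (s (Suc i)) (t j) (t (Suc j)) f)"
  proof (intro sum.cong refl)
    fix i assume i: "i \<in> {..<n}"
    have fi: "continuous_on (cbox (s i, t 0) (s (Suc i), t m)) f"
      using continuous_on_subset[OF f sub2] i by auto
    have "rint (s i) (s (Suc i)) (t 0) (t m) f
      = (\<Sum>j<m. integral {t j..t (Suc j)} (\<lambda>y. integral {s i..s (Suc i)} (\<lambda>x. f (x, y))))"
      unfolding rint_iterated(2)[OF fi]
      by (rule integral_split_sum[OF t continuous_on_integral_slice(2)[OF fi]])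
    also have "\<dots> = (\<Sum>j<m. rint (s i) (s (Suc i)) (t j) (t (Suc j)) f)"
      using i by (intro sum.cong refl rint_iterated(2)[symmetric] continuous_on_subset[OF f sub]) auto
    finally show "rint (s i) (s (Suc i)) (t 0) (t m) f = (\<Sum>j<m. rint (s i) (s (Suc i)) (t j) (t (Suc j)) f)" .
  qed
  finally show ?thesis .
qed

text \<open>A real problem on one period, to be applied to the real and the imaginary part of a
  complex solution. Both boundary conditions use the derivative in \<open>y\<close>, which is the
  outward normal derivative at the top only; since the coefficients are bounded in absolute value,
  the sign is immaterial for the estimates.\<close>

locale robin_problem =
  fixes L T Q R :: real and w wx wy wxx wyy q :: "real \<times> real \<Rightarrow> real" and r1 r2 :: "real \<Rightarrow> real"
  assumes L: "0 < L" and T: "0 < T"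
    and cont: "continuous_on (cbox (0, - T) (L, T)) w" "continuous_on (cbox (0, - T) (L, T)) wx"
      "continuous_on (cbox (0, - T) (L, T)) wy" "continuous_on (cbox (0, - T) (L, T)) wxx"
      "continuous_on (cbox (0, - T) (L, T)) wyy" "continuous_on (cbox (0, - T) (L, T)) q"
      "continuous_on {0..L} r1" "continuous_on {0..L} r2"
    and dx: "\<And>x y. x \<in> {0..L} \<Longrightarrow> y \<in> {- T..T} \<Longrightarrow>
        ((\<lambda>x. w (x, y)) has_real_derivative wx (x, y)) (at x within {0..L})"
      "\<And>x y. x \<in> {0..L} \<Longrightarrow> y \<in> {- T..T} \<Longrightarrow>
        ((\<lambda>x. wx (x, y)) has_real_derivative wxx (x, y)) (at x within {0..L})"
    and dy: "\<And>x y. x \<in> {0..L} \<Longrightarrow> y \<in> {- T..T} \<Longrightarrow>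
        ((\<lambda>y. w (x, y)) has_real_derivative wy (x, y)) (at y within {- T..T})"
      "\<And>x y. x \<in> {0..L} \<Longrightarrow> y \<in> {- T..T} \<Longrightarrow>
        ((\<lambda>y. wy (x, y)) has_real_derivative wyy (x, y)) (at y within {- T..T})"
    and per: "\<And>y. y \<in> {- T..T} \<Longrightarrow> w (L, y) = w (0, y)" "\<And>y. y \<in> {- T..T} \<Longrightarrow> wx (L, y) = wx (0, y)"
    and eq: "\<And>p. p \<in> cbox (0, - T) (L, T) \<Longrightarrow> wxx p + wyy p = - q p * w p"
    and robin: "\<And>x. x \<in> {0..L} \<Longrightarrow> wy (x, T) = r1 x * w (x, T)"
      "\<And>x. x \<in> {0..L} \<Longrightarrow> wy (x, - T) = r2 x * w (x, - T)"
    and bound: "\<And>p. p \<in> cbox (0, - T) (L, T) \<Longrightarrow> q p \<le> Q" "\<And>x. x \<in> {0..L} \<Longrightarrow> \<bar>r1 x\<bar> \<le> R"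
      "\<And>x. x \<in> {0..L} \<Longrightarrow> \<bar>r2 x\<bar> \<le> R"
begin

text \<open>
  Multiplying the equation by \<open>w\<close> and integrating gives the Dirichlet energy of
  \<open>w\<close>. The boundary term is the flux of \<open>\<rho> w\<^sup>2\<close>, where \<open>\<rho>\<close> interpolates the Robin coefficients,
  so that it is absorbed without a trace inequality.
\<close>

lemma robin_energy_estimate:
  shows "rint 0 L (- T) T (\<lambda>p. (wx p)\<^sup>2) + rint 0 L (- T) T (\<lambda>p. (wy p)\<^sup>2) / 2
    \<le> (Q + R / T + 2 * R\<^sup>2) * rint 0 L (- T) T (\<lambda>p. (w p)\<^sup>2)"
proof -
  let ?B = "cbox (0, - T) (L, T)"
  define \<rho> where "\<rho> = (\<lambda>(x, y). (r1 x * (y + T) + r2 x * (T - y)) / (2 * T))"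
  define \<sigma> where "\<sigma> x = (r1 x - r2 x) / (2 * T)" for x
  have R0: "R \<ge> 0" using bound(2)[of 0] L by auto
  have cr: "continuous_on ?B (\<lambda>p. r1 (fst p))" "continuous_on ?B (\<lambda>p. r2 (fst p))"
    by (rule continuous_on_compose2[OF cont(7)] continuous_on_compose2[OF cont(8)]; auto intro!: continuous_intros)+
  have c\<rho>: "continuous_on ?B \<rho>" unfolding \<rho>_def case_prod_unfold using T
    by (intro continuous_intros cr) auto
  have c\<sigma>: "continuous_on ?B (\<lambda>p. \<sigma> (fst p))" unfolding \<sigma>_def using T
    by (intro continuous_intros cr) auto
  have \<rho>b: "\<bar>\<rho> p\<bar> \<le> R" if pB: "p \<in> ?B" for p
  proof -
    obtain x y where p: "p = (x, y)" and x: "x \<in> {0..L}" and y: "y \<in> {- T..T}" using pB by (cases p) auto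
    have "\<bar>r1 x * (y + T) + r2 x * (T - y)\<bar> \<le> \<bar>r1 x\<bar> * (y + T) + \<bar>r2 x\<bar> * (T - y)"
      using y by (intro order_trans[OF abs_triangle_ineq]) (auto simp: abs_mult)
    also have "\<dots> \<le> R * (y + T) + R * (T - y)"
      using bound x y by (intro add_mono mult_right_mono) auto
    finally show ?thesis using T unfolding p \<rho>_def by (simp add: field_simps)
  qed
  have \<sigma>b: "\<sigma> x \<le> R / T" if "x \<in> {0..L}" for x
  proof -
    have "r1 x - r2 x \<le> 2 * R" using bound(2,3)[OF that] by linarith
    then have "\<sigma> x \<le> 2 * R / (2 * T)" unfolding \<sigma>_def using T by (intro divide_right_mono) auto
    then show ?thesis by simp
  qed
  \<comment> \<open>\<open>f1\<close> is the \<open>x\<close>-derivative of \<open>w * wx\<close>,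
    and \<open>f2\<close> is the \<open>y\<close>-derivative of
    \<open>w * wy - \<rho> * w\<^sup>2\<close>. The first integrates to 0 by periodicity, the second
    because its primitive vanishes on both boundary lines by the Robin conditions.\<close>
  define f1 where "f1 p = (wx p)\<^sup>2 + w p * wxx p" for p
  define f2 where "f2 p = (wy p)\<^sup>2 + w p * wyy p - (\<sigma> (fst p) * (w p)\<^sup>2 + 2 * \<rho> p * w p * wy p)" for p
  have cf: "continuous_on ?B f1" "continuous_on ?B f2"
    unfolding f1_def f2_def by (intro continuous_intros cont c\<rho> c\<sigma>)+
  have z1: "integral {0..L} (\<lambda>x. f1 (x, y)) = 0" if y: "y \<in> {- T..T}" for y
  proof (rule integral_unique)
    have "((\<lambda>x. f1 (x, y)) has_integral w (L, y) * wx (L, y) - w (0, y) * wx (0, y)) {0..L}"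
    proof (rule fundamental_theorem_of_calculus)
      fix x assume x: "x \<in> {0..L}"
      have "((\<lambda>x. w (x, y) * wx (x, y)) has_real_derivative f1 (x, y)) (at x within {0..L})"
        using DERIV_mult[OF dx(1)[OF x y] dx(2)[OF x y]] by (simp add: f1_def power2_eq_square mult.commute)
      then show "((\<lambda>x. w (x, y) * wx (x, y)) has_vector_derivative f1 (x, y)) (at x within {0..L})"
        by (simp only: has_real_derivative_iff_has_vector_derivative)
    qed (use L in simp)
    then show "((\<lambda>x. f1 (x, y)) has_integral 0) {0..L}" using per y by simp
  qed
  have I1: "rint 0 L (- T) T f1 = 0"
    unfolding rint_iterated(2)[OF cf(1)] by (rule integral_unique, rule has_integral_is_0, rule z1)
  have z2: "integral {- T..T} (\<lambda>y. f2 (x, y)) = 0" if x: "x \<in> {0..L}" for x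
  proof (rule integral_unique)
    let ?g = "\<lambda>y. w (x, y) * wy (x, y) - \<rho> (x, y) * (w (x, y))\<^sup>2"
    have "((\<lambda>y. f2 (x, y)) has_integral ?g T - ?g (- T)) {- T..T}"
    proof (rule fundamental_theorem_of_calculus)
      fix y assume y: "y \<in> {- T..T}"
      have "((\<lambda>y. \<rho> (x, y)) has_real_derivative \<sigma> x) (at y within {- T..T})"
        unfolding \<rho>_def \<sigma>_def using T by (auto intro!: derivative_eq_intros simp: field_simps)
      from DERIV_diff[OF DERIV_mult[OF dy(1)[OF x y] dy(2)[OF x y]]
          DERIV_mult[OF this DERIV_power[OF dy(1)[OF x y], of 2]]]
      have "(?g has_real_derivative f2 (x, y)) (at y within {- T..T})"
        by (simp add: f2_def power2_eq_square algebra_simps)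
      then show "(?g has_vector_derivative f2 (x, y)) (at y within {- T..T})"
        by (simp only: has_real_derivative_iff_has_vector_derivative)
    qed (use T in simp)
    moreover have "?g T = 0" "?g (- T) = 0"
      using robin[OF x] T by (simp_all add: \<rho>_def power2_eq_square)
    ultimately show "((\<lambda>y. f2 (x, y)) has_integral 0) {- T..T}" by simp
  qed
  have I2: "rint 0 L (- T) T f2 = 0"
    unfolding rint_iterated(1)[OF cf(2)] by (rule integral_unique, rule has_integral_is_0, rule z2)
  have pw: "(wx p)\<^sup>2 + (wy p)\<^sup>2 / 2 \<le> f1 p + f2 p + (Q + R / T + 2 * R\<^sup>2) * (w p)\<^sup>2" if p: "p \<in> ?B" for p
  proof -
    have "f1 p + f2 p = (wx p)\<^sup>2 + (wy p)\<^sup>2 + w p * (wxx p + wyy p) - (\<sigma> (fst p) * (w p)\<^sup>2 + 2 * \<rho> p * w p * wy p)"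
      by (simp add: f1_def f2_def algebra_simps)
    also have "w p * (wxx p + wyy p) = - (q p * (w p)\<^sup>2)"
      unfolding eq[OF p] by (simp add: power2_eq_square)
    finally have e: "f1 p + f2 p = (wx p)\<^sup>2 + (wy p)\<^sup>2 - q p * (w p)\<^sup>2 - \<sigma> (fst p) * (w p)\<^sup>2 - 2 * \<rho> p * w p * wy p"
      by simp
    have "fst p \<in> {0..L}" using p by (cases p) auto
    then have "q p * (w p)\<^sup>2 \<le> Q * (w p)\<^sup>2" "\<sigma> (fst p) * (w p)\<^sup>2 \<le> R / T * (w p)\<^sup>2"
      using bound(1)[OF p] \<sigma>b by (intro mult_right_mono; force)+
    \<comment> \<open>The mixed term is absorbed by half of \<open>(wy p)\<^sup>2\<close>; this is
      the origin of the factor one half in the energy and of the summand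
      \<open>2 * R\<^sup>2\<close> in the constant.\<close>
    moreover have "2 * \<rho> p * w p * wy p \<le> 2 * (\<rho> p)\<^sup>2 * (w p)\<^sup>2 + (wy p)\<^sup>2 / 2"
      using zero_le_power2[of "2 * \<rho> p * w p - wy p"] by (simp add: power2_eq_square algebra_simps)
    moreover have "2 * (\<rho> p)\<^sup>2 * (w p)\<^sup>2 \<le> 2 * R\<^sup>2 * (w p)\<^sup>2"
      using \<rho>b[OF p] R0 by (intro mult_right_mono mult_left_mono) (auto simp flip: abs_le_square_iff)
    ultimately show ?thesis unfolding e by (simp add: algebra_simps)
  qed
  have "rint 0 L (- T) T (\<lambda>p. (wx p)\<^sup>2 + (wy p)\<^sup>2 / 2)
      \<le> rint 0 L (- T) T (\<lambda>p. f1 p + f2 p + (Q + R / T + 2 * R\<^sup>2) * (w p)\<^sup>2)"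
    by (intro integral_le integrable_continuous continuous_intros cf cont pw) auto
  also have "rint 0 L (- T) T (\<lambda>p. f1 p + f2 p + (Q + R / T + 2 * R\<^sup>2) * (w p)\<^sup>2)
      = (Q + R / T + 2 * R\<^sup>2) * rint 0 L (- T) T (\<lambda>p. (w p)\<^sup>2)"
    by (subst integral_add, (intro integrable_continuous continuous_intros cf cont)+)+ (simp add: I1 I2)
  also have "rint 0 L (- T) T (\<lambda>p. (wx p)\<^sup>2 + (wy p)\<^sup>2 / 2)
      = rint 0 L (- T) T (\<lambda>p. (wx p)\<^sup>2) + rint 0 L (- T) T (\<lambda>p. (wy p)\<^sup>2) / 2"
    by (subst integral_add, ((intro integrable_continuous continuous_intros cont); simp)+) simp
  finally show ?thesis .
qed

text \<open>The Poincare inequality on a cell gains a factor of order \<open>1 / n\<^sup>2\<close>,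
  while the constant of the energy estimate does not depend on \<open>n\<close>. For large
  \<open>n\<close> the two together bound the square integral of \<open>w\<close> by a proper
  fraction of itself.\<close>

lemma robin_unique_by_cell_means:
  assumes n0: "0 < n" and n: "4 * ((max L (2 * T))\<^sup>2 * (Q + R / T + 2 * R\<^sup>2)) < (real n)\<^sup>2"
    and s: "\<And>i. s i = L * real i / real n" and t: "\<And>j. t j = - T + 2 * T * real j / real n"
    and mean: "\<And>i j. i < n \<Longrightarrow> j < n \<Longrightarrow> rint (s i) (s (Suc i)) (t j) (t (Suc j)) w = 0"
    and p: "p \<in> cbox (0, - T) (L, T)"
  shows "w p = 0"
proof -
  let ?B = "cbox (0, - T) (L, T)" and ?C = "Q + R / T + 2 * R\<^sup>2"
  let ?J = "rint 0 L (- T) T"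
  let ?M = "max L (2 * T)"
  have nn: "?J (\<lambda>p. (f p)\<^sup>2) \<ge> 0" if "continuous_on ?B f" for f
    by (intro integral_nonneg integrable_continuous continuous_intros that) auto
  have energy: "?J (\<lambda>p. (wx p)\<^sup>2) + ?J (\<lambda>p. (wy p)\<^sup>2) / 2 \<le> ?C * ?J (\<lambda>p. (w p)\<^sup>2)"
    by (rule robin_energy_estimate)
  have ms: "mono s" and mt: "mono t"
    using L T by (auto intro!: monoI divide_right_mono mult_left_mono simp: s t)
  have ends: "s 0 = 0" "s n = L" "t 0 = - T" "t n = T" using n0 by (auto simp: s t)
  have ds: "s (Suc i) - s i = L / n" and dt: "t (Suc i) - t i = 2 * T / n" for i
    by (auto simp: s t field_simps add_divide_distrib)
  have split: "?J f = (\<Sum>i<n. \<Sum>j<n. rint (s i) (s (Suc i)) (t j) (t (Suc j)) f)" if "continuous_on ?B f" for f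
    using rint_split_sum[OF ms mt, of n n f] that by (simp add: ends)
  have cell: "rint (s i) (s (Suc i)) (t j) (t (Suc j)) (\<lambda>p. (w p)\<^sup>2)
      \<le> 2 * (?M / n)\<^sup>2 * rint (s i) (s (Suc i)) (t j) (t (Suc j)) (\<lambda>p. (wx p)\<^sup>2)
        + 2 * (?M / n)\<^sup>2 * rint (s i) (s (Suc i)) (t j) (t (Suc j)) (\<lambda>p. (wy p)\<^sup>2)"
    if ij: "i < n" "j < n" for i j
  proof -
    have le: "0 \<le> s i" "s (Suc i) \<le> L" "- T \<le> t j" "t (Suc j) \<le> T"
      using ms mt ij ends by (metis monoD Suc_leI zero_le)+
    have sub: "cbox (s i, t j) (s (Suc i), t (Suc j)) \<subseteq> ?B" "{s i..s (Suc i)} \<subseteq> {0..L}" "{t j..t (Suc j)} \<subseteq> {- T..T}"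
      using le by auto
    have lt: "s i < s (Suc i)" "t j < t (Suc j)" using ds[of i] dt[of j] L T n0 by (auto simp: s t field_simps)
    have "rint (s i) (s (Suc i)) (t j) (t (Suc j)) (\<lambda>p. (w p)\<^sup>2)
      \<le> 2 * (L / n)\<^sup>2 * rint (s i) (s (Suc i)) (t j) (t (Suc j)) (\<lambda>p. (wx p)\<^sup>2)
        + 2 * (2 * T / n)\<^sup>2 * rint (s i) (s (Suc i)) (t j) (t (Suc j)) (\<lambda>p. (wy p)\<^sup>2)"
      unfolding ds[of i, symmetric] dt[of j, symmetric]
    proof (rule poincare_rectangle[OF lt])
      show "((\<lambda>x. w (x, y)) has_real_derivative wx (x, y)) (at x within {s i..s (Suc i)})"
        if "x \<in> {s i..s (Suc i)}" "y \<in> {t j..t (Suc j)}" for x y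
        using that sub by (intro has_field_derivative_subset[OF dx(1) sub(2)]) auto
      show "((\<lambda>y. w (x, y)) has_real_derivative wy (x, y)) (at y within {t j..t (Suc j)})"
        if "x \<in> {s i..s (Suc i)}" "y \<in> {t j..t (Suc j)}" for x y
        using that sub by (intro has_field_derivative_subset[OF dy(1) sub(3)]) auto
    qed (use cont sub mean ij in \<open>auto intro: continuous_on_subset\<close>)
    also have "\<dots> \<le> 2 * (?M / n)\<^sup>2 * rint (s i) (s (Suc i)) (t j) (t (Suc j)) (\<lambda>p. (wx p)\<^sup>2)
        + 2 * (?M / n)\<^sup>2 * rint (s i) (s (Suc i)) (t j) (t (Suc j)) (\<lambda>p. (wy p)\<^sup>2)"
      using L T continuous_on_subset[OF cont(2) sub(1)] continuous_on_subset[OF cont(3) sub(1)]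
      by (intro add_mono mult_mono power_mono divide_right_mono integral_nonneg integrable_continuous continuous_intros) auto
    finally show ?thesis .
  qed
  have "?J (\<lambda>p. (w p)\<^sup>2) \<le> (\<Sum>i<n. \<Sum>j<n. 2 * (?M / n)\<^sup>2 * rint (s i) (s (Suc i)) (t j) (t (Suc j)) (\<lambda>p. (wx p)\<^sup>2)
        + 2 * (?M / n)\<^sup>2 * rint (s i) (s (Suc i)) (t j) (t (Suc j)) (\<lambda>p. (wy p)\<^sup>2))"
    by (subst split) (auto intro!: continuous_intros cont sum_mono cell)
  also have "\<dots> = 2 * (?M / n)\<^sup>2 * ?J (\<lambda>p. (wx p)\<^sup>2) + 2 * (?M / n)\<^sup>2 * ?J (\<lambda>p. (wy p)\<^sup>2)"
    by (subst (1 2) split) (auto intro!: continuous_intros cont simp: sum.distrib sum_distrib_left)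
  \<comment> \<open>The constant doubles because the energy estimate controls only one half of the
    \<open>wy\<close> part.\<close>
  also have "\<dots> \<le> 4 * (?M / n)\<^sup>2 * (?J (\<lambda>p. (wx p)\<^sup>2) + ?J (\<lambda>p. (wy p)\<^sup>2) / 2)"
    using mult_nonneg_nonneg[OF zero_le_power2[of "?M / n"] nn[OF cont(2)]] by (simp add: algebra_simps)
  also have "\<dots> \<le> 4 * (?M / n)\<^sup>2 * (?C * ?J (\<lambda>p. (w p)\<^sup>2))"
    using energy by (intro mult_left_mono) auto
  finally have le: "?J (\<lambda>p. (w p)\<^sup>2) * (real n)\<^sup>2 \<le> ?J (\<lambda>p. (w p)\<^sup>2) * (4 * (?M\<^sup>2 * ?C))"
    using n0 by (simp add: power_divide field_simps)
  have "?J (\<lambda>p. (w p)\<^sup>2) = 0"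
  proof (rule ccontr)
    assume "?J (\<lambda>p. (w p)\<^sup>2) \<noteq> 0"
    then have "?J (\<lambda>p. (w p)\<^sup>2) > 0" using nn[OF cont(1)] by simp
    with le n show False by (simp add: mult_le_cancel_left_pos)
  qed
  moreover have "(L / 2, 0) \<in> box (0, - T) (L, T)"
    using L T by (auto simp: mem_box Basis_prod_def)
  ultimately have "(w p)\<^sup>2 = 0"
    using integral_cbox_eq_0_iff[of "(0, - T)" "(L, T)" "\<lambda>p. (w p)\<^sup>2"] p cont(1)
    by (auto intro!: continuous_intros)
  then show ?thesis by simp
qed

end

section \<open>Parallel frames and monodromy\<close>

definition m2 :: "complex \<Rightarrow> complex \<Rightarrow> complex \<Rightarrow> complex \<Rightarrow> cmat2" where
  "m2 a b c d = (\<chi> i j. if i = 1 then (if j = 1 then a else b) else (if j = 1 then c else d))"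

lemma m2_nth [simp]: "m2 a b c d $ 1 $ 1 = a" "m2 a b c d $ 1 $ 2 = b" "m2 a b c d $ 2 $ 1 = c" "m2 a b c d $ 2 $ 2 = d"
  by (simp_all add: m2_def)

lemma cmat2_eq_iff: "A = B \<longleftrightarrow> A$1$1 = B$1$1 \<and> A$1$2 = B$1$2 \<and> A$2$1 = B$2$1 \<and> A$2$2 = B$2$2" for A B :: cmat2
  by (auto simp: vec_eq_iff forall_2)

lemma cmat2_mult_nth [simp]:
  "(A ** B) $ 1 $ 1 = A$1$1 * B$1$1 + A$1$2 * B$2$1" "(A ** B) $ 1 $ 2 = A$1$1 * B$1$2 + A$1$2 * B$2$2"
  "(A ** B) $ 2 $ 1 = A$2$1 * B$1$1 + A$2$2 * B$2$1" "(A ** B) $ 2 $ 2 = A$2$1 * B$1$2 + A$2$2 * B$2$2"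
  for A B :: cmat2
  by (simp_all add: matrix_matrix_mult_def sum_2)

lemma scaleR_complex_mult: "r *\<^sub>R x = of_real r * x" for x :: complex
  by (rule scaleR_conv_of_real)

lemma mat_1_nth [simp]: "(mat 1 :: cmat2) $ 1 $ 1 = 1" "(mat 1 :: cmat2) $ 1 $ 2 = 0"
  "(mat 1 :: cmat2) $ 2 $ 1 = 0" "(mat 1 :: cmat2) $ 2 $ 2 = 1"
  by (simp_all add: mat_def)

lemma mat_scale_nth [simp]: "(c *\<^sub>M A) $ i $ j = c * A $ i $ j"
  by (simp add: mat_scale_def)

lemma sigma_nth [simp]:
  "sigma_0 $ 1 $ 1 = 1" "sigma_0 $ 1 $ 2 = 0" "sigma_0 $ 2 $ 1 = 0" "sigma_0 $ 2 $ 2 = - 1"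
  "sigma_plus $ 1 $ 1 = 0" "sigma_plus $ 1 $ 2 = 1" "sigma_plus $ 2 $ 1 = 0" "sigma_plus $ 2 $ 2 = 0"
  "sigma_minus $ 1 $ 1 = 0" "sigma_minus $ 1 $ 2 = 0" "sigma_minus $ 2 $ 1 = 1" "sigma_minus $ 2 $ 2 = 0"
  by (simp_all add: sigma_0_def sigma_plus_def sigma_minus_def)

lemma bilinear_cmat2: "bounded_bilinear ((**) :: cmat2 \<Rightarrow> cmat2 \<Rightarrow> cmat2)"
proof -
  have "bilinear ((**) :: cmat2 \<Rightarrow> cmat2 \<Rightarrow> cmat2)"
    unfolding bilinear_def linear_iff by (auto simp: cmat2_eq_iff algebra_simps)
  then show ?thesis by (simp add: bilinear_conv_bounded_bilinear)
qed

lemma bounded_linear_entry: "bounded_linear (\<lambda>A :: cmat2. A $ i $ j)"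
  by (intro bounded_linear_compose[OF bounded_linear_vec_nth bounded_linear_vec_nth])

lemma bounded_linear_mat_scale: "bounded_linear (\<lambda>c. c *\<^sub>M A)"
proof -
  have "linear (\<lambda>c. c *\<^sub>M A)" unfolding linear_iff by (auto simp: cmat2_eq_iff algebra_simps)
  then show ?thesis by (simp add: linear_conv_bounded_linear)
qed

text \<open>In the frame equation the connection acts by multiplication from the right, so these are
  its operator-valued coefficients. Composition reverses the order of the matrix factors.\<close>

definition rmul :: "cmat2 \<Rightarrow> (cmat2 \<Rightarrow>\<^sub>L cmat2)" where
  "rmul A = Blinfun (\<lambda>U. U ** A)"

lemma rmul_apply [simp]: "rmul A U = U ** A"
  unfolding rmul_def
  by (simp add: bounded_linear_Blinfun_apply bounded_bilinear.bounded_linear_left[OF bilinear_cmat2])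

lemma bounded_linear_rmul: "bounded_linear rmul"
proof -
  have "linear rmul"
    unfolding linear_iff by (auto intro!: blinfun_eqI simp: cmat2_eq_iff blinfun.bilinear_simps algebra_simps)
  then show ?thesis by (simp add: linear_conv_bounded_linear)
qed

text \<open>The adjugate, which is the inverse for determinant 1. In size two it is linear, so that
  it can be differentiated like any linear map, and on traceless matrices it is negation; together
  these make it invert the frame.\<close>

definition adj2 :: "cmat2 \<Rightarrow> cmat2" where
  "adj2 A = m2 (A$2$2) (- A$1$2) (- A$2$1) (A$1$1)"

lemma adj2_nth [simp]: "adj2 A $ 1 $ 1 = A$2$2" "adj2 A $ 1 $ 2 = - A$1$2" "adj2 A $ 2 $ 1 = - A$2$1" "adj2 A $ 2 $ 2 = A$1$1"
  by (simp_all add: adj2_def)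

lemma bounded_linear_adj2: "bounded_linear adj2"
proof -
  have "linear adj2" unfolding linear_iff by (auto simp: cmat2_eq_iff)
  then show ?thesis by (simp add: linear_conv_bounded_linear)
qed

lemma adj2_mult: "adj2 (A ** B) = adj2 B ** adj2 A"
  by (auto simp: cmat2_eq_iff algebra_simps)

lemma adj2_traceless: "A$1$1 + A$2$2 = 0 \<Longrightarrow> adj2 A = - A"
  by (auto simp: cmat2_eq_iff add_eq_0_iff2)

section \<open>The Lax connection of a solution, its frame and its monodromy\<close>

locale sinh_gordon_strip =
  fixes T L :: real and \<omega> p q px py qx qy :: "complex \<Rightarrow> real"
  assumes T: "T > 0" and L: "L > 0"
    and d\<omega>: "\<And>z. z \<in> strip T \<Longrightarrow> (\<omega> has_derivative (\<lambda>v. Re v * p z + Im v * q z)) (at z within strip T)"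
    and dp: "\<And>z. z \<in> strip T \<Longrightarrow> (p has_derivative (\<lambda>v. Re v * px z + Im v * py z)) (at z within strip T)"
    and dq: "\<And>z. z \<in> strip T \<Longrightarrow> (q has_derivative (\<lambda>v. Re v * qx z + Im v * qy z)) (at z within strip T)"
    and cont_derivs: "continuous_on (strip T) px" "continuous_on (strip T) py"
      "continuous_on (strip T) qx" "continuous_on (strip T) qy"
    and mixed: "\<And>z. z \<in> strip T \<Longrightarrow> py z = qx z"
    and laplace: "\<And>z. z \<in> strip T \<Longrightarrow> px z + qy z = - sinh (2 * \<omega> z) / 2"
    and periodic: "\<And>z. z \<in> strip T \<Longrightarrow> \<omega> (z + of_real L) = \<omega> z"
      "\<And>z. z \<in> strip T \<Longrightarrow> p (z + of_real L) = p z" "\<And>z. z \<in> strip T \<Longrightarrow> q (z + of_real L) = q z"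
    and smooth: "smooth_on (strip T) \<omega>" "smooth_on (strip T) p" "smooth_on (strip T) q"
begin

text \<open>
  \<open>ax\<close> and \<open>ay\<close> are the components along \<open>dx\<close> and \<open>dy\<close> of the Lax form with \<open>\<lambda> = l\<close> and \<open>\<gamma> = 1\<close>.
\<close>

definition ax :: "complex \<Rightarrow> complex \<Rightarrow> cmat2" where
  "ax l z = m2 (- (\<i> / 2) * of_real (q z)) (\<i> / 4 * (of_real (exp (\<omega> z)) / l + of_real (exp (- \<omega> z))))
     (\<i> / 4 * (of_real (exp (- \<omega> z)) + l * of_real (exp (\<omega> z)))) (\<i> / 2 * of_real (q z))"

definition ay :: "complex \<Rightarrow> complex \<Rightarrow> cmat2" where
  "ay l z = m2 (\<i> / 2 * of_real (p z)) (- (of_real (exp (\<omega> z)) / l - of_real (exp (- \<omega> z))) / 4)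
     (- (of_real (exp (- \<omega> z)) - l * of_real (exp (\<omega> z))) / 4) (- (\<i> / 2) * of_real (p z))"

definition conn :: "complex \<Rightarrow> complex \<Rightarrow> complex \<Rightarrow> cmat2" where
  "conn l z v = Re v *\<^sub>R ax l z + Im v *\<^sub>R ay l z"

lemma strip_shift: "z \<in> strip T \<Longrightarrow> z + of_real L \<in> strip T"
  by (simp add: strip_def)

lemma conn_shift: "z \<in> strip T \<Longrightarrow> conn l (z + of_real L) v = conn l z v"
  by (simp add: conn_def ax_def ay_def periodic)

lemma conn_adj: "adj2 (conn l z v) = - conn l z v"
  by (rule adj2_traceless) (simp add: conn_def ax_def ay_def)

lemma dexp: "z \<in> strip T \<Longrightarrow> ((\<lambda>z. exp (\<omega> z)) has_derivative (\<lambda>v. (Re v * p z + Im v * q z) * exp (\<omega> z))) (at z within strip T)"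
  "z \<in> strip T \<Longrightarrow> ((\<lambda>z. exp (- \<omega> z)) has_derivative (\<lambda>v. - (Re v * p z + Im v * q z) * exp (- \<omega> z))) (at z within strip T)"
  by (auto intro!: derivative_eq_intros d\<omega>)

lemma cont_\<omega>: "continuous_on (strip T) \<omega>" "continuous_on (strip T) p" "continuous_on (strip T) q"
  using d\<omega> dp dq by (meson continuous_on_eq_continuous_within has_derivative_continuous)+

lemma frame_exists:
  assumes l: "l \<noteq> 0"
  shows "\<exists>F. F 0 = mat 1 \<and> (\<forall>z\<in>strip T. (F has_derivative (\<lambda>v. F z ** conn l z v)) (at z within strip T))"
proof -
  define m where "m = 1 / l"
  have lm: "l * m = 1" using l by (simp add: m_def)
  \<comment> \<open>With constant matrices as coefficients of \<open>q\<close>, \<open>p\<close> and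
    the two exponentials, all derivatives of the connection can be taken coefficientwise.\<close>
  define C0 C1 C2 D0 D1 D2 where C: "C0 = m2 (- (\<i> / 2)) 0 0 (\<i> / 2)" "C1 = m2 0 (\<i> * m / 4) (\<i> * l / 4) 0"
    "C2 = m2 0 (\<i> / 4) (\<i> / 4) 0" "D0 = m2 (\<i> / 2) 0 0 (- (\<i> / 2))" "D1 = m2 0 (- m / 4) (l / 4) 0"
    "D2 = m2 0 (1 / 4) (- 1 / 4) 0"
  have ax: "ax l z = q z *\<^sub>R C0 + exp (\<omega> z) *\<^sub>R C1 + exp (- \<omega> z) *\<^sub>R C2" for z
    by (simp add: cmat2_eq_iff ax_def C m_def scaleR_complex_mult algebra_simps)
  have ay: "ay l z = p z *\<^sub>R D0 + exp (\<omega> z) *\<^sub>R D1 + exp (- \<omega> z) *\<^sub>R D2" for z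
    by (simp add: cmat2_eq_iff ay_def C m_def scaleR_complex_mult algebra_simps diff_divide_distrib)
  define Xx Xy Yx Yy where
    X: "Xx z = qx z *\<^sub>R C0 + (p z * exp (\<omega> z)) *\<^sub>R C1 - (p z * exp (- \<omega> z)) *\<^sub>R C2"
     "Xy z = qy z *\<^sub>R C0 + (q z * exp (\<omega> z)) *\<^sub>R C1 - (q z * exp (- \<omega> z)) *\<^sub>R C2"
     "Yx z = px z *\<^sub>R D0 + (p z * exp (\<omega> z)) *\<^sub>R D1 - (p z * exp (- \<omega> z)) *\<^sub>R D2"
     "Yy z = py z *\<^sub>R D0 + (q z * exp (\<omega> z)) *\<^sub>R D1 - (q z * exp (- \<omega> z)) *\<^sub>R D2" for z
  have dax: "(ax l has_derivative (\<lambda>v. Re v *\<^sub>R Xx z + Im v *\<^sub>R Xy z)) (at z within strip T)" if z: "z \<in> strip T" for z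
    unfolding ax by (rule has_derivative_eq_rhs[OF has_derivative_add[OF has_derivative_add[OF
        has_derivative_scaleR_left[OF dq[OF z]] has_derivative_scaleR_left[OF dexp(1)[OF z]]]
        has_derivative_scaleR_left[OF dexp(2)[OF z]]]])
      (simp add: fun_eq_iff X scaleR_add_left scaleR_add_right scaleR_diff_right algebra_simps)
  have day: "(ay l has_derivative (\<lambda>v. Re v *\<^sub>R Yx z + Im v *\<^sub>R Yy z)) (at z within strip T)" if z: "z \<in> strip T" for z
    unfolding ay by (rule has_derivative_eq_rhs[OF has_derivative_add[OF has_derivative_add[OF
        has_derivative_scaleR_left[OF dp[OF z]] has_derivative_scaleR_left[OF dexp(1)[OF z]]]
        has_derivative_scaleR_left[OF dexp(2)[OF z]]]])
      (simp add: fun_eq_iff X scaleR_add_left scaleR_add_right scaleR_diff_right algebra_simps)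
  have cX: "continuous_on (strip T) Xx" "continuous_on (strip T) Xy" "continuous_on (strip T) Yx" "continuous_on (strip T) Yy"
    unfolding X by (intro continuous_intros cont_derivs cont_\<omega>)+
  \<comment> \<open>The zero curvature equation: its diagonal entries are the sinh-Gordon equation,
    its off-diagonal entries cancel identically.\<close>
  have curv: "Yx z + ax l z ** ay l z = Xy z + ay l z ** ax l z" if z: "z \<in> strip T" for z
  proof -
    define E E' where "E = complex_of_real (exp (\<omega> z))" and "E' = complex_of_real (exp (- \<omega> z))"
    have EE: "E * E' = 1" by (simp add: E_def E'_def flip: of_real_mult exp_add)
    have "sinh (2 * \<omega> z) = (exp (\<omega> z) * exp (\<omega> z) - exp (- \<omega> z) * exp (- \<omega> z)) / 2"
      by (simp add: sinh_field_def mult_exp_exp)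
    then have sh: "complex_of_real (sinh (2 * \<omega> z)) = (E * E - E' * E') / 2"
      unfolding E_def E'_def by (simp only: of_real_mult of_real_diff of_real_divide of_real_numeral)
    have "complex_of_real (px z) + complex_of_real (qy z) = - complex_of_real (sinh (2 * \<omega> z)) / 2"
      using arg_cong[OF laplace[OF z], of complex_of_real] by simp
    then have lap: "complex_of_real (px z) = - (E * E - E' * E') / 4 - complex_of_real (qy z)"
      unfolding sh eq_diff_eq by (simp only: divide_divide_eq_left minus_divide_left) simp
    have ii: "\<i> * \<i> = - 1" by simp
    show ?thesis
      unfolding cmat2_eq_iff X ax ay C
      by (simp add: scaleR_complex_mult lap mixed[OF z] flip: E_def E'_def, intro conjI;
          simp add: field_simps; (use lm EE ii in algebra)?)
  qed
  have "\<exists>U. U 0 = mat 1 \<and> (\<forall>z\<in>strip T. (U has_derivative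
      (\<lambda>v. Re v *\<^sub>R rmul (ax l z) (U z) + Im v *\<^sub>R rmul (ay l z) (U z))) (at z within strip T))"
  proof (rule flat_connection_parallel_section[OF convex_strip closed_strip, where
        Axx = "\<lambda>z. rmul (Xx z)" and Axy = "\<lambda>z. rmul (Xy z)" and Ayx = "\<lambda>z. rmul (Yx z)" and Ayy = "\<lambda>z. rmul (Yy z)"])
    show "0 \<in> strip T" using T by (simp add: strip_def)
    have lin: "rmul (a *\<^sub>R A + b *\<^sub>R B) = a *\<^sub>R rmul A + b *\<^sub>R rmul B" for a b A B
      using bounded_linear.linear[OF bounded_linear_rmul] by (simp add: linear_add linear_scale)
    show "((\<lambda>z. rmul (ax l z)) has_derivative (\<lambda>v. Re v *\<^sub>R rmul (Xx z) + Im v *\<^sub>R rmul (Xy z))) (at z within strip T)"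
      if "z \<in> strip T" for z
      using bounded_linear.has_derivative[OF bounded_linear_rmul dax[OF that]] by (simp add: lin)
    show "((\<lambda>z. rmul (ay l z)) has_derivative (\<lambda>v. Re v *\<^sub>R rmul (Yx z) + Im v *\<^sub>R rmul (Yy z))) (at z within strip T)"
      if "z \<in> strip T" for z
      using bounded_linear.has_derivative[OF bounded_linear_rmul day[OF that]] by (simp add: lin)
    show "rmul (Yx z) + (rmul (ay l z) o\<^sub>L rmul (ax l z)) = rmul (Xy z) + (rmul (ax l z) o\<^sub>L rmul (ay l z))"
      if "z \<in> strip T" for z
    proof (rule blinfun_eqI)
      fix U :: cmat2
      show "(rmul (Yx z) + (rmul (ay l z) o\<^sub>L rmul (ax l z))) U = (rmul (Xy z) + (rmul (ax l z) o\<^sub>L rmul (ay l z))) U"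
        using arg_cong[OF curv[OF that], of "\<lambda>A. U ** A"]
        by (simp add: blinfun.bilinear_simps matrix_add_ldistrib matrix_mul_assoc)
    qed
  qed (intro bounded_linear.continuous_on[OF bounded_linear_rmul] cX)+
  moreover have "Re v *\<^sub>R rmul (ax l z) U + Im v *\<^sub>R rmul (ay l z) U = U ** conn l z v" for v z U
    by (simp add: conn_def cmat2_eq_iff scaleR_complex_mult algebra_simps)
  ultimately show ?thesis by simp
qed

definition frame :: "complex \<Rightarrow> complex \<Rightarrow> cmat2" where
  "frame l = (SOME F. F 0 = mat 1 \<and>
     (\<forall>z\<in>strip T. (F has_derivative (\<lambda>v. F z ** conn l z v)) (at z within strip T)))"

lemma frame_0: "l \<noteq> 0 \<Longrightarrow> frame l 0 = mat 1"
  and dframe: "l \<noteq> 0 \<Longrightarrow> z \<in> strip T \<Longrightarrow>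
    (frame l has_derivative (\<lambda>v. frame l z ** conn l z v)) (at z within strip T)"
  using someI_ex[OF frame_exists] unfolding frame_def by blast+

lemma dframe_adj: "l \<noteq> 0 \<Longrightarrow> z \<in> strip T \<Longrightarrow>
    ((\<lambda>z. adj2 (frame l z)) has_derivative (\<lambda>v. - conn l z v ** adj2 (frame l z))) (at z within strip T)"
  using bounded_linear.has_derivative[OF bounded_linear_adj2 dframe] by (simp add: adj2_mult conn_adj)

lemma zero_in_strip: "0 \<in> strip T"
  using T by (simp add: strip_def)

lemma frame_adj_right: assumes "l \<noteq> 0" "z \<in> strip T" shows "frame l z ** adj2 (frame l z) = mat 1"
proof -
  have "((\<lambda>z. frame l z ** adj2 (frame l z)) has_derivative (\<lambda>v. 0)) (at z within strip T)" if "z \<in> strip T" for z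
    by (rule has_derivative_eq_rhs[OF bounded_bilinear.FDERIV[OF bilinear_cmat2 dframe[OF assms(1) that] dframe_adj[OF assms(1) that]]])
       (simp add: fun_eq_iff cmat2_eq_iff algebra_simps)
  from has_derivative_zero_unique[OF convex_strip this assms(2) zero_in_strip]
  show ?thesis by (simp add: frame_0[OF assms(1)] cmat2_eq_iff)
qed

lemma frame_adj_left: "l \<noteq> 0 \<Longrightarrow> z \<in> strip T \<Longrightarrow> adj2 (frame l z) ** frame l z = mat 1"
  using frame_adj_right matrix_left_right_inverse by blast

text \<open>The holonomy over one period based at \<open>z\<close>, with the adjugate in the role of
  the inverse. Moving the base point conjugates it by parallel transport, which is why its
  derivative is a commutator.\<close>

definition monodromy :: "complex \<Rightarrow> complex \<Rightarrow> cmat2" where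
  "monodromy l z = adj2 (frame l z) ** frame l (z + of_real L)"

lemma dframe_shift:
  assumes "l \<noteq> 0" "z \<in> strip T"
  shows "((\<lambda>z. frame l (z + of_real L)) has_derivative (\<lambda>v. frame l (z + of_real L) ** conn l z v)) (at z within strip T)"
proof -
  have 1: "(\<lambda>z. z + of_real L) ` strip T \<subseteq> strip T" using strip_shift by blast
  have 2: "((\<lambda>z. z + of_real L) has_derivative (\<lambda>v. v)) (at z within strip T)"
    by (auto intro!: derivative_eq_intros)
  from has_derivative_in_compose2[OF dframe[OF assms(1)] 1 assms(2) 2] show ?thesis
    by (simp add: conn_shift assms(2))
qed

lemma dmonodromy:
  assumes "l \<noteq> 0" "z \<in> strip T"
  shows "(monodromy l has_derivative (\<lambda>v. bracket (monodromy l z) (conn l z v))) (at z within strip T)"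
  unfolding monodromy_def
  by (rule has_derivative_eq_rhs[OF bounded_bilinear.FDERIV[OF bilinear_cmat2 dframe_adj[OF assms] dframe_shift[OF assms]]])
     (simp add: fun_eq_iff bracket_def cmat2_eq_iff algebra_simps)

text \<open>The frame and its translate solve the same equation, so the translate is a constant
  matrix times the frame. Conjugating this constant by the frame at \<open>z\<close> or at its
  translate gives the same matrix.\<close>

lemma monodromy_shift:
  assumes l: "l \<noteq> 0" and z: "z \<in> strip T"
  shows "monodromy l (z + of_real L) = monodromy l z"
proof -
  have "((\<lambda>z. frame l (z + of_real L) ** adj2 (frame l z)) has_derivative (\<lambda>v. 0)) (at z within strip T)" if "z \<in> strip T" for z
    by (rule has_derivative_eq_rhs[OF bounded_bilinear.FDERIV[OF bilinear_cmat2 dframe_shift[OF l that] dframe_adj[OF l that]]])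
       (simp add: fun_eq_iff cmat2_eq_iff algebra_simps)
  from has_derivative_zero_unique[OF convex_strip this strip_shift[OF z] z]
  have "frame l (z + of_real L + of_real L) ** adj2 (frame l (z + of_real L)) = frame l (z + of_real L) ** adj2 (frame l z)" .
  then have "frame l (z + of_real L + of_real L) ** (adj2 (frame l (z + of_real L)) ** frame l (z + of_real L))
     = frame l (z + of_real L) ** adj2 (frame l z) ** frame l (z + of_real L)"
    by (simp add: matrix_mul_assoc)
  then have "frame l (z + of_real L + of_real L) = frame l (z + of_real L) ** (adj2 (frame l z) ** frame l (z + of_real L))"
    by (simp add: frame_adj_left[OF l strip_shift[OF z]] matrix_mul_assoc)
  then have "monodromy l (z + of_real L) = adj2 (frame l (z + of_real L)) ** (frame l (z + of_real L) ** (adj2 (frame l z) ** frame l (z + of_real L)))"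
    by (simp add: monodromy_def)
  then show ?thesis
    unfolding matrix_mul_assoc by (simp add: frame_adj_left[OF l strip_shift[OF z]] monodromy_def)
qed

text \<open>
  Where the normal derivative of \<open>\<omega>\<close> is \<open>A e\<^sup>\<omega> + B e\<^sup>-\<^sup>\<omega>\<close>, the tangential part of the connection is
  a combination of two constant traceless matrices \<open>P\<close> and \<open>Q\<close>, and inverting \<open>l\<close> transposes both.
  The commutator of \<open>P\<close> and \<open>Q\<close> anticommutes with \<open>P\<close> and \<open>Q\<close>, and \<open>J = (0, 1; -1, 0)\<close> conjugates a
  traceless matrix to minus its transpose. Hence \<open>kmat\<close>, which is the commutator times \<open>J\<close>,
  intertwines \<open>P\<close>, \<open>Q\<close> with their transposes.
\<close>

definition kmat :: "real \<Rightarrow> real \<Rightarrow> complex \<Rightarrow> cmat2" where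
  "kmat A B l = m2 (4 * of_real A - 4 * of_real B / l) (1 / l - l) (1 / l - l) (4 * of_real A - 4 * of_real B * l)"

lemma ax_kmat:
  assumes "l \<noteq> 0" and "q z = A * exp (\<omega> z) + B * exp (- \<omega> z)"
  shows "ax l z ** kmat A B l = kmat A B l ** ax (1 / l) z"
  using assms(1) by (simp add: cmat2_eq_iff ax_def kmat_def assms(2) field_simps)

text \<open>Along the boundary line the constant matrix intertwines the tangential connections at
  \<open>l\<close> and \<open>1 / l\<close>, so its product with the frame at \<open>l\<close> on
  the left and the inverse frame at \<open>1 / l\<close> on the right is constant there. Comparing
  the values at both ends of a period gives the claim.\<close>

lemma monodromy_kmat:
  assumes l: "l \<noteq> 0" and y: "\<bar>y\<bar> \<le> T"
    and bc: "\<And>z. Im z = y \<Longrightarrow> q z = A * exp (\<omega> z) + B * exp (- \<omega> z)"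
    and z: "Im z = y"
  shows "monodromy l z ** kmat A B l = kmat A B l ** monodromy (1 / l) z"
proof -
  define K where "K = kmat A B l"
  have l': "1 / l \<noteq> 0" using l by simp
  define G where "G z = frame l z ** K ** adj2 (frame (1 / l) z)" for z
  have st: "Complex x y \<in> strip T" for x using y by (auto simp: strip_def)
  have dG: "(G has_derivative (\<lambda>v. frame l z ** K ** (- conn (1 / l) z v ** adj2 (frame (1 / l) z))
      + frame l z ** conn l z v ** K ** adj2 (frame (1 / l) z))) (at z within strip T)" if "z \<in> strip T" for z
    unfolding G_def
    by (rule bounded_bilinear.FDERIV[OF bilinear_cmat2
        bounded_linear.has_derivative[OF bounded_bilinear.bounded_linear_left[OF bilinear_cmat2] dframe[OF l that]]
        dframe_adj[OF l' that]])
  have dC: "((\<lambda>x. Complex x y) has_derivative (\<lambda>t. of_real t)) (at x within UNIV)" for x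
    unfolding Complex_eq by (auto intro!: derivative_eq_intros)
  have "((\<lambda>x. G (Complex x y)) has_derivative (\<lambda>v. 0)) (at x within UNIV)" for x
  proof -
    have "q (Complex x y) = A * exp (\<omega> (Complex x y)) + B * exp (- \<omega> (Complex x y))" by (rule bc) simp
    from ax_kmat[OF l this] have *: "K ** ax (1 / l) (Complex x y) = ax l (Complex x y) ** K" by (simp add: K_def)
    have Kc: "K ** conn (1 / l) (Complex x y) (of_real t) = conn l (Complex x y) (of_real t) ** K" for t
      using arg_cong[OF *, of "\<lambda>A. t *\<^sub>R A"] by (simp add: conn_def cmat2_eq_iff scaleR_complex_mult algebra_simps)
    have Z: "X ** K ** (- conn (1 / l) (Complex x y) (of_real t) ** U)
      + X ** conn l (Complex x y) (of_real t) ** K ** U = 0" for t and U X :: cmat2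
    proof -
      have "X ** K ** (- conn (1 / l) (Complex x y) (of_real t) ** U)
        = - (X ** (K ** conn (1 / l) (Complex x y) (of_real t)) ** U)"
        by (simp add: cmat2_eq_iff algebra_simps)
      then show ?thesis unfolding Kc by (simp add: matrix_mul_assoc)
    qed
    have "range (\<lambda>x. Complex x y) \<subseteq> strip T" using st by blast
    from has_derivative_in_compose2[OF dG this UNIV_I[of x] dC] show ?thesis by (simp add: Z)
  qed
  from has_derivative_zero_unique[OF convex_UNIV this UNIV_I UNIV_I]
  have "G (Complex (Re z + L) y) = G (Complex (Re z) y)" by blast
  then have "G (z + of_real L) = G z" using z by (metis Complex_eq add.commute complex_eqI complex_surj plus_complex.sel Re_complex_of_real Im_complex_of_real add.right_neutral complex.sel)
  moreover have zs: "z \<in> strip T" using z y by (auto simp: strip_def)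
  ultimately have "frame l (z + of_real L) ** K ** adj2 (frame (1 / l) (z + of_real L)) = frame l z ** K ** adj2 (frame (1 / l) z)"
    by (simp add: G_def)
  then have "adj2 (frame l z) ** (frame l (z + of_real L) ** K ** adj2 (frame (1 / l) (z + of_real L))) ** frame (1 / l) (z + of_real L)
    = adj2 (frame l z) ** (frame l z ** K ** adj2 (frame (1 / l) z)) ** frame (1 / l) (z + of_real L)" by simp
  also have "\<dots> = (adj2 (frame l z) ** frame l z) ** K ** monodromy (1 / l) z"
    by (simp add: monodromy_def matrix_mul_assoc)
  also have "\<dots> = K ** monodromy (1 / l) z" by (simp add: frame_adj_left[OF l zs])
  also have "adj2 (frame l z) ** (frame l (z + of_real L) ** K ** adj2 (frame (1 / l) (z + of_real L))) ** frame (1 / l) (z + of_real L)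
    = monodromy l z ** K ** (adj2 (frame (1 / l) (z + of_real L)) ** frame (1 / l) (z + of_real L))"
    by (simp add: monodromy_def matrix_mul_assoc)
  finally show ?thesis by (simp add: frame_adj_left[OF l' strip_shift[OF zs]] K_def)
qed

end

section \<open>Entries of parallel matrices, and the boundary relations of the monodromy\<close>

lemma Ck_on_mult: "T > 0 \<Longrightarrow> Ck_on k (strip T) f \<Longrightarrow> Ck_on k (strip T) g \<Longrightarrow> Ck_on k (strip T) (\<lambda>z. f z * g z)"
  for f g :: "complex \<Rightarrow> complex"
  by (rule Ck_on_bilinear[OF _ bounded_bilinear_mult])

lemma Ck_on_of_real: "T > 0 \<Longrightarrow> Ck_on k (strip T) f \<Longrightarrow> Ck_on k (strip T) (\<lambda>z. complex_of_real (f z))"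
  by (rule Ck_on_bounded_linear[OF _ bounded_linear_of_real])

lemma Ck_on_minus: "T > 0 \<Longrightarrow> Ck_on k (strip T) f \<Longrightarrow> Ck_on k (strip T) (\<lambda>z. - f z)"
  by (rule Ck_on_bounded_linear[OF _ bounded_linear_minus[OF bounded_linear_ident]])

text \<open>Turns a matrix intertwining into scalar relations: every further pair \<open>P\<close>,
  \<open>P'\<close> intertwined by the same \<open>K\<close> yields one linear equation between the
  entries of \<open>M\<close> and \<open>M'\<close>.\<close>

lemma trace_intertwined:
  fixes M M' P P' K :: cmat2
  assumes MK: "M ** K = K ** M'" and PK: "P ** K = K ** P'" and K: "det K \<noteq> 0"
  shows "trace (M ** P) = trace (M' ** P')"
proof -
  obtain K' where K': "K ** K' = mat 1" "K' ** K = mat 1"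
    using K invertible_det_nz[of K] unfolding invertible_def by blast
  have M: "M = K ** M' ** K'" and P: "P = K ** P' ** K'"
    by (metis MK PK K'(1) matrix_mul_assoc matrix_mul_rid)+
  have "M ** P = K ** M' ** (K' ** K) ** P' ** K'"
    unfolding M P by (simp only: matrix_mul_assoc)
  also have "\<dots> = K ** (M' ** P' ** K')" unfolding K'(2) by (simp add: matrix_mul_assoc)
  finally have "trace (M ** P) = trace (M' ** P' ** K' ** K)"
    by (simp add: trace_mul_sym[of K])
  also have "M' ** P' ** K' ** K = M' ** P'"
    by (metis K'(2) matrix_mul_assoc matrix_mul_rid)
  finally show ?thesis .
qed

context sinh_gordon_strip
begin

definition E :: "complex \<Rightarrow> complex" where "E z = of_real (exp (\<omega> z))"
definition E' :: "complex \<Rightarrow> complex" where "E' z = of_real (exp (- \<omega> z))"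
definition wz :: "complex \<Rightarrow> complex" where "wz z = (1 / 2) * (of_real (p z) + (- \<i>) * of_real (q z))"
definition wb :: "complex \<Rightarrow> complex" where "wb z = (1 / 2) * (of_real (p z) + \<i> * of_real (q z))"

lemma Ck_coefficients: "Ck_on k (strip T) E" "Ck_on k (strip T) E'" "Ck_on k (strip T) wz" "Ck_on k (strip T) wb"
proof -
  note sm = smooth[unfolded smooth_on_def, rule_format]
  show "Ck_on k (strip T) E" "Ck_on k (strip T) E'"
    unfolding E_def E'_def
    by (intro Ck_on_of_real Ck_on_exp Ck_on_minus sm T)+
  show "Ck_on k (strip T) wz" "Ck_on k (strip T) wb"
    unfolding wz_def wb_def
    by (intro Ck_on_mult Ck_on_add Ck_on_const Ck_on_of_real sm T)+
qed

text \<open>The coefficients of \<open>v\<close> and \<open>cnj v\<close> are the Wirtinger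
  derivatives of the three entries. They are built from sums, products and negations only, matching
  the closure rules for \<open>Ck_on\<close>.\<close>

abbreviation "Df l g h z v \<equiv> v * (\<i> / 4 * (E' z * g z + - (1 / l) * (E z * h z)))
  + cnj v * (\<i> / 4 * (l * (E z * g z) + - (E' z * h z)))"
abbreviation "Dg l f g z v \<equiv> v * (- (wz z * g z) + \<i> / (2 * l) * (E z * f z))
  + cnj v * (wb z * g z + \<i> / 2 * (E' z * f z))"
abbreviation "Dh l f h z v \<equiv> v * (wz z * h z + - (\<i> / 2) * (E' z * f z))
  + cnj v * (- (wb z * h z) + - (\<i> * l / 2) * (E z * f z))"

text \<open>
  The entries \<open>f\<close>, \<open>g\<close>, \<open>h\<close> of a traceless matrix \<open>(f, g; h, -f)\<close> which is parallel
  for the connection with spectral parameters \<open>\<lambda> = l\<close> and \<open>\<gamma> = 1\<close>. Conjugation by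
  a constant diagonal matrix reduces the general case to this one.
\<close>

definition parallel_entries ::
  "complex \<Rightarrow> (complex \<Rightarrow> complex) \<Rightarrow> (complex \<Rightarrow> complex) \<Rightarrow> (complex \<Rightarrow> complex) \<Rightarrow> bool" where
  "parallel_entries l f g h \<longleftrightarrow> (\<forall>z\<in>strip T.
     (f has_derivative (\<lambda>v. Df l g h z v)) (at z within strip T) \<and>
     (g has_derivative (\<lambda>v. Dg l f g z v)) (at z within strip T) \<and>
     (h has_derivative (\<lambda>v. Dh l f h z v)) (at z within strip T))"

lemma parallel_entriesD:
  assumes "parallel_entries l f g h" "z \<in> strip T"
  shows "(f has_derivative (\<lambda>v. Df l g h z v)) (at z within strip T)"
    "(g has_derivative (\<lambda>v. Dg l f g z v)) (at z within strip T)"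
    "(h has_derivative (\<lambda>v. Dh l f h z v)) (at z within strip T)"
  using assms by (auto simp: parallel_entries_def)

text \<open>Bootstrapping: the derivatives are bilinear in the entries and smooth coefficients, so
  one order of regularity is gained at each step.\<close>

lemma parallel_entries_smooth:
  assumes "parallel_entries l f g h"
  shows "smooth_on (strip T) f" "smooth_on (strip T) g" "smooth_on (strip T) h"
proof -
  note d = parallel_entriesD[OF assms]
  have "Ck_on k (strip T) f \<and> Ck_on k (strip T) g \<and> Ck_on k (strip T) h" for k
  proof (induction k)
    case 0
    show ?case using d by (auto simp: continuous_on_eq_continuous_within intro!: has_derivative_continuous)
  next
    case (Suc k)
    then have k: "Ck_on k (strip T) f" "Ck_on k (strip T) g" "Ck_on k (strip T) h" by auto
    show ?case
      by (intro conjI Ck_on_SucI[OF T d(1)] Ck_on_SucI[OF T d(2)] Ck_on_SucI[OF T d(3)];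
          (assumption | intro Ck_on_const Ck_on_add Ck_on_mult Ck_on_minus Ck_coefficients k T))
  qed
  then show "smooth_on (strip T) f" "smooth_on (strip T) g" "smooth_on (strip T) h"
    by (auto simp: smooth_on_def)
qed

text \<open>Together with \<open>mg\<close> and \<open>mh\<close>, the entries of the traceless part
  of the monodromy. Scalar matrices commute with the connection and commutators are traceless, so
  this part satisfies the same equation.\<close>

definition mf :: "complex \<Rightarrow> complex \<Rightarrow> complex" where "mf l z = (monodromy l z $ 1 $ 1 - monodromy l z $ 2 $ 2) / 2"
definition mg :: "complex \<Rightarrow> complex \<Rightarrow> complex" where "mg l z = monodromy l z $ 1 $ 2"
definition mh :: "complex \<Rightarrow> complex \<Rightarrow> complex" where "mh l z = monodromy l z $ 2 $ 1"

lemma conn_nth: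
  assumes "l \<noteq> 0"
  shows "conn l z v $ 1 $ 1 = v * (wz z / 2) - cnj v * (wb z / 2)" (is ?A)
    "conn l z v $ 1 $ 2 = v * (\<i> / (4 * l) * E z) + cnj v * (\<i> / 4 * E' z)" (is ?B)
    "conn l z v $ 2 $ 1 = v * (\<i> / 4 * E' z) + cnj v * (\<i> * l / 4 * E z)" (is ?C)
    "conn l z v $ 2 $ 2 = - (v * (wz z / 2) - cnj v * (wb z / 2))" (is ?D)
proof -
  obtain a b where v: "v = of_real a + \<i> * of_real b" by (metis complex_eq)
  show ?A ?B ?C ?D
    using assms unfolding v
    by (simp_all add: conn_def ax_def ay_def scaleR_complex_mult wz_def wb_def flip: E_def E'_def)
       (simp_all add: field_simps)
qed

lemma monodromy_parallel_entries:
  assumes l: "l \<noteq> 0"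
  shows "parallel_entries l (mf l) (mg l) (mh l)"
  unfolding parallel_entries_def
proof (intro ballI conjI)
  fix z assume z: "z \<in> strip T"
  have d: "((\<lambda>z. monodromy l z $ i $ j) has_derivative (\<lambda>v. bracket (monodromy l z) (conn l z v) $ i $ j)) (at z within strip T)" for i j
    by (rule bounded_linear.has_derivative[OF bounded_linear_entry dmonodromy[OF l z]])
  have "(mf l has_derivative (\<lambda>v. (bracket (monodromy l z) (conn l z v) $ 1 $ 1 - bracket (monodromy l z) (conn l z v) $ 2 $ 2) / 2))
      (at z within strip T)"
    unfolding mf_def using has_derivative_mult_right[OF has_derivative_diff[OF d[of 1 1] d[of 2 2]], of "1 / 2"] by simp
  then show "(mf l has_derivative (\<lambda>v. Df l (mg l) (mh l) z v)) (at z within strip T)"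
    by (rule has_derivative_eq_rhs)
       (simp add: fun_eq_iff bracket_def conn_nth[OF l] mf_def mg_def mh_def algebra_simps
          add_divide_distrib diff_divide_distrib)
  show "(mg l has_derivative (\<lambda>v. Dg l (mf l) (mg l) z v)) (at z within strip T)"
    unfolding mg_def[abs_def]
    by (rule has_derivative_eq_rhs[OF d])
       (simp add: fun_eq_iff bracket_def conn_nth[OF l] mf_def mg_def mh_def algebra_simps
          add_divide_distrib diff_divide_distrib)
  show "(mh l has_derivative (\<lambda>v. Dh l (mf l) (mh l) z v)) (at z within strip T)"
    unfolding mh_def[abs_def]
    by (rule has_derivative_eq_rhs[OF d])
       (simp add: fun_eq_iff bracket_def conn_nth[OF l] mf_def mg_def mh_def algebra_simps
          add_divide_distrib diff_divide_distrib)
qed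

text \<open>
  For a negative spectral parameter near \<open>0\<close> the transport of a row \<open>(P, Q)\<close> along the real axis
  strictly decreases the imaginary part of \<open>cnj P * Q\<close>, which vanishes for the initial row \<open>(1, 0)\<close>
  and for its multiples.
\<close>

lemma monodromy_offdiagonal_nonzero:
  assumes \<epsilon>: "\<epsilon> > 0"
    and small: "\<And>x. x \<in> {0..L} \<Longrightarrow> 4 * (q (of_real x))\<^sup>2 + exp (2 * \<omega> (of_real x)) + exp (- 2 * \<omega> (of_real x)) < 1 / \<epsilon>"
  shows "mg (- of_real \<epsilon>) 0 \<noteq> 0"
proof -
  define l :: complex where "l = - of_real \<epsilon>"
  have l: "l \<noteq> 0" using \<epsilon> by (simp add: l_def)
  have st: "complex_of_real x \<in> strip T" for x using T by (simp add: strip_def)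
  define P where "P x = frame l (of_real x) $ 1 $ 1" for x
  define Q where "Q x = frame l (of_real x) $ 1 $ 2" for x
  define \<beta> where "\<beta> x = (exp (\<omega> (of_real x)) / \<epsilon> - exp (- \<omega> (of_real x))) / 4" for x
  define \<kappa> where "\<kappa> x = (exp (- \<omega> (of_real x)) - \<epsilon> * exp (\<omega> (of_real x))) / 4" for x
  define r where "r x = q (of_real x)" for x
  have dF: "((\<lambda>x. frame l (of_real x)) has_derivative (\<lambda>t. frame l (of_real x) ** (t *\<^sub>R ax l (of_real x)))) (at x within UNIV)" for x
    using has_derivative_in_compose2[OF dframe[OF l], of complex_of_real UNIV x complex_of_real] st
    by (auto simp: conn_def intro!: derivative_eq_intros)
  have dP: "(P has_vector_derivative (\<i> * \<kappa> x * Q x - \<i> / 2 * r x * P x)) (at x)" for x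
    unfolding has_vector_derivative_def P_def
    by (rule has_derivative_eq_rhs[OF bounded_linear.has_derivative[OF bounded_linear_entry dF]])
       (simp add: fun_eq_iff ax_def scaleR_complex_mult Q_def \<kappa>_def r_def l_def algebra_simps diff_divide_distrib)
  have dQ: "(Q has_vector_derivative (- \<i> * \<beta> x * P x + \<i> / 2 * r x * Q x)) (at x)" for x
    unfolding has_vector_derivative_def Q_def
    by (rule has_derivative_eq_rhs[OF bounded_linear.has_derivative[OF bounded_linear_entry dF]])
       (simp add: fun_eq_iff ax_def scaleR_complex_mult P_def \<beta>_def r_def l_def algebra_simps diff_divide_distrib)
  define \<theta> where "\<theta> x = Im (cnj (P x) * Q x)" for x
  have d\<theta>: "(\<theta> has_real_derivative r x * Re (cnj (P x) * Q x) - \<kappa> x * (cmod (Q x))\<^sup>2 - \<beta> x * (cmod (P x))\<^sup>2) (at x)" for x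
  proof -
    have "((\<lambda>x. cnj (P x) * Q x) has_vector_derivative cnj (P x) * (- \<i> * \<beta> x * P x + \<i> / 2 * r x * Q x)
       + cnj (\<i> * \<kappa> x * Q x - \<i> / 2 * r x * P x) * Q x) (at x)"
      by (intro has_vector_derivative_mult has_vector_derivative_cnj dP dQ)
    from bounded_linear.has_vector_derivative[OF bounded_linear_Im this]
    have "(\<theta> has_real_derivative Im (cnj (P x) * (- \<i> * \<beta> x * P x + \<i> / 2 * r x * Q x)
       + cnj (\<i> * \<kappa> x * Q x - \<i> / 2 * r x * P x) * Q x)) (at x)"
      by (simp only: \<theta>_def[abs_def] has_real_derivative_iff_has_vector_derivative)
    also have "Im (cnj (P x) * (- \<i> * \<beta> x * P x + \<i> / 2 * r x * Q x)
       + cnj (\<i> * \<kappa> x * Q x - \<i> / 2 * r x * P x) * Q x)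
      = r x * Re (cnj (P x) * Q x) - \<kappa> x * (cmod (Q x))\<^sup>2 - \<beta> x * (cmod (P x))\<^sup>2"
      unfolding cmod_power2 by (simp add: power2_eq_square algebra_simps)
    finally show ?thesis .
  qed
  \<comment> \<open>The derivative of \<theta> is at most minus a quadratic form in
    \<open>cmod (Q x)\<close> and \<open>cmod (P x)\<close>. As
    \<open>16 * (\<beta> x * \<kappa> x)\<close> equals
    \<open>1 / \<epsilon> - e\<^sup>2 - 1 / e\<^sup>2 + \<epsilon>\<close>, the hypothesis
    \<open>small\<close> makes the discriminant negative; it also gives
    \<open>\<kappa> x > 0\<close>, so that the form is positive definite.\<close>
  have neg: "r x * Re (cnj (P x) * Q x) - \<kappa> x * (cmod (Q x))\<^sup>2 - \<beta> x * (cmod (P x))\<^sup>2 < 0"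
    if x: "x \<in> {0..L}" for x
  proof -
    define e where "e = exp (\<omega> (of_real x))"
    have e0: "e > 0" and e': "exp (- \<omega> (of_real x)) = 1 / e" by (simp_all add: e_def exp_minus field_simps)
    have e2: "exp (2 * \<omega> (of_real x)) = e\<^sup>2" "exp (- 2 * \<omega> (of_real x)) = 1 / e\<^sup>2"
      by (simp_all add: e_def exp_double exp_minus field_simps flip: exp_double)
    have sm: "4 * (r x)\<^sup>2 + e\<^sup>2 + 1 / e\<^sup>2 < 1 / \<epsilon>" using small[OF x] unfolding r_def e2 by simp
    have be: "\<beta> x = (e / \<epsilon> - 1 / e) / 4" and ka: "\<kappa> x = (1 / e - \<epsilon> * e) / 4"
      unfolding \<beta>_def \<kappa>_def e' by (simp_all add: e_def)
    have "16 * (\<beta> x * \<kappa> x) = 1 / \<epsilon> - e\<^sup>2 - 1 / e\<^sup>2 + \<epsilon>"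
      unfolding be ka using e0 \<epsilon> by (simp add: field_simps power2_eq_square)
    then have bk: "4 * (\<beta> x * \<kappa> x) > (r x)\<^sup>2" using sm \<epsilon> by simp
    have "1 / e\<^sup>2 \<ge> 0" by simp
    then have "e\<^sup>2 < 1 / \<epsilon>" using sm zero_le_power2[of "r x"] by linarith
    then have "\<epsilon> * e\<^sup>2 < 1" using \<epsilon> by (simp add: pos_less_divide_eq mult.commute)
    moreover have "\<kappa> x = (1 - \<epsilon> * e\<^sup>2) / (4 * e)"
      unfolding ka using e0 by (simp add: field_simps power2_eq_square)
    ultimately have k0: "\<kappa> x > 0" using e0 by simp
    have PQ: "P x \<noteq> 0 \<or> Q x \<noteq> 0"
    proof (rule ccontr)
      assume "\<not> ?thesis"
      then have "(frame l (of_real x) ** adj2 (frame l (of_real x))) $ 1 $ 1 = 0" by (simp add: P_def Q_def)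
      then show False unfolding frame_adj_right[OF l st] by simp
    qed
    define s where "s = cmod (Q x)"
    define t where "t = cmod (P x)"
    have "r x * Re (cnj (P x) * Q x) \<le> \<bar>r x\<bar> * (t * s)"
    proof -
      have "\<bar>Re (cnj (P x) * Q x)\<bar> \<le> t * s"
        using abs_Re_le_cmod[of "cnj (P x) * Q x"] by (simp only: s_def t_def norm_mult complex_mod_cnj)
      from mult_left_mono[OF this abs_ge_zero[of "r x"]] show ?thesis
        using abs_ge_self[of "r x * Re (cnj (P x) * Q x)"] by (simp add: abs_mult)
    qed
    moreover have "\<kappa> x * (\<kappa> x * s\<^sup>2 + \<beta> x * t\<^sup>2 - \<bar>r x\<bar> * (t * s)) > 0"
    proof -
      have "\<kappa> x * (\<kappa> x * s\<^sup>2 + \<beta> x * t\<^sup>2 - \<bar>r x\<bar> * (t * s))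
        = (\<kappa> x * s - \<bar>r x\<bar> * t / 2)\<^sup>2 + (\<beta> x * \<kappa> x - (r x)\<^sup>2 / 4) * t\<^sup>2"
        by (simp add: power2_eq_square algebra_simps)
      moreover have "\<dots> > 0"
      proof (cases "t = 0")
        case True
        then have "s \<noteq> 0" using PQ by (simp add: s_def t_def)
        then show ?thesis using True k0 by simp
      next
        case False
        then show ?thesis using bk by (intro add_nonneg_pos mult_pos_pos) auto
      qed
      ultimately show ?thesis by simp
    qed
    ultimately show ?thesis using k0 unfolding s_def t_def by (simp add: zero_less_mult_iff)
  qed
  have "\<theta> L < \<theta> 0"
    by (rule DERIV_neg_imp_decreasing[OF L]) (meson d\<theta> neg atLeastAtMost_iff)
  moreover have "\<theta> 0 = 0" by (simp add: \<theta>_def P_def Q_def frame_0[OF l])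
  \<comment> \<open>At the base point 0 the frame is the identity, so the entry in question is
    \<open>Q L\<close>.\<close>
  moreover have "\<theta> L = 0" if "monodromy l 0 $ 1 $ 2 = 0"
  proof -
    have "monodromy l 0 = frame l (of_real L)"
      by (simp add: monodromy_def frame_0[OF l] cmat2_eq_iff)
    with that show ?thesis by (simp add: \<theta>_def P_def Q_def)
  qed
  ultimately show ?thesis by (auto simp: mg_def l_def)
qed

text \<open>The boundary condition makes the tangential connection a combination of the two matrices
  in \<open>PK\<close> and \<open>QK\<close>, multiplied by the two exponentials. Each is
  intertwined separately, and the two equations are the resulting trace identities.\<close>

lemma robin_condition:
  assumes l: "l \<noteq> 0" and y: "\<bar>y\<bar> \<le> T"
    and bc: "\<And>z. Im z = y \<Longrightarrow> q z = A * exp (\<omega> z) + B * exp (- \<omega> z)"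
    and z: "Im z = y" and K: "det (kmat A B l) \<noteq> 0"
  shows "of_real A * (mf l z - mf (1 / l) z) * 4 = l * mg l z + mh l z / l - mg (1 / l) z / l - l * mh (1 / l) z" (is ?A)
    "of_real B * (mf l z - mf (1 / l) z) * 4 = mg l z + mh l z - mg (1 / l) z - mh (1 / l) z" (is ?B)
proof -
  note MK = monodromy_kmat[OF l y bc z]
  have PK: "m2 (- 2 * of_real A) (1 / l) l (2 * of_real A) ** kmat A B l
      = kmat A B l ** m2 (- 2 * of_real A) l (1 / l) (2 * of_real A)"
    using l by (simp add: cmat2_eq_iff kmat_def field_simps)
  have QK: "m2 (- 2 * of_real B) 1 1 (2 * of_real B) ** kmat A B l
      = kmat A B l ** m2 (- 2 * of_real B) 1 1 (2 * of_real B)"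
    using l by (simp add: cmat2_eq_iff kmat_def field_simps)
  have e: "of_real C * (mf l z - mf (1 / l) z) * 4 = 2 * of_real C * (monodromy l z $ 1 $ 1 - monodromy l z $ 2 $ 2)
      - 2 * of_real C * (monodromy (1 / l) z $ 1 $ 1 - monodromy (1 / l) z $ 2 $ 2)" for C
    by (simp add: mf_def field_simps)
  show ?A
    unfolding e using trace_intertwined[OF MK PK K] by (simp add: trace_def sum_2 mg_def mh_def algebra_simps)
  show ?B
    unfolding e using trace_intertwined[OF MK QK K] by (simp add: trace_def sum_2 mg_def mh_def algebra_simps)
qed

lemma m_shift: "l \<noteq> 0 \<Longrightarrow> z \<in> strip T \<Longrightarrow> mf l (z + of_real L) = mf l z"
  "l \<noteq> 0 \<Longrightarrow> z \<in> strip T \<Longrightarrow> mg l (z + of_real L) = mg l z"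
  "l \<noteq> 0 \<Longrightarrow> z \<in> strip T \<Longrightarrow> mh l (z + of_real L) = mh l z"
  by (simp_all add: mf_def mg_def mh_def monodromy_shift)

end

section \<open>Jacobi fields\<close>

text \<open>Gaussian elimination: fewer homogeneous equations than unknowns. In the induction step
  the equation \<open>j\<close> is solved for the unknown \<open>i0\<close>.\<close>

lemma nontrivial_relation:
  fixes m :: "'i \<Rightarrow> 'j \<Rightarrow> complex"
  assumes "finite J" "finite I" "card J < card I"
  shows "\<exists>c. (\<exists>i\<in>I. c i \<noteq> 0) \<and> (\<forall>j\<in>J. (\<Sum>i\<in>I. c i * m i j) = 0)"
  using assms
proof (induction J arbitrary: I m rule: finite_induct)
  case empty
  then have "I \<noteq> {}" by auto
  then show ?case by (intro exI[of _ "\<lambda>_. 1"]) auto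
next
  case (insert j J)
  show ?case
  proof (cases "\<forall>i\<in>I. m i j = 0")
    case True
    have "card J < card I" using insert.prems insert.hyps by simp
    from insert.IH[OF insert.prems(1) this, of m] True show ?thesis by auto
  next
    case False
    then obtain i0 where i0: "i0 \<in> I" "m i0 j \<noteq> 0" by blast
    define I' where "I' = I - {i0}"
    have "finite I'" "card J < card I'"
      using insert.prems insert.hyps i0 by (auto simp: I'_def)
    from insert.IH[OF this, of "\<lambda>i k. m i k - m i j / m i0 j * m i0 k"] obtain c where
      c: "\<exists>i\<in>I'. c i \<noteq> 0" "\<And>k. k \<in> J \<Longrightarrow> (\<Sum>i\<in>I'. c i * (m i k - m i j / m i0 j * m i0 k)) = 0" by blast
    define d where "d = c(i0 := - (\<Sum>i\<in>I'. c i * m i j) / m i0 j)"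
    have sum: "(\<Sum>i\<in>I. d i * m i k) = (\<Sum>i\<in>I'. c i * (m i k - m i j / m i0 j * m i0 k))" for k
    proof -
      have "(\<Sum>i\<in>I. d i * m i k) = d i0 * m i0 k + (\<Sum>i\<in>I'. d i * m i k)"
        using i0 insert.prems by (simp add: I'_def sum.remove)
      also have "(\<Sum>i\<in>I'. d i * m i k) = (\<Sum>i\<in>I'. c i * m i k)"
        by (intro sum.cong) (auto simp: d_def I'_def)
      also have "d i0 * m i0 k = - (\<Sum>i\<in>I'. c i * (m i j / m i0 j * m i0 k))"
        by (simp add: d_def sum_distrib_right sum_divide_distrib mult.assoc)
      finally show ?thesis by (simp add: sum_subtractf right_diff_distrib)
    qed
    have "(\<Sum>i\<in>I. d i * m i k) = 0" if "k \<in> insert j J" for k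
      unfolding sum using that i0(2) c(2) by (cases "k = j") auto
    moreover have "\<exists>i\<in>I. d i \<noteq> 0" using c(1) by (auto simp: d_def I'_def)
    ultimately show ?thesis by blast
  qed
qed

lemma wirtinger_real: "v * a + cnj v * b = Re v *\<^sub>R (a + b) + Im v *\<^sub>R (\<i> * (a - b))"
  by (simp add: complex_eq_iff algebra_simps)

context sinh_gordon_strip
begin

text \<open>Periodic solutions of the linearisation of the sinh-Gordon equation, with the
  derivatives carried along as functions. All conditions are jointly linear in the seven functions,
  so linear combinations need no differentiation.\<close>

definition jacobi_field ::
  "(complex \<Rightarrow> complex) \<Rightarrow> (complex \<Rightarrow> complex) \<Rightarrow> (complex \<Rightarrow> complex) \<Rightarrow> (complex \<Rightarrow> complex) \<Rightarrow>
   (complex \<Rightarrow> complex) \<Rightarrow> (complex \<Rightarrow> complex) \<Rightarrow> (complex \<Rightarrow> complex) \<Rightarrow> bool" where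
  "jacobi_field u ux uy uxx uxy uyx uyy \<longleftrightarrow>
     (\<forall>z\<in>strip T. (u has_derivative (\<lambda>v. Re v *\<^sub>R ux z + Im v *\<^sub>R uy z)) (at z within strip T)) \<and>
     (\<forall>z\<in>strip T. (ux has_derivative (\<lambda>v. Re v *\<^sub>R uxx z + Im v *\<^sub>R uxy z)) (at z within strip T)) \<and>
     (\<forall>z\<in>strip T. (uy has_derivative (\<lambda>v. Re v *\<^sub>R uyx z + Im v *\<^sub>R uyy z)) (at z within strip T)) \<and>
     continuous_on (strip T) uxx \<and> continuous_on (strip T) uyy \<and>
     (\<forall>z\<in>strip T. uxx z + uyy z = - of_real (cosh (2 * \<omega> z)) * u z) \<and>
     (\<forall>z\<in>strip T. u (z + of_real L) = u z \<and> ux (z + of_real L) = ux z)"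

lemma jacobi_field_sum:
  assumes "finite I" and j: "\<And>i. i \<in> I \<Longrightarrow> jacobi_field (u i) (ux i) (uy i) (uxx i) (uxy i) (uyx i) (uyy i)"
  shows "jacobi_field (\<lambda>z. \<Sum>i\<in>I. c i * u i z) (\<lambda>z. \<Sum>i\<in>I. c i * ux i z) (\<lambda>z. \<Sum>i\<in>I. c i * uy i z)
     (\<lambda>z. \<Sum>i\<in>I. c i * uxx i z) (\<lambda>z. \<Sum>i\<in>I. c i * uxy i z) (\<lambda>z. \<Sum>i\<in>I. c i * uyx i z) (\<lambda>z. \<Sum>i\<in>I. c i * uyy i z)"
proof -
  have D: "((\<lambda>z. \<Sum>i\<in>I. c i * a i z) has_derivative
       (\<lambda>v. Re v *\<^sub>R (\<Sum>i\<in>I. c i * b i z) + Im v *\<^sub>R (\<Sum>i\<in>I. c i * b' i z))) (at z within strip T)"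
    if "\<And>i. i \<in> I \<Longrightarrow> (a i has_derivative (\<lambda>v. Re v *\<^sub>R b i z + Im v *\<^sub>R b' i z)) (at z within strip T)"
    for a b b' :: "'a \<Rightarrow> complex \<Rightarrow> complex" and z
  proof -
    have "((\<lambda>z. \<Sum>i\<in>I. c i * a i z) has_derivative (\<lambda>v. \<Sum>i\<in>I. c i * (Re v *\<^sub>R b i z + Im v *\<^sub>R b' i z))) (at z within strip T)"
      by (intro has_derivative_sum has_derivative_mult_right that)
    then show ?thesis
      by (rule has_derivative_eq_rhs) (simp add: fun_eq_iff distrib_left sum.distrib scaleR_right.sum)
  qed
  have pde: "(\<Sum>i\<in>I. c i * uxx i z) + (\<Sum>i\<in>I. c i * uyy i z) = - of_real (cosh (2 * \<omega> z)) * (\<Sum>i\<in>I. c i * u i z)"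
    if "z \<in> strip T" for z
  proof -
    have "(\<Sum>i\<in>I. c i * uxx i z) + (\<Sum>i\<in>I. c i * uyy i z) = (\<Sum>i\<in>I. c i * (uxx i z + uyy i z))"
      by (simp add: distrib_left sum.distrib)
    also have "\<dots> = (\<Sum>i\<in>I. - of_real (cosh (2 * \<omega> z)) * (c i * u i z))"
      using j that by (intro sum.cong) (auto simp: jacobi_field_def)
    finally show ?thesis by (simp add: sum_distrib_left)
  qed
  show ?thesis unfolding jacobi_field_def
  proof (intro conjI ballI D pde)
    show "continuous_on (strip T) (\<lambda>z. \<Sum>i\<in>I. c i * uxx i z)" "continuous_on (strip T) (\<lambda>z. \<Sum>i\<in>I. c i * uyy i z)"
      using j by (auto intro!: continuous_intros simp: jacobi_field_def)
  qed (use j in \<open>auto simp: jacobi_field_def cong: sum.cong\<close>)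
qed

lemma jacobi_field_mf:
  assumes l: "l \<noteq> 0"
  shows "\<exists>uxx uxy uyx uyy. jacobi_field (mf l)
    (\<lambda>z. \<i> / 4 * (E' z * mg l z + - (1 / l) * (E z * mh l z)) + \<i> / 4 * (l * (E z * mg l z) + - (E' z * mh l z)))
    (\<lambda>z. \<i> * (\<i> / 4 * (E' z * mg l z + - (1 / l) * (E z * mh l z)) - \<i> / 4 * (l * (E z * mg l z) + - (E' z * mh l z))))
    uxx uxy uyx uyy"
proof -
  note d = parallel_entriesD[OF monodromy_parallel_entries[OF l]]
  \<comment> \<open>\<phi> and \<psi> are the derivatives of \<open>mf l\<close> with respect to
    \<open>z\<close> and its conjugate, and \<xi> is the mixed second derivative. The terms with
    first derivatives of \<omega> cancel in \<xi>, whichever order of differentiation is used; four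
    times \<xi> is the Laplacian.\<close>
  define \<phi> where "\<phi> z = \<i> / 4 * (E' z * mg l z + - (1 / l) * (E z * mh l z))" for z
  define \<psi> where "\<psi> z = \<i> / 4 * (l * (E z * mg l z) + - (E' z * mh l z))" for z
  define \<xi> where "\<xi> z = - (1 / 8) * (E z * E z + E' z * E' z) * mf l z" for z
  have EE: "E z * E' z = 1" for z by (simp add: E_def E'_def flip: of_real_mult exp_add)
  have cosh: "complex_of_real (cosh (2 * \<omega> z)) = (E z * E z + E' z * E' z) / 2" for z
  proof -
    have "cosh (2 * \<omega> z) = (exp (\<omega> z) * exp (\<omega> z) + exp (- \<omega> z) * exp (- \<omega> z)) / 2"
      by (simp add: cosh_field_def mult_exp_exp)
    then show ?thesis unfolding E_def E'_def by (simp only: of_real_mult of_real_add of_real_divide of_real_numeral)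
  qed
  have dE: "(E has_derivative (\<lambda>v. (v * wz z + cnj v * wb z) * E z)) (at z within strip T)"
    "(E' has_derivative (\<lambda>v. - (v * wz z + cnj v * wb z) * E' z)) (at z within strip T)" if z: "z \<in> strip T" for z
  proof -
    have *: "complex_of_real (Re v * p z + Im v * q z) = v * wz z + cnj v * wb z" for v
      by (simp add: complex_eq_iff wz_def wb_def algebra_simps)
    show "(E has_derivative (\<lambda>v. (v * wz z + cnj v * wb z) * E z)) (at z within strip T)"
      unfolding E_def[abs_def]
      using bounded_linear.has_derivative[OF bounded_linear_of_real[where 'a = complex] dexp(1)[OF z]]
      by (simp only: of_real_mult * )
    show "(E' has_derivative (\<lambda>v. - (v * wz z + cnj v * wb z) * E' z)) (at z within strip T)"
      unfolding E'_def[abs_def]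
      using bounded_linear.has_derivative[OF bounded_linear_of_real[where 'a = complex] dexp(2)[OF z]]
      by (simp only: of_real_mult of_real_minus * )
  qed
  \<comment> \<open>\<open>\<phi>z\<close> and \<open>\<psi>b\<close> are the pure second
    derivatives. They cancel from the Laplacian and only their continuity matters.\<close>
  define \<phi>z where "\<phi>z z = \<i> / 4 * (- 2 * wz z * E' z * mg l z - 2 / l * (wz z * E z * mh l z)) - (1 / (8 * l)) * mf l z - (1 / (8 * l)) * mf l z" for z
  define \<psi>b where "\<psi>b z = \<i> / 4 * (2 * l * (wb z * E z * mg l z) + 2 * wb z * E' z * mh l z) - l / 8 * mf l z - l / 8 * mf l z" for z
  have d\<phi>: "(\<phi> has_derivative (\<lambda>v. v * \<phi>z z + cnj v * \<xi> z)) (at z within strip T)" if z: "z \<in> strip T" for z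
    unfolding \<phi>_def
    by (rule has_derivative_eq_rhs[OF has_derivative_mult_right[OF has_derivative_add[OF
        has_derivative_mult[OF dE(2)[OF z] d(2)[OF z]]
        has_derivative_mult_right[OF has_derivative_mult[OF dE(1)[OF z] d(3)[OF z]]]]]])
       (use l EE[of z] in \<open>simp add: fun_eq_iff \<phi>z_def \<xi>_def field_simps\<close>)
  have d\<psi>: "(\<psi> has_derivative (\<lambda>v. v * \<xi> z + cnj v * \<psi>b z)) (at z within strip T)" if z: "z \<in> strip T" for z
    unfolding \<psi>_def
    by (rule has_derivative_eq_rhs[OF has_derivative_mult_right[OF has_derivative_add[OF
        has_derivative_mult_right[OF has_derivative_mult[OF dE(1)[OF z] d(2)[OF z]]]
        has_derivative_minus[OF has_derivative_mult[OF dE(2)[OF z] d(3)[OF z]]]]]])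
       (use l EE[of z] in \<open>simp add: fun_eq_iff \<psi>b_def \<xi>_def field_simps\<close>)
  have cM: "continuous_on (strip T) (mf l)" "continuous_on (strip T) (mg l)" "continuous_on (strip T) (mh l)"
    using d by (auto simp: continuous_on_eq_continuous_within intro!: has_derivative_continuous)
  have cE: "continuous_on (strip T) E" "continuous_on (strip T) E'" "continuous_on (strip T) wz" "continuous_on (strip T) wb"
    using Ck_coefficients[of 0] by auto
  have cont: "continuous_on (strip T) \<phi>z" "continuous_on (strip T) \<psi>b" "continuous_on (strip T) \<xi>"
    unfolding \<phi>z_def \<psi>b_def \<xi>_def using l by (auto intro!: continuous_intros cM cE)
  have shiftE: "E (z + of_real L) = E z" "E' (z + of_real L) = E' z" if "z \<in> strip T" for z
    using that by (simp_all add: E_def E'_def periodic)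
  have "jacobi_field (mf l) (\<lambda>z. \<phi> z + \<psi> z) (\<lambda>z. \<i> * (\<phi> z - \<psi> z))
     (\<lambda>z. \<phi>z z + 2 * \<xi> z + \<psi>b z) (\<lambda>z. \<i> * (\<phi>z z - \<psi>b z)) (\<lambda>z. \<i> * (\<phi>z z - \<psi>b z))
     (\<lambda>z. - \<phi>z z + 2 * \<xi> z - \<psi>b z)"
    unfolding jacobi_field_def
  proof (intro conjI ballI)
    fix z assume z: "z \<in> strip T"
    show "(mf l has_derivative (\<lambda>v. Re v *\<^sub>R (\<phi> z + \<psi> z) + Im v *\<^sub>R (\<i> * (\<phi> z - \<psi> z)))) (at z within strip T)"
      by (rule has_derivative_eq_rhs[OF d(1)[OF z]])
         (simp only: wirtinger_real \<phi>_def \<psi>_def)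
    show "((\<lambda>z. \<phi> z + \<psi> z) has_derivative (\<lambda>v. Re v *\<^sub>R (\<phi>z z + 2 * \<xi> z + \<psi>b z)
        + Im v *\<^sub>R (\<i> * (\<phi>z z - \<psi>b z)))) (at z within strip T)"
      by (rule has_derivative_eq_rhs[OF has_derivative_add[OF d\<phi>[OF z] d\<psi>[OF z]]])
         (simp add: fun_eq_iff complex_eq_iff algebra_simps)
    show "((\<lambda>z. \<i> * (\<phi> z - \<psi> z)) has_derivative (\<lambda>v. Re v *\<^sub>R (\<i> * (\<phi>z z - \<psi>b z))
        + Im v *\<^sub>R (- \<phi>z z + 2 * \<xi> z - \<psi>b z))) (at z within strip T)"
      by (rule has_derivative_eq_rhs[OF has_derivative_mult_right[OF has_derivative_diff[OF d\<phi>[OF z] d\<psi>[OF z]]]])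
         (simp add: fun_eq_iff complex_eq_iff algebra_simps)
    show "\<phi>z z + 2 * \<xi> z + \<psi>b z + (- \<phi>z z + 2 * \<xi> z - \<psi>b z) = - complex_of_real (cosh (2 * \<omega> z)) * mf l z"
      unfolding cosh \<xi>_def by (simp add: field_simps)
    show "mf l (z + of_real L) = mf l z" using m_shift(1)[OF l z] .
    show "\<phi> (z + of_real L) + \<psi> (z + of_real L) = \<phi> z + \<psi> z"
      unfolding \<phi>_def \<psi>_def by (simp add: m_shift[OF l z] shiftE[OF z])
  qed (intro continuous_intros cont)+
  then show ?thesis unfolding \<phi>_def \<psi>_def by blast
qed

end

section \<open>Polynomial Killing fields from linear relations\<close>

lemma sum_mat_scale: "(\<Sum>i\<in>I. x i *\<^sub>M A) = (\<Sum>i\<in>I. x i) *\<^sub>M A"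
  by (rule linear_sum[OF bounded_linear.linear[OF bounded_linear_mat_scale], symmetric])

lemma polynomial_field_cong:
  assumes "polynomial_field T \<Psi>"
    and "\<And>l g z. l \<noteq> 0 \<Longrightarrow> g \<noteq> 0 \<Longrightarrow> z \<in> strip T \<Longrightarrow> \<Phi> l g z = \<Psi> l g z"
  shows "polynomial_field T \<Phi>"
  using assms unfolding polynomial_field_def by simp

lemma polynomial_field_monomial:
  assumes T: "T > 0" and "smooth_on (strip T) \<phi>" "trace \<sigma> = 0"
  shows "polynomial_field T (\<lambda>l g z. (l powi m * g powi n * \<phi> z) *\<^sub>M \<sigma>)"
  unfolding polynomial_field_def
proof (intro exI[of _ "{(m, n)}"] exI[of _ "\<lambda>_ _ z. \<phi> z *\<^sub>M \<sigma>"] conjI)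
  show "\<forall>(m, n)\<in>{(m, n)}. smooth_on (strip T) (\<lambda>z. \<phi> z *\<^sub>M \<sigma>) \<and> (\<lambda>z. \<phi> z *\<^sub>M \<sigma>) ` strip T \<subseteq> sl2"
    using smooth_on_bounded_linear[OF T bounded_linear_mat_scale assms(2)] assms(3)
    by (auto simp: sl2_def trace_def sum_2 simp flip: distrib_left)
qed (simp_all add: cmat2_eq_iff mult.assoc)

lemma polynomial_field_zero: "polynomial_field T (\<lambda>l g z. 0)"
  unfolding polynomial_field_def by (intro exI[of _ "{}"]) auto

lemma polynomial_field_add:
  assumes T: "T > 0" and 1: "polynomial_field T \<Phi>" and 2: "polynomial_field T \<Psi>"
  shows "polynomial_field T (\<lambda>l g z. \<Phi> l g z + \<Psi> l g z)"
proof -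
  obtain F C where F: "finite F" "\<forall>(m, n)\<in>F. smooth_on (strip T) (C m n) \<and> C m n ` strip T \<subseteq> sl2"
    "\<forall>l g. l \<noteq> 0 \<longrightarrow> g \<noteq> 0 \<longrightarrow> (\<forall>z\<in>strip T. \<Phi> l g z = (\<Sum>(m, n)\<in>F. (l powi m * g powi n) *\<^sub>M C m n z))"
    using 1 unfolding polynomial_field_def by (elim exE conjE)
  obtain G D where G: "finite G" "\<forall>(m, n)\<in>G. smooth_on (strip T) (D m n) \<and> D m n ` strip T \<subseteq> sl2"
    "\<forall>l g. l \<noteq> 0 \<longrightarrow> g \<noteq> 0 \<longrightarrow> (\<forall>z\<in>strip T. \<Psi> l g z = (\<Sum>(m, n)\<in>G. (l powi m * g powi n) *\<^sub>M D m n z))"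
    using 2 unfolding polynomial_field_def by (elim exE conjE)
  \<comment> \<open>Nothing is known about the coefficient functions outside their index sets, so
    they are replaced by zero there before both sums are extended to the union.\<close>
  define C' where "C' m n = (if (m, n) \<in> F then C m n else (\<lambda>z. 0))" for m n
  define D' where "D' m n = (if (m, n) \<in> G then D m n else (\<lambda>z. 0))" for m n
  have sl0: "0 \<in> sl2" by (simp add: sl2_def trace_def)
  have sladd: "A + B \<in> sl2" if "A \<in> sl2" "B \<in> sl2" for A B
    using that by (simp add: sl2_def trace_add)
  have C': "smooth_on (strip T) (C' m n)" "z \<in> strip T \<Longrightarrow> C' m n z \<in> sl2" for m n z
    using bspec[OF F(2), of "(m, n)"] sl0 by (auto simp: image_subset_iff C'_def smooth_on_zero[OF T])
  have D': "smooth_on (strip T) (D' m n)" "z \<in> strip T \<Longrightarrow> D' m n z \<in> sl2" for m n z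
    using bspec[OF G(2), of "(m, n)"] sl0 by (auto simp: image_subset_iff D'_def smooth_on_zero[OF T])
  have scale0: "c *\<^sub>M 0 = 0" and scale_add: "c *\<^sub>M (A + B) = c *\<^sub>M A + c *\<^sub>M B" for c A B
    by (simp_all add: cmat2_eq_iff algebra_simps)
  show ?thesis unfolding polynomial_field_def
  proof (intro exI[of _ "F \<union> G"] exI[of _ "\<lambda>m n z. C' m n z + D' m n z"] conjI allI impI ballI)
    show "finite (F \<union> G)" using F(1) G(1) by simp
    show "case mn of (m, n) \<Rightarrow> smooth_on (strip T) (\<lambda>z. C' m n z + D' m n z) \<and>
        (\<lambda>z. C' m n z + D' m n z) ` strip T \<subseteq> sl2" for mn
      using C' D' sladd by (auto simp: smooth_on_add[OF T])
    fix l g :: complex and z assume lgz: "l \<noteq> 0" "g \<noteq> 0" "z \<in> strip T"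
    have "\<Phi> l g z = (\<Sum>(m, n)\<in>F \<union> G. (l powi m * g powi n) *\<^sub>M C' m n z)"
      unfolding F(3)[rule_format, OF lgz] using F(1) G(1)
      by (intro sum.mono_neutral_cong_left) (auto simp: C'_def scale0)
    moreover have "\<Psi> l g z = (\<Sum>(m, n)\<in>F \<union> G. (l powi m * g powi n) *\<^sub>M D' m n z)"
      unfolding G(3)[rule_format, OF lgz] using F(1) G(1)
      by (intro sum.mono_neutral_cong_left) (auto simp: D'_def scale0)
    ultimately show "\<Phi> l g z + \<Psi> l g z = (\<Sum>(m, n)\<in>F \<union> G. (l powi m * g powi n) *\<^sub>M (C' m n z + D' m n z))"
      by (simp add: scale_add sum.distrib case_prod_unfold)
  qed
qed

lemma polynomial_field_sum:
  assumes "T > 0" "finite I" "\<And>i. i \<in> I \<Longrightarrow> polynomial_field T (\<Phi> i)"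
  shows "polynomial_field T (\<lambda>l g z. \<Sum>i\<in>I. \<Phi> i l g z)"
  using assms(2,3)
proof (induction I rule: finite_induct)
  case empty
  show ?case unfolding sum.empty by (rule polynomial_field_zero)
next
  case (insert i I)
  have "polynomial_field T (\<lambda>l g z. \<Phi> i l g z + (\<Sum>i\<in>I. \<Phi> i l g z))"
    by (rule polynomial_field_add[OF assms(1)]) (auto intro: insert)
  with insert.hyps show ?case by simp
qed

text \<open>The power \<open>s\<close> provides the weights 0, -1 and 1 in \<gamma> that the
  diagonal, upper right and lower left entries receive on passing from the parameters \<lambda> /
  \<gamma> and 1 to \<lambda> and \<gamma>.\<close>

lemma polynomial_field_poly:
  assumes T: "T > 0" and "smooth_on (strip T) \<phi>" "trace \<sigma> = 0"
  shows "polynomial_field T (\<lambda>l g z. (g powi s * (poly P (l / g) * \<phi> z)) *\<^sub>M \<sigma>)"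
proof -
  have "polynomial_field T (\<lambda>l g z. \<Sum>k\<le>degree P. (l powi int k * g powi (s - int k) * (coeff P k * \<phi> z)) *\<^sub>M \<sigma>)"
    using assms by (intro polynomial_field_sum polynomial_field_monomial
        smooth_on_bounded_linear[OF T bounded_linear_mult_right]) auto
  then show ?thesis
  proof (rule polynomial_field_cong)
    fix l g :: complex and z assume lg: "l \<noteq> 0" "g \<noteq> 0"
    have e: "coeff P k * (l / g) ^ k * (g powi s * \<phi> z) = l powi int k * g powi (s - int k) * (coeff P k * \<phi> z)" for k
      using lg by (simp add: power_int_diff power_divide)
    have "(\<Sum>k\<le>degree P. (l powi int k * g powi (s - int k) * (coeff P k * \<phi> z)) *\<^sub>M \<sigma>)
      = (\<Sum>k\<le>degree P. coeff P k * (l / g) ^ k * (g powi s * \<phi> z)) *\<^sub>M \<sigma>"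
      unfolding sum_mat_scale e ..
    also have "(\<Sum>k\<le>degree P. coeff P k * (l / g) ^ k * (g powi s * \<phi> z)) = g powi s * (poly P (l / g) * \<phi> z)"
      unfolding poly_altdef sum_distrib_right[symmetric] by (rule mult.left_commute)
    finally show "(g powi s * (poly P (l / g) * \<phi> z)) *\<^sub>M \<sigma>
      = (\<Sum>k\<le>degree P. (l powi int k * g powi (s - int k) * (coeff P k * \<phi> z)) *\<^sub>M \<sigma>)" ..
  qed
qed

text \<open>One summand of the superposed field: after reweighting, the equations at
  \<open>l\<close> become those at \<mu> up to an error with the factor
  \<open>(\<mu> - l) * e\<close>. In the application this factor is the same for all summands, so
  the errors add up to a multiple of the linear relation or of its derivative. Here \<open>w\<close>
  stands for \<open>cnj v\<close>.\<close>

lemma superposition_identities: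
  fixes l \<mu> :: complex
  assumes "l \<noteq> 0" "\<mu> \<noteq> 0"
  shows "c * \<mu> * e * (v * (\<i> / 4 * (E' * g + - (1 / l) * (E * h))) + w * (\<i> / 4 * (l * (E * g) + - (E' * h))))
      = v * (\<i> / 4 * (E' * (c * l * e * g) + - (1 / \<mu>) * (E * (c * \<mu> * e * h))))
        + w * (\<i> / 4 * (\<mu> * (E * (c * l * e * g)) + - (E' * (c * \<mu> * e * h))))
        + v * (\<i> / 4) * (c * ((\<mu> - l) * e) * (E' * g + - (1 / l) * (E * h)))" (is ?A)
    and "c * l * e * (v * (- (wz * g) + \<i> / (2 * l) * (E * f)) + w * (wb * g + \<i> / 2 * (E' * f)))
      = v * (- (wz * (c * l * e * g)) + \<i> / (2 * \<mu>) * (E * (c * \<mu> * e * f)))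
        + w * (wb * (c * l * e * g) + \<i> / 2 * (E' * (c * \<mu> * e * f)))
        + w * (- (\<i> / 2) * E') * (c * ((\<mu> - l) * e) * f)" (is ?B)
    and "c * \<mu> * e * (v * (wz * h + - (\<i> / 2) * (E' * f)) + w * (- (wb * h) + - (\<i> * l / 2) * (E * f)))
      = v * (wz * (c * \<mu> * e * h) + - (\<i> / 2) * (E' * (c * \<mu> * e * f)))
        + w * (- (wb * (c * \<mu> * e * h)) + - (\<i> * \<mu> / 2) * (E * (c * \<mu> * e * f)))
        + w * (\<i> / 2 * \<mu> * E) * (c * ((\<mu> - l) * e) * f)" (is ?C)
proof -
  \<comment> \<open>With the inverses of \<open>l\<close> and \<mu> replaced by variables
    \<open>k\<close> and \<open>n\<close>, the claims become polynomial identities modulo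
    \<open>l * k = 1\<close> and \<open>m * n = 1\<close>.\<close>
  have g1: "c * m * e * (v * (j * (E' * g + - k * (E * h))) + w * (j * (l * (E * g) + - (E' * h))))
      = v * (j * (E' * (c * l * e * g) + - n * (E * (c * m * e * h))))
        + w * (j * (m * (E * (c * l * e * g)) + - (E' * (c * m * e * h))))
        + v * j * (c * ((m - l) * e) * (E' * g + - k * (E * h)))"
    if "l * k = 1" "m * n = 1" for m k n j
    using that by algebra
  have g2: "c * l * e * (v * (- (wz * g) + j * k * (E * f)) + w * (wb * g + j * (E' * f)))
      = v * (- (wz * (c * l * e * g)) + j * n * (E * (c * m * e * f)))
        + w * (wb * (c * l * e * g) + j * (E' * (c * m * e * f)))
        + w * (- j * E') * (c * ((m - l) * e) * f)"
    if "l * k = 1" "m * n = 1" for m k n j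
    using that by algebra
  have g3: "c * m * e * (v * (wz * h + - j * (E' * f)) + w * (- (wb * h) + - (j * l) * (E * f)))
      = v * (wz * (c * m * e * h) + - j * (E' * (c * m * e * f)))
        + w * (- (wb * (c * m * e * h)) + - (j * m) * (E * (c * m * e * f)))
        + w * (j * m * E) * (c * ((m - l) * e) * f)" for m j
    by algebra
  have inv: "l * (1 / l) = 1" "\<mu> * (1 / \<mu>) = 1" using assms by auto
  have quot: "\<i> / (2 * x) = \<i> / 2 * (1 / x)" "\<i> * x / 2 = \<i> / 2 * x" for x by simp_all
  show ?A by (rule g1[OF inv])
  show ?B unfolding quot by (rule g2[OF inv])
  show ?C unfolding quot by (rule g3)
qed

context sinh_gordon_strip
begin

lemma d_omega: assumes "z \<in> strip T"
  shows "d_z T (\<lambda>w. of_real (\<omega> w)) z = wz z" "d_zbar T (\<lambda>w. of_real (\<omega> w)) z = wb z"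
proof -
  have "((\<lambda>w. complex_of_real (\<omega> w)) has_derivative (\<lambda>v. of_real (Re v * p z + Im v * q z))) (at z within strip T)"
    by (rule bounded_linear.has_derivative[OF bounded_linear_of_real d\<omega>[OF assms]])
  from strip_frechet_derivative[OF T assms this]
  show "d_z T (\<lambda>w. of_real (\<omega> w)) z = wz z" "d_zbar T (\<lambda>w. of_real (\<omega> w)) z = wb z"
    by (simp_all add: d_z_def d_zbar_def partial_x_def partial_y_def wz_def wb_def)
qed

lemma lax_form_nth:
  assumes "z \<in> strip T"
  shows "lax_form T \<omega> l \<gamma> z v $ 1 $ 1 = v * (wz z / 2) - cnj v * (wb z / 2)"
    "lax_form T \<omega> l \<gamma> z v $ 1 $ 2 = v * (\<i> / (4 * l) * E z) + cnj v * (\<i> / (4 * \<gamma>) * E' z)"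
    "lax_form T \<omega> l \<gamma> z v $ 2 $ 1 = v * (\<i> * \<gamma> / 4 * E' z) + cnj v * (\<i> * l / 4 * E z)"
    "lax_form T \<omega> l \<gamma> z v $ 2 $ 2 = - (v * (wz z / 2) - cnj v * (wb z / 2))"
  by (simp_all add: lax_form_def lax_z_def lax_zbar_def d_omega[OF assms] E_def E'_def)

text \<open>The Lax form at \<open>l\<close> and \<gamma> arises from the one at
  \<open>l / \<gamma>\<close> and 1 by multiplying the upper right entry by
  \<open>1 / \<gamma>\<close> and the lower left entry by \<gamma>. This is conjugation by a
  constant diagonal matrix, and the Killing field is conjugated along with it.\<close>

lemma killing_field_parallel_entries:
  assumes ent: "\<And>\<mu>. \<mu> \<noteq> 0 \<Longrightarrow> parallel_entries \<mu> (f \<mu>) (g \<mu>) (h \<mu>)"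
  shows "killing_field T \<omega> (\<lambda>l \<gamma> z. f (l / \<gamma>) z *\<^sub>M sigma_0 + (1 / \<gamma> * g (l / \<gamma>) z) *\<^sub>M sigma_plus
    + (\<gamma> * h (l / \<gamma>) z) *\<^sub>M sigma_minus)"
  unfolding killing_field_def
proof (intro allI impI conjI ballI)
  fix l \<gamma> :: complex assume l: "l \<noteq> 0" "\<gamma> \<noteq> 0"
  define \<mu> where "\<mu> = l / \<gamma>"
  have \<mu>: "\<mu> \<noteq> 0" using l by (simp add: \<mu>_def)
  have lm: "l = \<mu> * \<gamma>" using l by (simp add: \<mu>_def)
  note sm = parallel_entries_smooth[OF ent[OF \<mu>]]
  note d = parallel_entriesD[OF ent[OF \<mu>]]
  show "smooth_on (strip T) (\<lambda>z. f (l / \<gamma>) z *\<^sub>M sigma_0 + (1 / \<gamma> * g (l / \<gamma>) z) *\<^sub>M sigma_plus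
    + (\<gamma> * h (l / \<gamma>) z) *\<^sub>M sigma_minus)"
    using sm unfolding \<mu>_def[symmetric]
    by (intro smooth_on_add[OF T] smooth_on_bounded_linear[OF T bounded_linear_mat_scale]
        smooth_on_bounded_linear[OF T bounded_linear_mult_right]) auto
  show "(\<lambda>z. f (l / \<gamma>) z *\<^sub>M sigma_0 + (1 / \<gamma> * g (l / \<gamma>) z) *\<^sub>M sigma_plus
    + (\<gamma> * h (l / \<gamma>) z) *\<^sub>M sigma_minus) ` strip T \<subseteq> sl2"
    by (auto simp: sl2_def trace_def sum_2)
  fix z assume z: "z \<in> strip T"
  note dd = has_derivative_add[OF has_derivative_add[OF
      bounded_linear.has_derivative[OF bounded_linear_mat_scale d(1)[OF z], of sigma_0]
      bounded_linear.has_derivative[OF bounded_linear_mat_scale has_derivative_mult_right[OF d(2)[OF z], of "1 / \<gamma>"], of sigma_plus]]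
      bounded_linear.has_derivative[OF bounded_linear_mat_scale has_derivative_mult_right[OF d(3)[OF z], of \<gamma>], of sigma_minus]]
  show "((\<lambda>z. f (l / \<gamma>) z *\<^sub>M sigma_0 + (1 / \<gamma> * g (l / \<gamma>) z) *\<^sub>M sigma_plus + (\<gamma> * h (l / \<gamma>) z) *\<^sub>M sigma_minus)
    has_derivative (\<lambda>v. bracket (f (l / \<gamma>) z *\<^sub>M sigma_0 + (1 / \<gamma> * g (l / \<gamma>) z) *\<^sub>M sigma_plus
      + (\<gamma> * h (l / \<gamma>) z) *\<^sub>M sigma_minus) (lax_form T \<omega> l \<gamma> z v))) (at z within strip T)"
    unfolding \<mu>_def[symmetric]
  proof (rule has_derivative_eq_rhs[OF dd], rule ext)
    fix v
    have b: "v * (\<i> / (4 * l) * E z) + cnj v * (\<i> / (4 * \<gamma>) * E' z)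
        = 1 / \<gamma> * (v * (\<i> / (4 * \<mu>) * E z) + cnj v * (\<i> / 4 * E' z))"
      using l \<mu> by (simp add: lm field_simps)
    have c: "v * (\<i> * \<gamma> / 4 * E' z) + cnj v * (\<i> * l / 4 * E z)
        = \<gamma> * (v * (\<i> / 4 * E' z) + cnj v * (\<i> * \<mu> / 4 * E z))"
      by (simp add: lm field_simps)
    show "Df \<mu> (g \<mu>) (h \<mu>) z v *\<^sub>M sigma_0
      + (1 / \<gamma> * Dg \<mu> (f \<mu>) (g \<mu>) z v) *\<^sub>M sigma_plus
      + (\<gamma> * Dh \<mu> (f \<mu>) (h \<mu>) z v) *\<^sub>M sigma_minus
      = bracket (f \<mu> z *\<^sub>M sigma_0 + (1 / \<gamma> * g \<mu> z) *\<^sub>M sigma_plus + (\<gamma> * h \<mu> z) *\<^sub>M sigma_minus)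
          (lax_form T \<omega> l \<gamma> z v)"
      unfolding cmat2_eq_iff bracket_def using l \<mu>
      by (simp add: lax_form_nth[OF z] b c, intro conjI; simp add: lm field_simps)
  qed
qed

text \<open>
  A linear relation between the diagonal entries \<open>f i\<close> says exactly that the sum of the fields
  \<open>c i / (\<mu> - l i)\<close> times the parallel matrix at \<open>l i\<close>, with the upper right entry scaled by
  \<open>l i / \<mu>\<close>, is parallel at \<open>\<mu>\<close>. Clearing denominators gives a polynomial in \<open>\<mu>\<close>.
\<close>

lemma finite_type_of_relation:
  assumes I: "finite I" "inj_on l I" and l: "\<And>i. i \<in> I \<Longrightarrow> l i \<noteq> 0"
    and ent: "\<And>i. i \<in> I \<Longrightarrow> parallel_entries (l i) (f i) (g i) (h i)"
    and rel: "\<And>z. z \<in> strip T \<Longrightarrow> (\<Sum>i\<in>I. c i * f i z) = 0"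
    and nz: "i0 \<in> I" "c i0 \<noteq> 0" "g i0 0 \<noteq> 0"
  shows "finite_type T \<omega>"
proof -
  define e where "e i \<mu> = (\<Prod>k\<in>I - {i}. \<mu> - l k)" for i \<mu>
  define P where "P i = (\<Prod>k\<in>I - {i}. [:- l k, 1:])" for i
  have P: "poly (P i) \<mu> = e i \<mu>" for i \<mu>
    by (simp add: P_def e_def poly_prod)
  define W where "W \<mu> = (\<Prod>k\<in>I. \<mu> - l k)" for \<mu>
  have ePi: "(\<mu> - l i) * e i \<mu> = W \<mu>" if "i \<in> I" for i \<mu>
    using I(1) that by (simp add: W_def e_def prod.remove)
  \<comment> \<open>The sum described above, multiplied by \<open>\<mu> * W \<mu>\<close>: this
    removes the poles at all \<open>l i\<close> and the \<open>1 / \<mu>\<close> in the upper right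
    entry.\<close>
  define f' where "f' \<mu> z = (\<Sum>i\<in>I. c i * \<mu> * e i \<mu> * f i z)" for \<mu> z
  define g' where "g' \<mu> z = (\<Sum>i\<in>I. c i * l i * e i \<mu> * g i z)" for \<mu> z
  define h' where "h' \<mu> z = (\<Sum>i\<in>I. c i * \<mu> * e i \<mu> * h i z)" for \<mu> z
  \<comment> \<open>The error in the diagonal entry is a multiple of the \<open>z\<close>-derivative
    of the relation. It is separated from the conjugate derivative by testing with the tangent
    vectors 1 and \<open>\<i>\<close>.\<close>
  have relz: "(\<Sum>i\<in>I. c i * (E' z * g i z + - (1 / l i) * (E z * h i z))) = 0" if z: "z \<in> strip T" for z
  proof -
    let ?a = "\<Sum>i\<in>I. c i * (\<i> / 4 * (E' z * g i z + - (1 / l i) * (E z * h i z)))"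
    let ?b = "\<Sum>i\<in>I. c i * (\<i> / 4 * (l i * (E z * g i z) + - (E' z * h i z)))"
    have "((\<lambda>z. \<Sum>i\<in>I. c i * f i z) has_derivative (\<lambda>v. \<Sum>i\<in>I. c i *
        Df (l i) (g i) (h i) z v))
        (at z within strip T)"
      by (intro has_derivative_sum has_derivative_mult_right parallel_entriesD(1)[OF ent z])
    moreover have "((\<lambda>z. \<Sum>i\<in>I. c i * f i z) has_derivative (\<lambda>v. 0)) (at z within strip T)"
      by (rule has_derivative_transform[OF z _ has_derivative_const]) (use rel in simp)
    ultimately have 0: "(\<lambda>v. \<Sum>i\<in>I. c i *
        Df (l i) (g i) (h i) z v)
        = (\<lambda>v. 0)"
      by (rule strip_derivative_unique[OF T z])
    have ab: "v * ?a + cnj v * ?b = 0" for v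
    proof -
      have "v * ?a + cnj v * ?b = (\<Sum>i\<in>I. c i *
        Df (l i) (g i) (h i) z v)"
        unfolding distrib_left sum.distrib sum_distrib_left by (simp add: mult.left_commute)
      then show ?thesis using fun_cong[OF 0, of v] by simp
    qed
    have "?a + ?b = 0" "\<i> * (?a - ?b) = 0"
      using ab[of 1] ab[of \<i>] by (simp_all add: right_diff_distrib)
    then have "?a = 0" by simp
    also have "?a = \<i> / 4 * (\<Sum>i\<in>I. c i * (E' z * g i z + - (1 / l i) * (E z * h i z)))"
      unfolding sum_distrib_left by (simp add: mult.left_commute)
    finally show ?thesis by simp
  qed
  have PiZ: "(\<Sum>i\<in>I. c i * ((\<mu> - l i) * e i \<mu>) * x i) = 0" if "(\<Sum>i\<in>I. c i * x i) = 0" for \<mu> x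
  proof -
    have "(\<Sum>i\<in>I. c i * ((\<mu> - l i) * e i \<mu>) * x i) = W \<mu> * (\<Sum>i\<in>I. c i * x i)"
      unfolding sum_distrib_left by (intro sum.cong refl) (simp add: ePi[symmetric] mult_ac)
    with that show ?thesis by simp
  qed
  have ent': "parallel_entries \<mu> (f' \<mu>) (g' \<mu>) (h' \<mu>)" if \<mu>: "\<mu> \<noteq> 0" for \<mu>
    unfolding parallel_entries_def
  proof (intro ballI conjI)
    fix z assume z: "z \<in> strip T"
    note d = parallel_entriesD[OF ent z]
    have Zf: "(\<Sum>i\<in>I. c i * ((\<mu> - l i) * e i \<mu>) * f i z) = 0" by (rule PiZ[OF rel[OF z]])
    have Zz: "(\<Sum>i\<in>I. c i * ((\<mu> - l i) * e i \<mu>) * (E' z * g i z + - (1 / l i) * (E z * h i z))) = 0"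
      by (rule PiZ[OF relz[OF z]])
    have "(f' \<mu> has_derivative (\<lambda>v. \<Sum>i\<in>I. c i * \<mu> * e i \<mu> *
        Df (l i) (g i) (h i) z v))
        (at z within strip T)"
      (is "(_ has_derivative ?S) _")
      unfolding f'_def by (intro has_derivative_sum has_derivative_mult_right d(1))
    moreover have "?S v
       = Df \<mu> (g' \<mu>) (h' \<mu>) z v
        + v * (\<i> / 4) * (\<Sum>i\<in>I. c i * ((\<mu> - l i) * e i \<mu>) * (E' z * g i z + - (1 / l i) * (E z * h i z)))" for v
      unfolding g'_def h'_def sum_distrib_left sum.distrib[symmetric] sum_negf[symmetric]
      by (intro sum.cong refl superposition_identities(1) l \<mu>)
    ultimately show "(f' \<mu> has_derivative (\<lambda>v. Df \<mu> (g' \<mu>) (h' \<mu>) z v)) (at z within strip T)"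
      unfolding Zz by simp
    have "(g' \<mu> has_derivative (\<lambda>v. \<Sum>i\<in>I. c i * l i * e i \<mu> *
        Dg (l i) (f i) (g i) z v))
        (at z within strip T)"
      (is "(_ has_derivative ?S) _")
      unfolding g'_def by (intro has_derivative_sum has_derivative_mult_right d(2))
    moreover have "?S v
       = Dg \<mu> (f' \<mu>) (g' \<mu>) z v
        + cnj v * (- (\<i> / 2) * E' z) * (\<Sum>i\<in>I. c i * ((\<mu> - l i) * e i \<mu>) * f i z)" for v
      unfolding g'_def f'_def sum_distrib_left sum.distrib[symmetric] sum_negf[symmetric]
      by (intro sum.cong refl superposition_identities(2) l \<mu>)
    ultimately show "(g' \<mu> has_derivative (\<lambda>v. Dg \<mu> (f' \<mu>) (g' \<mu>) z v)) (at z within strip T)"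
      unfolding Zf by simp
    have "(h' \<mu> has_derivative (\<lambda>v. \<Sum>i\<in>I. c i * \<mu> * e i \<mu> *
        Dh (l i) (f i) (h i) z v))
        (at z within strip T)"
      (is "(_ has_derivative ?S) _")
      unfolding h'_def by (intro has_derivative_sum has_derivative_mult_right d(3))
    moreover have "?S v
       = Dh \<mu> (f' \<mu>) (h' \<mu>) z v
        + cnj v * (\<i> / 2 * \<mu> * E z) * (\<Sum>i\<in>I. c i * ((\<mu> - l i) * e i \<mu>) * f i z)" for v
      unfolding h'_def f'_def sum_distrib_left sum.distrib[symmetric] sum_negf[symmetric]
      by (intro sum.cong refl superposition_identities(3) l \<mu>)
    ultimately show "(h' \<mu> has_derivative (\<lambda>v. Dh \<mu> (f' \<mu>) (h' \<mu>) z v)) (at z within strip T)"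
      unfolding Zf by simp
  qed
  define \<Phi> where "\<Phi> = (\<lambda>l \<gamma> z. f' (l / \<gamma>) z *\<^sub>M sigma_0 + (1 / \<gamma> * g' (l / \<gamma>) z) *\<^sub>M sigma_plus
    + (\<gamma> * h' (l / \<gamma>) z) *\<^sub>M sigma_minus)"
  have "killing_field T \<omega> \<Phi>"
    unfolding \<Phi>_def by (rule killing_field_parallel_entries[OF ent'])
  moreover have "polynomial_field T \<Phi>"
  proof -
    let ?s1 = "\<lambda>lam \<gamma> z i. (\<gamma> powi 0 * (poly (smult (c i) (pCons 0 (P i))) (lam / \<gamma>) * f i z)) *\<^sub>M sigma_0"
    let ?s2 = "\<lambda>lam \<gamma> z i. (\<gamma> powi (- 1) * (poly (smult (c i * l i) (P i)) (lam / \<gamma>) * g i z)) *\<^sub>M sigma_plus"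
    let ?s3 = "\<lambda>lam \<gamma> z i. (\<gamma> powi 1 * (poly (smult (c i) (pCons 0 (P i))) (lam / \<gamma>) * h i z)) *\<^sub>M sigma_minus"
    note sm = parallel_entries_smooth[OF ent]
    have tr: "trace sigma_0 = 0" "trace sigma_plus = 0" "trace sigma_minus = 0"
      by (simp_all add: trace_def sum_2)
    have "polynomial_field T (\<lambda>lam \<gamma> z.
        (\<Sum>i\<in>I. ?s1 lam \<gamma> z i)
      + (\<Sum>i\<in>I. ?s2 lam \<gamma> z i)
      + (\<Sum>i\<in>I. ?s3 lam \<gamma> z i))"
      by (intro polynomial_field_add[OF T] polynomial_field_sum[OF T I(1)] polynomial_field_poly[OF T] sm tr)
    then show ?thesis
    proof (rule polynomial_field_cong)
      fix lam \<gamma> :: complex and z assume "\<gamma> \<noteq> 0"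
      have 1: "(\<Sum>i\<in>I. ?s1 lam \<gamma> z i)
         = f' (lam / \<gamma>) z *\<^sub>M sigma_0"
        by (simp add: sum_mat_scale f'_def P mult_ac)
      have 2: "(\<Sum>i\<in>I. ?s2 lam \<gamma> z i)
         = (1 / \<gamma> * g' (lam / \<gamma>) z) *\<^sub>M sigma_plus"
        by (simp add: sum_mat_scale g'_def P
            sum_distrib_left power_int_minus divide_inverse mult_ac)
      have 3: "(\<Sum>i\<in>I. ?s3 lam \<gamma> z i)
         = (\<gamma> * h' (lam / \<gamma>) z) *\<^sub>M sigma_minus"
        by (simp add: sum_mat_scale h'_def P
            sum_distrib_left mult_ac)
      show "\<Phi> lam \<gamma> z = (\<Sum>i\<in>I. ?s1 lam \<gamma> z i)
      + (\<Sum>i\<in>I. ?s2 lam \<gamma> z i)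
      + (\<Sum>i\<in>I. ?s3 lam \<gamma> z i)"
        unfolding 1 2 3 \<Phi>_def ..
    qed
  qed
  \<comment> \<open>At the parameter \<open>l i0\<close> all other summands contain a vanishing
    factor, so only the term with \<open>g i0\<close> remains in the upper right entry.\<close>
  moreover have "\<Phi> (l i0) 1 0 \<noteq> 0"
  proof -
    have "e i (l i0) = 0" if "i \<in> I" "i \<noteq> i0" for i
      using I(1) nz(1) that by (auto simp: e_def)
    then have "g' (l i0) 0 = (\<Sum>i\<in>I. if i = i0 then c i0 * l i0 * e i0 (l i0) * g i0 0 else 0)"
      unfolding g'_def by (intro sum.cong) auto
    also have "\<dots> = c i0 * l i0 * e i0 (l i0) * g i0 0" using I(1) nz(1) by simp
    also have "\<dots> \<noteq> 0"
      using nz l[OF nz(1)] I inj_onD[OF I(2)] by (auto simp: e_def)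
    finally have "\<Phi> (l i0) 1 0 $ 1 $ 2 \<noteq> 0" by (simp add: \<Phi>_def)
    then show ?thesis by (metis zero_index)
  qed
  ultimately show ?thesis
    unfolding finite_type_def using l[OF nz(1)] zero_in_strip
    by (intro exI[of _ \<Phi>] conjI exI[of _ "l i0"] exI[of _ 1] bexI[of _ 0]) auto
qed

end

section \<open>Durham boundary conditions\<close>

locale durham_strip = sinh_gordon_strip +
  fixes A1 B1 A2 B2 :: real
  assumes bc1: "\<And>z. Im z = T \<Longrightarrow> q z = A1 * exp (\<omega> z) + B1 * exp (- \<omega> z)"
    and bc2: "\<And>z. Im z = - T \<Longrightarrow> q z = A2 * exp (\<omega> z) + B2 * exp (- \<omega> z)"
begin

definition robin :: "(complex \<Rightarrow> complex) \<Rightarrow> (complex \<Rightarrow> complex) \<Rightarrow> bool" where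
  "robin u uy \<longleftrightarrow> (\<forall>z. Im z = T \<longrightarrow> uy z = of_real (A1 * exp (\<omega> z) - B1 * exp (- \<omega> z)) * u z) \<and>
     (\<forall>z. Im z = - T \<longrightarrow> uy z = of_real (A2 * exp (\<omega> z) - B2 * exp (- \<omega> z)) * u z)"

definition cell :: "nat \<Rightarrow> nat \<Rightarrow> nat \<Rightarrow> (real \<times> real) set" where
  "cell n i j = cbox (L * real i / real n, - T + 2 * T * real j / real n)
     (L * real (Suc i) / real n, - T + 2 * T * real (Suc j) / real n)"

definition cell_mean :: "nat \<Rightarrow> (complex \<Rightarrow> complex) \<Rightarrow> nat \<times> nat \<Rightarrow> complex" where
  "cell_mean n u = (\<lambda>(i, j). integral (cell n i j) (\<lambda>p. u (Complex (fst p) (snd p))))"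

lemma Complex_in_strip: "Complex x y \<in> strip T \<longleftrightarrow> y \<in> {- T..T}"
  by (auto simp: strip_def)

lemma continuous_Complex:
  "continuous_on X (\<lambda>x. Complex x y)" "continuous_on S (\<lambda>p. Complex (fst p) (snd p))"
  unfolding Complex_eq by (intro continuous_intros)+

lemma continuous_on_Complex:
  assumes "continuous_on (strip T) u" "S \<subseteq> UNIV \<times> {- T..T}"
  shows "continuous_on S (\<lambda>p. u (Complex (fst p) (snd p)))"
proof (rule continuous_on_compose2[OF assms(1)])
  show "continuous_on S (\<lambda>p. Complex (fst p) (snd p))" by (rule continuous_Complex)
  show "(\<lambda>p. Complex (fst p) (snd p)) ` S \<subseteq> strip T"
    using assms(2) by (auto simp: Complex_in_strip)
qed

lemma integrable_on_cell:
  fixes u :: "complex \<Rightarrow> complex"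
  assumes "continuous_on (strip T) u" "i < n" "j < n"
  shows "(\<lambda>p. u (Complex (fst p) (snd p))) integrable_on cell n i j"
proof -
  have "2 * T * real (Suc j) / real n \<le> 2 * T" "0 \<le> 2 * T * real j / real n"
    using assms T by (simp_all add: field_simps del: of_nat_Suc)
  then have "cell n i j \<subseteq> UNIV \<times> {- T..T}" by (auto simp: cell_def)
  from integrable_continuous[OF continuous_on_Complex[OF assms(1) this, unfolded cell_def]]
  show ?thesis unfolding cell_def .
qed

text \<open>Here \<open>re\<close> is to be the real or the imaginary part, so that one argument
  serves both.\<close>

lemma partial_derivatives:
  assumes d: "\<And>z. z \<in> strip T \<Longrightarrow> (u has_derivative (\<lambda>v. Re v *\<^sub>R ux z + Im v *\<^sub>R uy z)) (at z within strip T)"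
    and re: "bounded_linear re" and y: "y \<in> {- T..T}"
  shows "x \<in> X \<Longrightarrow> ((\<lambda>x. re (u (Complex x y))) has_real_derivative re (ux (Complex x y))) (at x within X)"
    and "((\<lambda>y. re (u (Complex x y))) has_real_derivative re (uy (Complex x y))) (at y within {- T..T})"
proof -
  have lin: "(\<lambda>t. re (t *\<^sub>R w)) = (*) (re w)" for w
    by (simp add: fun_eq_iff linear_scale[OF bounded_linear.linear[OF re]])
  {
    assume x: "x \<in> X"
    have 1: "((\<lambda>x. Complex x y) has_derivative (\<lambda>t. of_real t)) (at x within X)"
      unfolding Complex_eq by (auto intro!: derivative_eq_intros)
    have "(\<lambda>x. Complex x y) ` X \<subseteq> strip T" using y by (auto simp: Complex_in_strip)
    from bounded_linear.has_derivative[OF re has_derivative_in_compose2[OF d this x 1]]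
    show "((\<lambda>x. re (u (Complex x y))) has_real_derivative re (ux (Complex x y))) (at x within X)"
      by (simp add: has_field_derivative_def lin)
  }
  have 1: "((\<lambda>y. Complex x y) has_derivative (\<lambda>t. \<i> * of_real t)) (at y within {- T..T})"
    unfolding Complex_eq by (auto intro!: derivative_eq_intros)
  have "(\<lambda>y. Complex x y) ` {- T..T} \<subseteq> strip T" by (auto simp: Complex_in_strip)
  from bounded_linear.has_derivative[OF re has_derivative_in_compose2[OF d this y 1]]
  show "((\<lambda>y. re (u (Complex x y))) has_real_derivative re (uy (Complex x y))) (at y within {- T..T})"
    by (simp add: has_field_derivative_def lin)
qed

lemma continuous_bounded_above:
  fixes f :: "'b::euclidean_space \<Rightarrow> real"
  assumes "continuous_on S f" "compact S"
  shows "\<exists>M>0. \<forall>x\<in>S. \<bar>f x\<bar> \<le> M"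
  using compact_imp_bounded[OF compact_continuous_image[OF assms]] by (auto simp: bounded_pos)

lemma jacobi_field_continuous:
  assumes "jacobi_field u ux uy uxx uxy uyx uyy"
  shows "continuous_on (strip T) u" "continuous_on (strip T) ux" "continuous_on (strip T) uy"
    "continuous_on (strip T) uxx" "continuous_on (strip T) uyy"
  using assms unfolding jacobi_field_def
  by (meson continuous_on_eq_continuous_within has_derivative_continuous)+

lemma shift_invariant_zero:
  assumes per: "\<And>z. z \<in> strip T \<Longrightarrow> u (z + of_real L) = u z"
    and zero: "\<And>x y. x \<in> {0..L} \<Longrightarrow> y \<in> {- T..T} \<Longrightarrow> u (Complex x y) = (0::complex)"
    and z: "z \<in> strip T"
  shows "u z = 0"
proof -
  have n: "u (w + of_real (real n * L)) = u w" if "w \<in> strip T" for n w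
    using that
  proof (induction n)
    case (Suc n)
    have "w + of_real (real n * L) \<in> strip T" using Suc.prems by (simp add: strip_def)
    from per[OF this] Suc.IH[OF Suc.prems] show ?case by (simp add: algebra_simps)
  qed simp
  define k where "k = \<lfloor>Re z / L\<rfloor>"
  define w where "w = Complex (Re z - of_int k * L) (Im z)"
  have "of_int k \<le> Re z / L" "Re z / L < of_int k + 1"
    unfolding k_def by linarith+
  then have "of_int k * L \<le> Re z" "Re z < (of_int k + 1) * L"
    using L by (simp_all add: pos_le_divide_eq pos_divide_less_eq)
  then have "u w = 0" unfolding w_def using z by (intro zero) (auto simp: strip_def algebra_simps)
  moreover have "u z = u w"
  proof (cases "k \<ge> 0")
    case True
    then have "z = w + of_real (real (nat k) * L)" by (simp add: w_def complex_eq_iff)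
    then show ?thesis using n[of w "nat k"] z by (simp add: w_def strip_def)
  next
    case False
    then have "w = z + of_real (real (nat (- k)) * L)" by (simp add: w_def complex_eq_iff)
    then show ?thesis using n[OF z, of "nat (- k)"] by simp
  qed
  ultimately show ?thesis by simp
qed

text \<open>The point is the order of quantifiers: \<open>n\<close> depends on \<omega>, the period,
  the strip and the boundary constants, but not on \<open>u\<close>. Hence the cell means embed the
  solution space into a space of dimension \<open>n * n\<close>.\<close>

lemma jacobi_field_zero:
  "\<exists>n. 0 < n \<and> (\<forall>u ux uy uxx uxy uyx uyy. jacobi_field u ux uy uxx uxy uyx uyy \<longrightarrow> robin u uy \<longrightarrow>
     (\<forall>c\<in>{..<n} \<times> {..<n}. cell_mean n u c = 0) \<longrightarrow> (\<forall>z\<in>strip T. u z = 0))"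
proof -
  let ?B = "cbox (0, - T) (L, T)"
  have sub: "?B \<subseteq> UNIV \<times> {- T..T}" by auto
  define r1 where "r1 x = A1 * exp (\<omega> (Complex x T)) - B1 * exp (- \<omega> (Complex x T))" for x
  define r2 where "r2 x = A2 * exp (\<omega> (Complex x (- T))) - B2 * exp (- \<omega> (Complex x (- T)))" for x
  define qq where "qq p = cosh (2 * \<omega> (Complex (fst p) (snd p)))" for p
  have c\<omega>: "continuous_on X (\<lambda>x. \<omega> (Complex x y))" if "y \<in> {- T..T}" for y X
    by (rule continuous_on_compose2[OF cont_\<omega>(1) continuous_Complex(1)]) (use that in \<open>auto simp: Complex_in_strip\<close>)
  have cr: "continuous_on {0..L} r1" "continuous_on {0..L} r2"
    unfolding r1_def r2_def using T by (intro continuous_intros c\<omega>; simp)+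
  have "continuous_on ?B (\<lambda>p. \<omega> (Complex (fst p) (snd p)))"
    by (rule continuous_on_compose2[OF cont_\<omega>(1) continuous_Complex(2)]) (auto simp: Complex_in_strip)
  then have cq: "continuous_on ?B qq"
    unfolding qq_def cosh_field_def by (intro continuous_intros) auto
  obtain Q where Q: "\<And>p. p \<in> ?B \<Longrightarrow> qq p \<le> Q"
    using continuous_bounded_above[OF cq compact_cbox] by (meson abs_le_D1)
  obtain R1 R2 where "\<And>x. x \<in> {0..L} \<Longrightarrow> \<bar>r1 x\<bar> \<le> R1" "\<And>x. x \<in> {0..L} \<Longrightarrow> \<bar>r2 x\<bar> \<le> R2"
    using continuous_bounded_above[OF cr(1) compact_Icc] continuous_bounded_above[OF cr(2) compact_Icc] by meson
  then have R: "\<And>x. x \<in> {0..L} \<Longrightarrow> \<bar>r1 x\<bar> \<le> max R1 R2" "\<And>x. x \<in> {0..L} \<Longrightarrow> \<bar>r2 x\<bar> \<le> max R1 R2"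
    by (meson max.coboundedI1 max.coboundedI2)+
  define R where "R = max R1 R2"
  define K where "K = 4 * ((max L (2 * T))\<^sup>2 * (Q + R / T + 2 * R\<^sup>2))"
  obtain m :: nat where m: "K < real m" using reals_Archimedean2 by blast
  define n where "n = Suc m"
  have n0: "0 < n" by (simp add: n_def)
  have "real n \<le> (real n)\<^sup>2" using self_le_power[of "real n" 2] by (simp add: n_def)
  then have n: "K < (real n)\<^sup>2" using m by (simp add: n_def)
  show ?thesis
  proof (intro exI[of _ n] conjI n0 allI impI ballI)
    fix u ux uy uxx uxy uyx uyy z
    assume J: "jacobi_field u ux uy uxx uxy uyx uyy" and rob: "robin u uy"
      and mean: "\<forall>c\<in>{..<n} \<times> {..<n}. cell_mean n u c = 0" and z: "z \<in> strip T"
    note cJ = jacobi_field_continuous[OF J]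
    have dJ: "\<And>z. z \<in> strip T \<Longrightarrow> (u has_derivative (\<lambda>v. Re v *\<^sub>R ux z + Im v *\<^sub>R uy z)) (at z within strip T)"
      "\<And>z. z \<in> strip T \<Longrightarrow> (ux has_derivative (\<lambda>v. Re v *\<^sub>R uxx z + Im v *\<^sub>R uxy z)) (at z within strip T)"
      "\<And>z. z \<in> strip T \<Longrightarrow> (uy has_derivative (\<lambda>v. Re v *\<^sub>R uyx z + Im v *\<^sub>R uyy z)) (at z within strip T)"
      and pde: "\<And>z. z \<in> strip T \<Longrightarrow> uxx z + uyy z = - of_real (cosh (2 * \<omega> z)) * u z"
      and per: "\<And>z. z \<in> strip T \<Longrightarrow> u (z + of_real L) = u z" "\<And>z. z \<in> strip T \<Longrightarrow> ux (z + of_real L) = ux z"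
      using J by (auto simp: jacobi_field_def)
    have part: "re (u (Complex x y)) = 0"
      if re: "bounded_linear re" and scale: "\<And>r w. re (of_real r * w) = r * re w"
        and x: "x \<in> {0..L}" and y: "y \<in> {- T..T}" for x y and re :: "complex \<Rightarrow> real"
    proof -
      define F where "F v p = re (v (Complex (fst p) (snd p)))" for v p
      have cF: "continuous_on ?B (F v)" if "continuous_on (strip T) v" for v
        unfolding F_def by (intro bounded_linear.continuous_on[OF re] continuous_on_Complex[OF that sub])
      have shift: "Complex L y = Complex 0 y + of_real L" for y by (simp add: complex_eq_iff)
      interpret rp: robin_problem L T Q R "F u" "F ux" "F uy" "F uxx" "F uyy" qq r1 r2
      proof (unfold_locales)
        fix x y assume x: "x \<in> {0..L}" and y: "y \<in> {- T..T}"
        show "((\<lambda>x. F u (x, y)) has_real_derivative F ux (x, y)) (at x within {0..L})"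
          unfolding F_def fst_conv snd_conv by (rule partial_derivatives(1)[OF dJ(1) re y x])
        show "((\<lambda>x. F ux (x, y)) has_real_derivative F uxx (x, y)) (at x within {0..L})"
          unfolding F_def fst_conv snd_conv by (rule partial_derivatives(1)[OF dJ(2) re y x])
        show "((\<lambda>y. F u (x, y)) has_real_derivative F uy (x, y)) (at y within {- T..T})"
          unfolding F_def fst_conv snd_conv by (rule partial_derivatives(2)[OF dJ(1) re y])
        show "((\<lambda>y. F uy (x, y)) has_real_derivative F uyy (x, y)) (at y within {- T..T})"
          unfolding F_def fst_conv snd_conv by (rule partial_derivatives(2)[OF dJ(3) re y])
      next
        fix y assume "y \<in> {- T..T}"
        then show "F u (L, y) = F u (0, y)" "F ux (L, y) = F ux (0, y)"
          unfolding F_def fst_conv snd_conv shift by (simp_all add: per Complex_in_strip)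
      next
        fix p assume "p \<in> ?B"
        then have "Complex (fst p) (snd p) \<in> strip T" by (cases p) (simp add: Complex_in_strip)
        then have "re (uxx (Complex (fst p) (snd p)) + uyy (Complex (fst p) (snd p)))
          = re (of_real (- qq p) * u (Complex (fst p) (snd p)))"
          by (simp add: pde qq_def)
        then show "F uxx p + F uyy p = - qq p * F u p"
          unfolding scale F_def linear_add[OF bounded_linear.linear[OF re]] .
      next
        fix x :: real
        show "F uy (x, T) = r1 x * F u (x, T)" "F uy (x, - T) = r2 x * F u (x, - T)"
          using rob unfolding F_def robin_def r1_def r2_def fst_conv snd_conv by (simp_all only: scale complex.sel)
      qed (fact L T cF[OF cJ(1)] cF[OF cJ(2)] cF[OF cJ(3)] cF[OF cJ(4)] cF[OF cJ(5)] cq cr Q R[folded R_def])+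
      have "F u (x, y) = 0"
      proof (rule rp.robin_unique_by_cell_means[OF n0 n[unfolded K_def] refl refl])
        fix i j assume ij: "i < n" "j < n"
        from integral_linear[OF integrable_on_cell[OF cJ(1) ij] re] mean ij
        have "integral (cell n i j) (F u) = 0"
          by (auto simp: F_def[abs_def] o_def cell_mean_def linear_0[OF bounded_linear.linear[OF re]])
        then show "rint (L * real i / real n) (L * real (Suc i) / real n)
            (- T + 2 * T * real j / real n) (- T + 2 * T * real (Suc j) / real n) (F u) = 0"
          unfolding cell_def .
      next
        show "(x, y) \<in> ?B" using x y by simp
      qed
      then show ?thesis by (simp add: F_def)
    qed
    have u0: "u (Complex x y) = 0" if "x \<in> {0..L}" "y \<in> {- T..T}" for x y
      using part[OF bounded_linear_Re _ that] part[OF bounded_linear_Im _ that] by (simp add: complex_eq_iff)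
    show "u z = 0" by (rule shift_invariant_zero[where u = u, OF per(1) u0 z])
  qed
qed

text \<open>In the determinant the square of \<open>1 / t - t\<close> grows quadratically in
  \<open>t\<close>, while the other product grows at most linearly.\<close>

lemma det_kmat_nonzero:
  assumes t: "t > 16 * (A\<^sup>2 + B\<^sup>2 + \<bar>A * B\<bar>) + 3"
  shows "det (kmat A B (- of_real (1 / t))) \<noteq> 0"
proof -
  define S where "S = 16 * (A\<^sup>2 + B\<^sup>2 + \<bar>A * B\<bar>)"
  have S0: "S \<ge> 0" by (simp add: S_def)
  have t3: "t > S + 3" using t by (simp add: S_def)
  then have t0: "t > 0" using S0 by linarith
  have "det (kmat A B (- of_real (1 / t))) = of_real ((4 * A + 4 * B * t) * (4 * A + 4 * B / t) - (1 / t - t)\<^sup>2)"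
    using t0 by (simp add: det_2 kmat_def power2_eq_square)
  moreover have "(4 * A + 4 * B * t) * (4 * A + 4 * B / t) = 16 * (A\<^sup>2 + B\<^sup>2) + 16 * (A * B) * (t + 1 / t)"
    using t0 by (simp add: power2_eq_square field_simps)
  moreover have "16 * (A\<^sup>2 + B\<^sup>2) + 16 * (A * B) * (t + 1 / t) < (1 / t - t)\<^sup>2"
  proof -
    have t1: "1 / t \<le> 1" using t3 S0 by simp
    have "A * B * (t + 1 / t) \<le> \<bar>A * B\<bar> * (t + 1 / t)"
      using t0 by (intro mult_right_mono) auto
    moreover have "\<bar>A * B\<bar> * (t + 1 / t) \<le> \<bar>A * B\<bar> * (t + 1)"
      using t1 by (intro mult_left_mono) auto
    moreover have "16 * (A\<^sup>2 + B\<^sup>2) \<le> 16 * (A\<^sup>2 + B\<^sup>2) * (t + 1)"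
      using mult_left_mono[of 1 "t + 1" "16 * (A\<^sup>2 + B\<^sup>2)"] t0 by simp
    ultimately have "16 * (A\<^sup>2 + B\<^sup>2) + 16 * (A * B) * (t + 1 / t) \<le> S * (t + 1)"
      by (simp add: S_def algebra_simps)
    also have "S * (t + 1) < t\<^sup>2 - 2"
    proof -
      have "(S + 3) * t \<le> t * t" using t3 t0 by (intro mult_right_mono) auto
      then show ?thesis using t3 S0 by (simp add: power2_eq_square algebra_simps)
    qed
    also have "t\<^sup>2 - 2 \<le> (1 / t - t)\<^sup>2"
      using t0 by (simp add: power2_diff power_divide)
    finally show ?thesis .
  qed
  ultimately show ?thesis by (metis less_irrefl of_real_eq_0_iff right_minus_eq)
qed

lemma robin_jacobi_field:
  assumes l: "l \<noteq> 0" and K: "det (kmat A1 B1 l) \<noteq> 0" "det (kmat A2 B2 l) \<noteq> 0"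
  shows "\<exists>ux uy uxx uxy uyx uyy. jacobi_field (\<lambda>z. mf l z - mf (1 / l) z) ux uy uxx uxy uyx uyy
     \<and> robin (\<lambda>z. mf l z - mf (1 / l) z) uy"
proof -
  define fx where "fx l z = \<i> / 4 * (E' z * mg l z + - (1 / l) * (E z * mh l z)) + \<i> / 4 * (l * (E z * mg l z) + - (E' z * mh l z))" for l z
  define fy where "fy l z = \<i> * (\<i> / 4 * (E' z * mg l z + - (1 / l) * (E z * mh l z)) - \<i> / 4 * (l * (E z * mg l z) + - (E' z * mh l z)))" for l z
  \<comment> \<open>Indexing the two parameters by truth values presents the difference as a sum
    with coefficients 1 and -1.\<close>
  define lam where "lam b = (if b then l else 1 / l)" for b
  have "\<exists>uxx uxy uyx uyy. jacobi_field (mf (lam b)) (fx (lam b)) (fy (lam b)) uxx uxy uyx uyy" for b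
    unfolding fx_def fy_def by (rule jacobi_field_mf) (use l in \<open>simp add: lam_def\<close>)
  then obtain uxx uxy uyx uyy where J:
    "\<And>b. jacobi_field (mf (lam b)) (fx (lam b)) (fy (lam b)) (uxx b) (uxy b) (uyx b) (uyy b)" by metis
  from jacobi_field_sum[where I = "UNIV :: bool set" and u = "\<lambda>b. mf (lam b)" and ux = "\<lambda>b. fx (lam b)"
      and uy = "\<lambda>b. fy (lam b)", OF finite J, of "\<lambda>b. if b then 1 else - 1"]
  have "\<exists>uxx uxy uyx uyy. jacobi_field (\<lambda>z. mf l z - mf (1 / l) z) (\<lambda>z. fx l z - fx (1 / l) z)
      (\<lambda>z. fy l z - fy (1 / l) z) uxx uxy uyx uyy"
    by (simp add: UNIV_bool lam_def) blast
  moreover have "robin (\<lambda>z. mf l z - mf (1 / l) z) (\<lambda>z. fy l z - fy (1 / l) z)"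
  proof -
    have key: "fy l z - fy (1 / l) z = of_real (A * exp (\<omega> z) - B * exp (- \<omega> z)) * (mf l z - mf (1 / l) z)"
      if 1: "of_real A * (mf l z - mf (1 / l) z) * 4 = l * mg l z + mh l z / l - mg (1 / l) z / l - l * mh (1 / l) z"
        and 2: "of_real B * (mf l z - mf (1 / l) z) * 4 = mg l z + mh l z - mg (1 / l) z - mh (1 / l) z" for A B z
    proof -
      \<comment> \<open>The off-diagonal entries enter through exactly the two combinations that
        \<open>robin_condition\<close> determines, and the minus sign between them turns
        \<open>B\<close> into \<open>- B\<close>.\<close>
      have fy: "fy l z = - (1 / 4) * (E' z * (mg l z + mh l z) - E z * (l * mg l z + mh l z / l))" if "l \<noteq> 0" for l
        using that by (simp add: fy_def field_simps)
      have l': "1 / l \<noteq> 0" using l by simp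
      have "fy l z - fy (1 / l) z = (E z * (l * mg l z + mh l z / l - mg (1 / l) z / l - l * mh (1 / l) z)
          - E' z * (mg l z + mh l z - mg (1 / l) z - mh (1 / l) z)) / 4"
        unfolding fy[OF l] fy[OF l'] by (simp add: field_simps)
      also have "\<dots> = (of_real A * E z - of_real B * E' z) * (mf l z - mf (1 / l) z)"
        unfolding 1[symmetric] 2[symmetric] by (simp add: field_simps)
      finally show ?thesis by (simp add: E_def E'_def)
    qed
    have "fy l z - fy (1 / l) z = of_real (A1 * exp (\<omega> z) - B1 * exp (- \<omega> z)) * (mf l z - mf (1 / l) z)" if "Im z = T" for z
      by (intro key robin_condition[OF l _ bc1 that K(1)]) (use T in auto)
    moreover have "fy l z - fy (1 / l) z = of_real (A2 * exp (\<omega> z) - B2 * exp (- \<omega> z)) * (mf l z - mf (1 / l) z)" if "Im z = - T" for z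
      by (intro key robin_condition[OF l _ bc2 that K(2)]) (use T in auto)
    ultimately show ?thesis by (simp add: robin_def)
  qed
  ultimately show ?thesis by blast
qed

lemma durham_finite_type: "finite_type T \<omega>"
proof -
  obtain n where n: "0 < n" and zero: "\<And>u ux uy uxx uxy uyx uyy. jacobi_field u ux uy uxx uxy uyx uyy \<Longrightarrow> robin u uy \<Longrightarrow>
     (\<forall>c\<in>{..<n} \<times> {..<n}. cell_mean n u c = 0) \<Longrightarrow> (\<forall>z\<in>strip T. u z = 0)"
    using jacobi_field_zero by blast
  have "continuous_on {0..L} (\<lambda>x. 4 * (q (of_real x))\<^sup>2 + exp (2 * \<omega> (of_real x)) + exp (- 2 * \<omega> (of_real x)))"
    by (intro continuous_intros continuous_on_compose2[OF cont_\<omega>(1)] continuous_on_compose2[OF cont_\<omega>(3)])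
       (use T in \<open>auto simp: strip_def\<close>)
  then obtain W where W: "W > 0"
    "\<And>x. x \<in> {0..L} \<Longrightarrow> 4 * (q (of_real x))\<^sup>2 + exp (2 * \<omega> (of_real x)) + exp (- 2 * \<omega> (of_real x)) \<le> W"
    using continuous_bounded_above[OF _ compact_Icc] by (meson abs_le_D1)
  \<comment> \<open>Every \<open>t k\<close> must exceed \<open>W\<close> for the nonvanishing
    off-diagonal entry, both determinant thresholds for the invertibility of \<open>kmat\<close>,
    and 1 to keep the parameters apart from their inverses.\<close>
  define t0 where "t0 = W + (16 * (A1\<^sup>2 + B1\<^sup>2 + \<bar>A1 * B1\<bar>) + 3) + (16 * (A2\<^sup>2 + B2\<^sup>2 + \<bar>A2 * B2\<bar>) + 3) + 1"
  define t where "t k = t0 + real k" for k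
  have nn: "16 * (A\<^sup>2 + B\<^sup>2 + \<bar>A * B\<bar>) \<ge> 0" for A B :: real by simp
  have t: "t k > W" "t k > 16 * (A1\<^sup>2 + B1\<^sup>2 + \<bar>A1 * B1\<bar>) + 3" "t k > 16 * (A2\<^sup>2 + B2\<^sup>2 + \<bar>A2 * B2\<bar>) + 3" "t k > 1" for k
    using W(1) nn[of A1 B1] nn[of A2 B2] unfolding t_def t0_def by linarith+
  have tinj: "t k = t k' \<longleftrightarrow> k = k'" for k k' by (simp add: t_def)
  define lam where "lam k = - complex_of_real (1 / t k)" for k
  have tpos: "t k > 0" for k using t(4)[of k] by linarith
  have lam0: "lam k \<noteq> 0" for k using tpos[of k] by (simp add: lam_def)
  have lam_inv: "1 / lam k = - complex_of_real (t k)" for k by (simp add: lam_def)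
  define U where "U k z = mf (lam k) z - mf (1 / lam k) z" for k z
  have "\<exists>ux uy uxx uxy uyx uyy. jacobi_field (U k) ux uy uxx uxy uyx uyy \<and> robin (U k) uy" for k
    unfolding U_def
    by (rule robin_jacobi_field[OF lam0]) (use det_kmat_nonzero[OF t(2)] det_kmat_nonzero[OF t(3)] in \<open>simp_all add: lam_def\<close>)
  then obtain ux uy uxx uxy uyx uyy where
    J: "\<And>k. jacobi_field (U k) (ux k) (uy k) (uxx k) (uxy k) (uyx k) (uyy k)" and R: "\<And>k. robin (U k) (uy k)"
    by metis
  \<comment> \<open>The interval includes \<open>n * n\<close>, so there is one parameter more than
    there are cells.\<close>
  define I where "I = {..n * n}"
  have "card ({..<n} \<times> {..<n}) < card I" by (simp add: I_def card_cartesian_product)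
  from nontrivial_relation[OF _ _ this, of "\<lambda>k. cell_mean n (U k)"]
  obtain c where c: "\<exists>k\<in>I. c k \<noteq> 0" "\<And>d. d \<in> {..<n} \<times> {..<n} \<Longrightarrow> (\<Sum>k\<in>I. c k * cell_mean n (U k) d) = 0"
    by (auto simp: I_def)
  have fI: "finite I" by (simp add: I_def)
  have "\<forall>z\<in>strip T. (\<Sum>k\<in>I. c k * U k z) = 0"
  proof (rule zero[OF jacobi_field_sum[OF fI J]])
    show "robin (\<lambda>z. \<Sum>k\<in>I. c k * U k z) (\<lambda>z. \<Sum>k\<in>I. c k * uy k z)"
      using R unfolding robin_def by (simp add: sum_distrib_left mult.left_commute)
    show "\<forall>d\<in>{..<n} \<times> {..<n}. cell_mean n (\<lambda>z. \<Sum>k\<in>I. c k * U k z) d = 0"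
    proof
      fix d assume d: "d \<in> {..<n} \<times> {..<n}"
      obtain i j where ij: "d = (i, j)" "i < n" "j < n" using d by blast
      note int = integrable_on_cell[OF jacobi_field_continuous(1)[OF J] ij(2,3)]
      have "cell_mean n (\<lambda>z. \<Sum>k\<in>I. c k * U k z) d = (\<Sum>k\<in>I. c k * cell_mean n (U k) d)"
        unfolding cell_mean_def ij(1) prod.case
        by (subst integral_sum[OF fI]) (auto intro!: integrable_on_mult_right int)
      with c(2)[OF d] show "cell_mean n (\<lambda>z. \<Sum>k\<in>I. c k * U k z) d = 0" by simp
    qed
  qed
  then have rel: "(\<Sum>k\<in>I. c k * mf (lam k) z) - (\<Sum>k\<in>I. c k * mf (1 / lam k) z) = 0" if "z \<in> strip T" for z
    using that by (simp add: U_def right_diff_distrib sum_subtractf)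
  \<comment> \<open>The differences are split into single entries: the index \<open>(k, b)\<close>
    selects \<open>lam k\<close> or its inverse, with coefficient \<open>c k\<close> or
    \<open>- c k\<close>. Injectivity holds because \<open>1 / t k < 1 < t k'\<close> for all
    \<open>k\<close> and \<open>k'\<close>.\<close>
  define l where "l = (\<lambda>(k, b). if b then lam k else 1 / lam k)"
  obtain k0 where k0: "k0 \<in> I" "c k0 \<noteq> 0" using c(1) by blast
  show ?thesis
  proof (rule finite_type_of_relation[where I = "I \<times> (UNIV :: bool set)" and l = l and
        f = "\<lambda>i. mf (l i)" and g = "\<lambda>i. mg (l i)" and h = "\<lambda>i. mh (l i)" and
        c = "\<lambda>(k, b). if b then c k else - c k" and ?i0.0 = "(k0, True)"])
    show "finite (I \<times> (UNIV :: bool set))" using fI by simp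
    show l0: "l i \<noteq> 0" for i using lam0 by (auto simp: l_def split: prod.split)
    show "parallel_entries (l i) (mf (l i)) (mg (l i)) (mh (l i))" for i
      by (rule monodromy_parallel_entries[OF l0])
    have small: "1 / t k < 1" for k using t(4)[of k] by simp
    have ne: "1 / t k \<noteq> t k'" for k k' using small[of k] t(4)[of k'] by linarith
    have inj: "1 / t k = 1 / t k' \<longleftrightarrow> k = k'" for k k' using tpos[of k] tpos[of k'] tinj by (simp add: field_simps)
    show "inj_on l (I \<times> UNIV)"
    proof (rule inj_onI)
      fix x y assume "l x = l y"
      moreover obtain k b where x: "x = (k, b)" by fastforce
      moreover obtain k' b' where y: "y = (k', b')" by fastforce
      moreover have "l (k, b) = - complex_of_real (if b then 1 / t k else t k)" for k b
        using lam_inv by (simp add: l_def lam_def)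
      ultimately have "(if b then 1 / t k else t k) = (if b' then 1 / t k' else t k')"
        by (simp only: neg_equal_iff_equal of_real_eq_iff)
      then show "x = y" unfolding x y using inj[of k k'] ne[of k k'] ne[of k' k] tinj[of k k']
        by (cases b; cases b') (auto dest: sym)
    qed
    show "(\<Sum>i\<in>I \<times> UNIV. (case i of (k, b) \<Rightarrow> if b then c k else - c k) * mf (l i) z) = 0" if "z \<in> strip T" for z
    proof -
      have "(\<Sum>i\<in>I \<times> UNIV. (case i of (k, b) \<Rightarrow> if b then c k else - c k) * mf (l i) z)
        = (\<Sum>k\<in>I. \<Sum>b\<in>UNIV. (if b then c k else - c k) * mf (l (k, b)) z)"
        by (simp add: sum.cartesian_product case_prod_unfold)
      also have "\<dots> = (\<Sum>k\<in>I. c k * mf (lam k) z) - (\<Sum>k\<in>I. c k * mf (1 / lam k) z)"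
        by (simp add: UNIV_bool l_def sum_subtractf)
      finally show ?thesis using rel[OF that] by simp
    qed
    show "(k0, True) \<in> I \<times> UNIV" "(case (k0, True) of (k, b) \<Rightarrow> if b then c k else - c k) \<noteq> 0" using k0 by auto
    show "mg (l (k0, True)) 0 \<noteq> 0"
      unfolding l_def lam_def using tpos[of k0]
      by simp (rule monodromy_offdiagonal_nonzero[of "1 / t k0", simplified],
          use tpos[of k0] W(2) t(1)[of k0] in \<open>auto intro: le_less_trans\<close>)
  qed
qed

end

section \<open>From a smooth solution to real partial derivatives\<close>

lemma smooth_on_partial:
  assumes "smooth_on S f"
  shows "smooth_on S (\<lambda>z. frechet_derivative f (at z within S) v)"
  unfolding smooth_on_def
proof
  fix k
  have "Ck_on (Suc k) S f" using assms by (simp only: smooth_on_def)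
  then show "Ck_on k S (\<lambda>z. frechet_derivative f (at z within S) v)" by simp
qed

lemma smooth_on_has_derivative:
  fixes f :: "complex \<Rightarrow> 'a::real_normed_vector"
  assumes "smooth_on (strip T) f" "z \<in> strip T"
  shows "(f has_derivative (\<lambda>v. Re v *\<^sub>R partial_x T f z + Im v *\<^sub>R partial_y T f z)) (at z within strip T)"
proof -
  let ?D = "frechet_derivative f (at z within strip T)"
  have "Ck_on (Suc 0) (strip T) f" using assms(1) unfolding smooth_on_def by blast
  then have D: "(f has_derivative ?D) (at z within strip T)"
    using assms(2) by (simp add: differentiable_on_def frechet_derivative_works)
  then have lin: "linear ?D" by (rule has_derivative_linear)
  have "?D v = Re v *\<^sub>R ?D 1 + Im v *\<^sub>R ?D \<i>" for v
  proof -
    have v: "Re v *\<^sub>R 1 + Im v *\<^sub>R \<i> = v" by (simp add: complex_eq_iff)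
    have "?D (Re v *\<^sub>R 1 + Im v *\<^sub>R \<i>) = Re v *\<^sub>R ?D 1 + Im v *\<^sub>R ?D \<i>"
      by (simp only: linear_add[OF lin] linear_scale[OF lin])
    then show ?thesis unfolding v .
  qed
  then show ?thesis
    unfolding partial_x_def partial_y_def by (intro has_derivative_eq_rhs[OF D] ext)
qed

theorem theorem1:
  fixes T :: real and \<omega> :: "complex \<Rightarrow> real"
  assumes "T > 0"
    and "smooth_on (strip T) \<omega>"
    and "singly_periodic T \<omega>"
    and "sinh_gordon T \<omega>"
    and "durham_boundary T \<omega>"
  shows "finite_type T \<omega>"
proof -
  obtain L where L: "L > 0" and per: "\<And>z. z \<in> strip T \<Longrightarrow> \<omega> (z + of_real L) = \<omega> z"
    using assms(3) unfolding singly_periodic_def by blast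
  obtain A1 B1 where bc1: "\<And>z. Im z = T \<Longrightarrow> partial_y T \<omega> z = A1 * exp (\<omega> z) + B1 * exp (- \<omega> z)"
    using assms(5) unfolding durham_boundary_def by blast
  obtain A2 B2 where bc2: "\<And>z. Im z = - T \<Longrightarrow> partial_y T \<omega> z = A2 * exp (\<omega> z) + B2 * exp (- \<omega> z)"
    using assms(5) unfolding durham_boundary_def by blast
  define p where "p = partial_x T \<omega>"
  define q where "q = partial_y T \<omega>"
  have sm: "smooth_on (strip T) p" "smooth_on (strip T) q"
    unfolding p_def q_def partial_x_def[abs_def] partial_y_def[abs_def]
    by (intro smooth_on_partial assms(2))+
  have d\<omega>: "(\<omega> has_derivative (\<lambda>v. Re v * p z + Im v * q z)) (at z within strip T)" if "z \<in> strip T" for z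
    using smooth_on_has_derivative[OF assms(2) that] by (simp add: p_def q_def)
  have dp: "(p has_derivative (\<lambda>v. Re v * partial_x T p z + Im v * partial_y T p z)) (at z within strip T)"
    and dq: "(q has_derivative (\<lambda>v. Re v * partial_x T q z + Im v * partial_y T q z)) (at z within strip T)"
    if "z \<in> strip T" for z
    using smooth_on_has_derivative[OF sm(1) that] smooth_on_has_derivative[OF sm(2) that] by simp_all
  have cont: "continuous_on (strip T) (partial_x T f)" "continuous_on (strip T) (partial_y T f)"
    if "smooth_on (strip T) f" for f :: "complex \<Rightarrow> real"
    using smooth_on_partial[OF that, of 1, unfolded smooth_on_def, rule_format, of 0]
      smooth_on_partial[OF that, of \<i>, unfolded smooth_on_def, rule_format, of 0]
    by (simp_all add: partial_x_def[abs_def] partial_y_def[abs_def])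
  \<comment> \<open>The translate of \<omega> is \<omega> itself, so the periodicity of its
    derivatives follows from their uniqueness.\<close>
  have pq: "p (z + of_real L) = p z \<and> q (z + of_real L) = q z" if z: "z \<in> strip T" for z
  proof -
    have sub: "(\<lambda>z. z + of_real L) ` strip T \<subseteq> strip T" by (auto simp: strip_def)
    have "((\<lambda>z. z + complex_of_real L) has_derivative (\<lambda>v. v)) (at z within strip T)"
      by (auto intro!: derivative_eq_intros)
    from has_derivative_in_compose2[OF d\<omega> sub z this]
    have "((\<lambda>z. \<omega> (z + of_real L)) has_derivative (\<lambda>v. Re v * p (z + of_real L) + Im v * q (z + of_real L))) (at z within strip T)" .
    from has_derivative_transform[OF z _ this, of \<omega>] per
    have "(\<omega> has_derivative (\<lambda>v. Re v * p (z + of_real L) + Im v * q (z + of_real L))) (at z within strip T)" by simp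
    from fun_cong[OF strip_derivative_unique[OF assms(1) z this d\<omega>[OF z]]]
    have e: "Re v * p (z + of_real L) + Im v * q (z + of_real L) = Re v * p z + Im v * q z" for v .
    show ?thesis using e[of 1] e[of \<i>] by simp
  qed
  \<comment> \<open>The real part of the complex equation is the equation for the Laplacian. Its
    imaginary part gives the symmetry of the mixed derivatives, because the hyperbolic sine term is
    real.\<close>
  have eq: "partial_y T p z = partial_x T q z \<and> partial_x T p z + partial_y T q z = - sinh (2 * \<omega> z) / 2"
    if z: "z \<in> strip T" for z
  proof -
    let ?w = "\<lambda>w. complex_of_real (\<omega> w)"
    have dz: "d_z T ?w z = (of_real (p z) - \<i> * of_real (q z)) / 2" if z: "z \<in> strip T" for z
    proof -
      have "(?w has_derivative (\<lambda>v. of_real (Re v * p z + Im v * q z))) (at z within strip T)"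
        by (rule bounded_linear.has_derivative[OF bounded_linear_of_real d\<omega>[OF z]])
      from strip_frechet_derivative[OF assms(1) z this] show ?thesis
        by (simp add: d_z_def partial_x_def partial_y_def)
    qed
    have "((\<lambda>z. (complex_of_real (p z) - \<i> * complex_of_real (q z)) / 2) has_derivative
        (\<lambda>v. (of_real (Re v * partial_x T p z + Im v * partial_y T p z)
          - \<i> * of_real (Re v * partial_x T q z + Im v * partial_y T q z)) / 2)) (at z within strip T)"
      by (intro bounded_linear.has_derivative[OF bounded_linear_divide] has_derivative_diff has_derivative_mult_right
          bounded_linear.has_derivative[OF bounded_linear_of_real] dp[OF z] dq[OF z])
    from has_derivative_transform[OF z dz this]
    have "(d_z T ?w has_derivative
        (\<lambda>v. (of_real (Re v * partial_x T p z + Im v * partial_y T p z)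
          - \<i> * of_real (Re v * partial_x T q z + Im v * partial_y T q z)) / 2)) (at z within strip T)" by simp
    from strip_frechet_derivative[OF assms(1) z this]
    have "d_zbar T (d_z T ?w) z = ((of_real (partial_x T p z) - \<i> * of_real (partial_x T q z)) / 2
        + \<i> * ((of_real (partial_y T p z) - \<i> * of_real (partial_y T q z)) / 2)) / 2"
      by (simp add: d_zbar_def partial_x_def[of T "d_z T ?w"] partial_y_def[of T "d_z T ?w"])
    moreover have "d_zbar T (d_z T ?w) z + of_real (sinh (2 * \<omega> z)) / 8 = 0"
      using assms(4) z unfolding sinh_gordon_def by blast
    ultimately show ?thesis by (simp add: complex_eq_iff)
  qed
  interpret durham_strip T L \<omega> p q "partial_x T p" "partial_y T p" "partial_x T q" "partial_y T q" A1 B1 A2 B2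
  proof (unfold_locales)
    fix z
    show "Im z = T \<Longrightarrow> q z = A1 * exp (\<omega> z) + B1 * exp (- \<omega> z)"
      "Im z = - T \<Longrightarrow> q z = A2 * exp (\<omega> z) + B2 * exp (- \<omega> z)"
      unfolding q_def by (fact bc1, fact bc2)
    assume z: "z \<in> strip T"
    show "p (z + of_real L) = p z" "q (z + of_real L) = q z" using pq[OF z] by auto
    show "partial_y T p z = partial_x T q z"
      "partial_x T p z + partial_y T q z = - sinh (2 * \<omega> z) / 2" using eq[OF z] by auto
    show "\<omega> (z + of_real L) = \<omega> z" by (rule per[OF z])
    show "(\<omega> has_derivative (\<lambda>v. Re v * p z + Im v * q z)) (at z within strip T)" by (rule d\<omega>[OF z])
    show "(p has_derivative (\<lambda>v. Re v * partial_x T p z + Im v * partial_y T p z)) (at z within strip T)" by (rule dp[OF z])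
    show "(q has_derivative (\<lambda>v. Re v * partial_x T q z + Im v * partial_y T q z)) (at z within strip T)" by (rule dq[OF z])
  qed (fact assms(1) L assms(2) sm cont[OF sm(1)] cont[OF sm(2)])+
  show ?thesis by (rule durham_finite_type)
qed

end
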